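(* Let $K\subseteq L\subseteq\mathcal A$ be differential fields of characteristic $0$, where $\mathcal A$ is a saturated differentially closed field with $|L|<|\mathcal A|$, and let $L/K$ be a strongly normal extension. Then $Gal(L/K)$ is isomorphic to a group interpretable in the field $C_{\mathcal A}$, where the interpretation is given by quantifier-free formulas of the language of rings with parameters from $C_K$; that is, there are $d\ge 1$, a subset $S\subseteq C_{\mathcal A}^d$, an equivalence relation $\sim$ on $S$ and a ternary relation $R$ on $S$, all defined in $C_{\mathcal A}$ by quantifier-free ring formulas with parameters from $C_K$, such that $R$ induces the graph of a group law on $S/\!\sim$ and $(S/\!\sim,R/\!\sim)$ is isomorphic to $(Gal(L/K),\circ)$.
   Context: For a differential field $F$, $C_F$ is its field of constants. $\langle A,B\rangle$ denotes the differential field generated by $A\cup B$ inside $\mathcal A$. $Hom_K(L,\mathcal A)$ is the set of differential field embeddings of $L$ into $\mathcal A$ fixing $K$ pointwise. An element $\tau\in Hom_K(L,\mathcal A)$ is strong if $\tau$ is the identity on $C_L$ and $\langle L,C_{\mathcal A}\rangle=\langle\tau(L),C_{\mathcal A}\rangle$. $L/K$ is strongly normal if $L$ is finitely generated as a differential field over $K$ and every $\tau\in Hom_K(L,\mathcal A)$ is strong. $Gal(L/K)$ is the group of differential field automorphisms of $\langle L,C_{\mathcal A}\rangle$ fixing $\langle K,C_{\mathcal A}\rangle$ pointwise. The field $C_K$ is not assumed algebraically closed. *)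

theory Defs
  imports Main "HOL-Library.Poly_Mapping" "HOL-Algebra.Group"
begin

text \<open>The ambient universal differential field \<open>\<A>\<close> is the whole type \<open>'a\<close>
  (of characteristic 0, class field_char_0) equipped with a derivation \<open>D\<close>.\<close>

definition derivation :: "('a::field \<Rightarrow> 'a) \<Rightarrow> bool" where
  "derivation D \<longleftrightarrow> (\<forall>x y. D (x + y) = D x + D y) \<and> (\<forall>x y. D (x * y) = x * D y + D x * y)"

definition diff_subfield :: "('a::field \<Rightarrow> 'a) \<Rightarrow> 'a set \<Rightarrow> bool" where
  "diff_subfield D F \<longleftrightarrow> 0 \<in> F \<and> 1 \<in> F \<and>
     (\<forall>x\<in>F. \<forall>y\<in>F. x + y \<in> F \<and> x * y \<in> F) \<and>
     (\<forall>x\<in>F. - x \<in> F \<and> inverse x \<in> F \<and> D x \<in> F)"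

definition consts_of :: "('a::field \<Rightarrow> 'a) \<Rightarrow> 'a set \<Rightarrow> 'a set" where
  "consts_of D F = {x \<in> F. D x = 0}"

definition dgen :: "('a::field \<Rightarrow> 'a) \<Rightarrow> 'a set \<Rightarrow> 'a set" where
  "dgen D A = \<Inter> {F. diff_subfield D F \<and> A \<subseteq> F}"

subsection \<open>Differential closedness (Blum's axioms)\<close>

text \<open>Ordinary polynomials in variables \<open>0,1,2,\<dots>\<close>; as differential polynomial in one
  differential indeterminate \<open>y\<close>, variable \<open>i\<close> stands for \<open>y\<^sup>(\<^sup>i\<^sup>)\<close>.\<close>
type_synonym 'a mpoly = "(nat \<Rightarrow>\<^sub>0 nat) \<Rightarrow>\<^sub>0 'a"

definition mpeval :: "'a::comm_ring_1 mpoly \<Rightarrow> (nat \<Rightarrow> 'a) \<Rightarrow> 'a" where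
  "mpeval p x = (\<Sum>m\<in>Poly_Mapping.keys p. Poly_Mapping.lookup p m *
                    (\<Prod>i\<in>Poly_Mapping.keys m. x i ^ Poly_Mapping.lookup m i))"

definition mpvars :: "'a::zero mpoly \<Rightarrow> nat set" where
  "mpvars p = (\<Union>m\<in>Poly_Mapping.keys p. Poly_Mapping.keys m)"

definition dorder :: "'a::zero mpoly \<Rightarrow> nat" where
  "dorder p = Max (mpvars p)"

definition deval :: "('a::comm_ring_1 \<Rightarrow> 'a) \<Rightarrow> 'a mpoly \<Rightarrow> 'a \<Rightarrow> 'a" where
  "deval D f a = mpeval f (\<lambda>i. (D ^^ i) a)"

definition diff_closed :: "('a::field \<Rightarrow> 'a) \<Rightarrow> bool" where
  "diff_closed D \<longleftrightarrow> derivation D \<and>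
     (\<forall>f g :: 'a mpoly. mpvars f \<noteq> {} \<longrightarrow> g \<noteq> 0 \<longrightarrow>
        (mpvars g = {} \<or> dorder g < dorder f) \<longrightarrow>
        (\<exists>a. deval D f a = 0 \<and> deval D g a \<noteq> 0))"

datatype 'a dterm = DVar nat | DConst 'a | DAdd "'a dterm" "'a dterm"
  | DMul "'a dterm" "'a dterm" | DNeg "'a dterm" | DDer "'a dterm"

datatype 'a dfm = DEq "'a dterm" "'a dterm" | DNot "'a dfm" | DAnd "'a dfm" "'a dfm"
  | DEx nat "'a dfm"

primrec dteval :: "('a::comm_ring_1 \<Rightarrow> 'a) \<Rightarrow> (nat \<Rightarrow> 'a) \<Rightarrow> 'a dterm \<Rightarrow> 'a" where
  "dteval D e (DVar n) = e n"
| "dteval D e (DConst c) = c"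
| "dteval D e (DAdd s t) = dteval D e s + dteval D e t"
| "dteval D e (DMul s t) = dteval D e s * dteval D e t"
| "dteval D e (DNeg s) = - dteval D e s"
| "dteval D e (DDer s) = D (dteval D e s)"

primrec dsat :: "('a::comm_ring_1 \<Rightarrow> 'a) \<Rightarrow> (nat \<Rightarrow> 'a) \<Rightarrow> 'a dfm \<Rightarrow> bool" where
  "dsat D e (DEq s t) \<longleftrightarrow> dteval D e s = dteval D e t"
| "dsat D e (DNot \<phi>) \<longleftrightarrow> \<not> dsat D e \<phi>"
| "dsat D e (DAnd \<phi> \<psi>) \<longleftrightarrow> dsat D e \<phi> \<and> dsat D e \<psi>"
| "dsat D e (DEx n \<phi>) \<longleftrightarrow> (\<exists>a. dsat D (e(n := a)) \<phi>)"

primrec dtparams :: "'a dterm \<Rightarrow> 'a set" where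
  "dtparams (DVar n) = {}"
| "dtparams (DConst c) = {c}"
| "dtparams (DAdd s t) = dtparams s \<union> dtparams t"
| "dtparams (DMul s t) = dtparams s \<union> dtparams t"
| "dtparams (DNeg s) = dtparams s"
| "dtparams (DDer s) = dtparams s"

primrec dparams :: "'a dfm \<Rightarrow> 'a set" where
  "dparams (DEq s t) = dtparams s \<union> dtparams t"
| "dparams (DNot \<phi>) = dparams \<phi>"
| "dparams (DAnd \<phi> \<psi>) = dparams \<phi> \<union> dparams \<psi>"
| "dparams (DEx n \<phi>) = dparams \<phi>"

text \<open>\<open>\<A>\<close> is saturated (i.e. \<open>|\<A>|\<close>-saturated): every finitely satisfiable set of
  formulas in one free variable with parameters from a set of size \<open>< |\<A>|\<close> is realized.
  A formula "in one variable" is evaluated by assigning that element to every variable.\<close>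
definition saturated :: "('a::comm_ring_1 \<Rightarrow> 'a) \<Rightarrow> bool" where
  "saturated D \<longleftrightarrow> (\<forall>(A::'a set) (p::'a dfm set).
     (card_of A, card_of (UNIV::'a set)) \<in> ordLess \<longrightarrow>
     (\<forall>\<phi>\<in>p. dparams \<phi> \<subseteq> A) \<longrightarrow>
     (\<forall>F. finite F \<and> F \<subseteq> p \<longrightarrow> (\<exists>a. \<forall>\<phi>\<in>F. dsat D (\<lambda>_. a) \<phi>)) \<longrightarrow>
     (\<exists>a. \<forall>\<phi>\<in>p. dsat D (\<lambda>_. a) \<phi>))"

definition diff_hom :: "('a::field \<Rightarrow> 'a) \<Rightarrow> 'a set \<Rightarrow> 'a set \<Rightarrow> ('a \<Rightarrow> 'a) set" where
  "diff_hom D K L = {\<tau>. inj_on \<tau> L \<and>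
      (\<forall>x\<in>L. \<forall>y\<in>L. \<tau> (x + y) = \<tau> x + \<tau> y \<and> \<tau> (x * y) = \<tau> x * \<tau> y) \<and> \<tau> 1 = 1 \<and>
      (\<forall>x\<in>L. \<tau> (D x) = D (\<tau> x)) \<and> (\<forall>x\<in>K. \<tau> x = x)}"

definition strong :: "('a::field \<Rightarrow> 'a) \<Rightarrow> 'a set \<Rightarrow> ('a \<Rightarrow> 'a) \<Rightarrow> bool" where
  "strong D L \<tau> \<longleftrightarrow> (\<forall>x\<in>consts_of D L. \<tau> x = x) \<and>
      dgen D (L \<union> consts_of D UNIV) = dgen D (\<tau> ` L \<union> consts_of D UNIV)"

definition strongly_normal :: "('a::field \<Rightarrow> 'a) \<Rightarrow> 'a set \<Rightarrow> 'a set \<Rightarrow> bool" where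
  "strongly_normal D K L \<longleftrightarrow> (\<exists>F. finite F \<and> L = dgen D (K \<union> F)) \<and>
      (\<forall>\<tau>\<in>diff_hom D K L. strong D L \<tau>)"

definition gal_set :: "('a::field \<Rightarrow> 'a) \<Rightarrow> 'a set \<Rightarrow> 'a set \<Rightarrow> ('a \<Rightarrow> 'a) set" where
  "gal_set D K L = (let M = dgen D (L \<union> consts_of D UNIV); N = dgen D (K \<union> consts_of D UNIV) in
     {\<sigma>. \<sigma> \<in> extensional M \<and> bij_betw \<sigma> M M \<and>
       (\<forall>x\<in>M. \<forall>y\<in>M. \<sigma> (x + y) = \<sigma> x + \<sigma> y \<and> \<sigma> (x * y) = \<sigma> x * \<sigma> y) \<and>
       (\<forall>x\<in>M. \<sigma> (D x) = D (\<sigma> x)) \<and> (\<forall>x\<in>N. \<sigma> x = x)})"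

definition gal_group :: "('a::field \<Rightarrow> 'a) \<Rightarrow> 'a set \<Rightarrow> 'a set \<Rightarrow> ('a \<Rightarrow> 'a) monoid" where
  "gal_group D K L = (let M = dgen D (L \<union> consts_of D UNIV) in
     \<lparr>carrier = gal_set D K L, mult = (\<lambda>\<sigma> \<tau>. restrict (\<sigma> \<circ> \<tau>) M), one = restrict id M\<rparr>)"

datatype 'a rterm = RVar nat | RConst 'a | RAdd "'a rterm" "'a rterm"
  | RMul "'a rterm" "'a rterm" | RNeg "'a rterm"

datatype 'a qfm = REq "'a rterm" "'a rterm" | RNot "'a qfm" | RAnd "'a qfm" "'a qfm"
  | ROr "'a qfm" "'a qfm"

primrec rteval :: "'a::comm_ring_1 list \<Rightarrow> 'a rterm \<Rightarrow> 'a" where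
  "rteval xs (RVar n) = xs ! n"
| "rteval xs (RConst c) = c"
| "rteval xs (RAdd s t) = rteval xs s + rteval xs t"
| "rteval xs (RMul s t) = rteval xs s * rteval xs t"
| "rteval xs (RNeg s) = - rteval xs s"

primrec qsat :: "'a::comm_ring_1 list \<Rightarrow> 'a qfm \<Rightarrow> bool" where
  "qsat xs (REq s t) \<longleftrightarrow> rteval xs s = rteval xs t"
| "qsat xs (RNot \<phi>) \<longleftrightarrow> \<not> qsat xs \<phi>"
| "qsat xs (RAnd \<phi> \<psi>) \<longleftrightarrow> qsat xs \<phi> \<and> qsat xs \<psi>"
| "qsat xs (ROr \<phi> \<psi>) \<longleftrightarrow> qsat xs \<phi> \<or> qsat xs \<psi>"

primrec rtparams :: "'a rterm \<Rightarrow> 'a set" where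
  "rtparams (RVar n) = {}"
| "rtparams (RConst c) = {c}"
| "rtparams (RAdd s t) = rtparams s \<union> rtparams t"
| "rtparams (RMul s t) = rtparams s \<union> rtparams t"
| "rtparams (RNeg s) = rtparams s"

primrec qparams :: "'a qfm \<Rightarrow> 'a set" where
  "qparams (REq s t) = rtparams s \<union> rtparams t"
| "qparams (RNot \<phi>) = qparams \<phi>"
| "qparams (RAnd \<phi> \<psi>) = qparams \<phi> \<union> qparams \<psi>"
| "qparams (ROr \<phi> \<psi>) = qparams \<phi> \<union> qparams \<psi>"

definition qf_defined :: "'a::comm_ring_1 set \<Rightarrow> nat \<Rightarrow> 'a qfm \<Rightarrow> 'a list set" where
  "qf_defined C n \<phi> = {xs. length xs = n \<and> set xs \<subseteq> C \<and> qsat xs \<phi>}"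

end

theory Submission
  imports Defs "HOL-Computational_Algebra.Polynomial"
begin

text \<open>
  Write \<open>C\<close> for the constants of \<open>\<A>\<close> and \<open>a\<close> for a finite tuple generating \<open>L\<close> over \<open>K\<close>.
  Embeddings of finitely generated differential fields into \<open>\<A>\<close> extend (Blum's axioms and saturation),
  so strong normality forces \<open>C\<^sub>L = C\<^sub>K\<close>, and by compactness finitely many \<open>l\<^sub>k \<in> K{a}\<close> suffice to write
  \<open>\<sigma>(a)\<close>, for every \<open>\<sigma> \<in> Gal(L/K)\<close>, as a quotient \<open>h(a, c)\<close> of linear combinations of the \<open>l\<^sub>k\<close> with
  coefficients \<open>c\<close> in \<open>C\<close>.  Restriction to \<open>L\<close> identifies \<open>Gal(L/K)\<close> with the embeddings of \<open>L\<close> over \<open>K\<close>.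

  A pair \<open>(c, c')\<close> of coefficient tuples codes an automorphism and its inverse.  Put \<open>b = h(a, c)\<close> and
  \<open>b' = h(a, c')\<close>, and require that \<open>b\<close> and \<open>b'\<close> are differential specialisations of \<open>a\<close> over \<open>K\<close> and
  \<open>h(b', c) = a\<close>.  Then \<open>a \<mapsto> b\<close> is injective on \<open>K{a}\<close>: if \<open>t(b) = 0\<close>, then the numerator of
  \<open>t(h(a, c))\<close> vanishes, hence so does that of \<open>t(h(b', c)) = t(a)\<close>.  The conditions are polynomial
  equations and inequations in \<open>(c, c')\<close> over \<open>L\<close>; Hilbert's basis theorem makes them finite in number, and
  linear disjointness of \<open>L\<close> and \<open>C\<close> over \<open>C\<^sub>L = C\<^sub>K\<close> replaces their coefficients by elements of \<open>C\<^sub>K\<close>.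
  Equality and composition of the coded automorphisms are treated in the same way.
\<close>

text \<open>The form of the codes is dictated by the ban on quantifiers. That \<open>b\<close>
  satisfies every equation of \<open>a\<close> over \<open>K\<close> is an infinite conjunction of
  equations, to which noetherianity applies; that \<open>b\<close> satisfies no further equation is
  an infinite conjunction of inequations, to which it does not. The inverse is a finite witness for
  the latter, and since no quantifier may range over the witness, it has to be carried in the tuple.
  Neither coefficient tuple is determined by the automorphism, which is why the group lives on a
  quotient. Partial isomorphisms are sets of pairs closed under the field operations.
  Well-definedness and injectivity then become one symmetric condition, that \<open>u\<close> and
  \<open>v\<close> vanish together, and a relation can be closed under the operations before it is
  known to be a map. Blum's axioms speak of one equation and one inequation in a single unknown, so
  embeddings are extended one element at a time.\<close>

section \<open>Derivations and differential subfields\<close>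

lemma derivation_add: "derivation D \<Longrightarrow> D (x + y) = D x + D y"
  and derivation_mult: "derivation D \<Longrightarrow> D (x * y) = x * D y + D x * y"
  by (auto simp: derivation_def)

lemma derivation_0: assumes "derivation D" shows "D 0 = 0"
  using derivation_add[OF assms, of 0 0] by (metis add_0 add_cancel_right_right)

lemma derivation_1: assumes "derivation D" shows "D 1 = 0"
  using derivation_mult[OF assms, of 1 1] by (metis add_cancel_right_right mult_1 mult_1_right)

lemma derivation_minus: assumes "derivation D" shows "D (- x) = - D x"
  using derivation_add[OF assms, of x "- x"] derivation_0[OF assms]
  by (simp add: eq_neg_iff_add_eq_0 add.commute)

lemma derivation_diff: assumes "derivation D" shows "D (x - y) = D x - D y"
  using derivation_add[OF assms, of x "- y"] derivation_minus[OF assms] by simp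

lemma derivation_inverse:
  assumes "derivation D"
  shows "D (inverse x) = - (D x * (inverse x * inverse x))"
proof (cases "x = 0")
  case False
  have "x * D (inverse x) + D x * inverse x = 0"
    using derivation_mult[OF assms, of x "inverse x"] derivation_1[OF assms] False by simp
  hence "inverse x * (x * D (inverse x) + D x * inverse x) = 0" by simp
  hence "D (inverse x) + D x * (inverse x * inverse x) = 0"
    using False by (simp add: distrib_left mult.assoc[symmetric]) (simp add: mult_ac)
  thus ?thesis by (simp add: eq_neg_iff_add_eq_0)
qed (use derivation_0[OF assms] in simp)

lemma derivation_divide:
  assumes "derivation D" "y \<noteq> 0"
  shows "D (x / y) = (D x * y - x * D y) / (y * y)"
proof -
  have "D (x / y) = D x * inverse y - x * (D y * (inverse y * inverse y))"
    by (simp add: divide_inverse derivation_mult[OF assms(1)] derivation_inverse[OF assms(1)])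
  also have "\<dots> = (D x * y - x * D y) * (inverse y * inverse y)"
    using assms(2) by (simp add: left_diff_distrib mult.assoc)
  finally show ?thesis by (simp add: divide_inverse)
qed

lemma derivation_sum: assumes "derivation D" shows "D (sum f I) = (\<Sum>i\<in>I. D (f i))"
  by (induction I rule: infinite_finite_induct)
    (auto simp: derivation_0[OF assms] derivation_add[OF assms])

text \<open>The part of \<open>D\<close> that acts on the coefficients is kept apart from the chain
  rule term; at a simple root this determines \<open>D x\<close>.\<close>

lemma derivation_poly:
  assumes "derivation D"
  shows "D (poly p x) = poly (map_poly D p) x + poly (pderiv p) x * D x"
  by (induction p)
    (auto simp: derivation_0[OF assms] derivation_add[OF assms] derivation_mult[OF assms]
      map_poly_pCons pderiv_pCons algebra_simps)

lemma diff_subfieldD: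
  assumes "diff_subfield D F"
  shows "0 \<in> F" "1 \<in> F" "x \<in> F \<Longrightarrow> y \<in> F \<Longrightarrow> x + y \<in> F" "x \<in> F \<Longrightarrow> y \<in> F \<Longrightarrow> x * y \<in> F"
    "x \<in> F \<Longrightarrow> - x \<in> F" "x \<in> F \<Longrightarrow> inverse x \<in> F" "x \<in> F \<Longrightarrow> D x \<in> F"
    "x \<in> F \<Longrightarrow> y \<in> F \<Longrightarrow> x - y \<in> F" "x \<in> F \<Longrightarrow> y \<in> F \<Longrightarrow> x / y \<in> F"
  using assms unfolding diff_subfield_def divide_inverse diff_conv_add_uminus[of x y] by blast+

lemma diff_subfield_sum:
  assumes "diff_subfield D F" "\<And>i. i \<in> I \<Longrightarrow> f i \<in> F" shows "sum f I \<in> F"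
  using assms(2) by (induction I rule: infinite_finite_induct) (auto simp: diff_subfieldD[OF assms(1)])

lemma diff_subfield_dgen: "diff_subfield D (dgen D A)"
  unfolding dgen_def diff_subfield_def by auto

lemma dgen_superset: "A \<subseteq> dgen D A"
  unfolding dgen_def by auto

lemma dgen_least: "diff_subfield D F \<Longrightarrow> A \<subseteq> F \<Longrightarrow> dgen D A \<subseteq> F"
  unfolding dgen_def by auto

lemma dgen_mono: "A \<subseteq> B \<Longrightarrow> dgen D A \<subseteq> dgen D B"
  by (meson dgen_least dgen_superset diff_subfield_dgen order_trans)

lemma diff_subfield_constants:
  assumes "derivation D" "diff_subfield D F" shows "diff_subfield D (consts_of D F)"
  using assms(2) derivation_add[OF assms(1)] derivation_mult[OF assms(1)] derivation_minus[OF assms(1)]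
    derivation_inverse[OF assms(1)] derivation_0[OF assms(1)] derivation_1[OF assms(1)]
  unfolding diff_subfield_def consts_of_def by auto

section \<open>Partial isomorphisms as fields of pairs\<close>

text \<open>The graph of an isomorphism between two subfields. The last clause, applied to
  differences of pairs, says both that the relation is single-valued and that it is
  injective.\<close>

definition pair_field :: "('a::field \<times> 'a) set \<Rightarrow> bool" where
  "pair_field \<Theta> \<longleftrightarrow> (0, 0) \<in> \<Theta> \<and> (1, 1) \<in> \<Theta> \<and>
     (\<forall>u v u' v'. (u, v) \<in> \<Theta> \<longrightarrow> (u', v') \<in> \<Theta> \<longrightarrow> (u + u', v + v') \<in> \<Theta> \<and> (u * u', v * v') \<in> \<Theta>) \<and>
     (\<forall>u v. (u, v) \<in> \<Theta> \<longrightarrow> (- u, - v) \<in> \<Theta> \<and> (inverse u, inverse v) \<in> \<Theta> \<and> (u = 0 \<longleftrightarrow> v = 0))"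

definition diff_pair_field :: "('a::field \<Rightarrow> 'a) \<Rightarrow> ('a \<times> 'a) set \<Rightarrow> bool" where
  "diff_pair_field D \<Theta> \<longleftrightarrow> pair_field \<Theta> \<and> (\<forall>u v. (u, v) \<in> \<Theta> \<longrightarrow> (D u, D v) \<in> \<Theta>)"

inductive_set pair_gen :: "('a::field \<times> 'a) set \<Rightarrow> ('a \<times> 'a) set" for G where
  gen: "g \<in> G \<Longrightarrow> g \<in> pair_gen G"
| zero: "(0, 0) \<in> pair_gen G"
| one: "(1, 1) \<in> pair_gen G"
| add: "(u, v) \<in> pair_gen G \<Longrightarrow> (u', v') \<in> pair_gen G \<Longrightarrow> (u + u', v + v') \<in> pair_gen G"
| mult: "(u, v) \<in> pair_gen G \<Longrightarrow> (u', v') \<in> pair_gen G \<Longrightarrow> (u * u', v * v') \<in> pair_gen G"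
| uminus: "(u, v) \<in> pair_gen G \<Longrightarrow> (- u, - v) \<in> pair_gen G"
| inverse: "(u, v) \<in> pair_gen G \<Longrightarrow> (inverse u, inverse v) \<in> pair_gen G"

lemma pair_fieldD:
  assumes "pair_field \<Theta>"
  shows "(0, 0) \<in> \<Theta>" "(1, 1) \<in> \<Theta>"
    "(u, v) \<in> \<Theta> \<Longrightarrow> (u', v') \<in> \<Theta> \<Longrightarrow> (u + u', v + v') \<in> \<Theta>"
    "(u, v) \<in> \<Theta> \<Longrightarrow> (u', v') \<in> \<Theta> \<Longrightarrow> (u * u', v * v') \<in> \<Theta>"
    "(u, v) \<in> \<Theta> \<Longrightarrow> (- u, - v) \<in> \<Theta>" "(u, v) \<in> \<Theta> \<Longrightarrow> (inverse u, inverse v) \<in> \<Theta>"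
    "(u, v) \<in> \<Theta> \<Longrightarrow> u = 0 \<longleftrightarrow> v = 0"
  using assms unfolding pair_field_def by auto

lemma pair_field_diff:
  assumes "pair_field \<Theta>" "(u, v) \<in> \<Theta>" "(u', v') \<in> \<Theta>" shows "(u - u', v - v') \<in> \<Theta>"
  using pair_fieldD(3)[OF assms(1,2) pair_fieldD(5)[OF assms(1,3)]] by simp

lemma pair_field_divide:
  assumes "pair_field \<Theta>" "(u, v) \<in> \<Theta>" "(u', v') \<in> \<Theta>" shows "(u / u', v / v') \<in> \<Theta>"
  using pair_fieldD(4)[OF assms(1,2) pair_fieldD(6)[OF assms(1,3)]] by (simp add: divide_inverse)

lemma pair_field_sum:
  assumes "pair_field \<Theta>" "\<And>i. i \<in> I \<Longrightarrow> (f i, g i) \<in> \<Theta>" shows "(sum f I, sum g I) \<in> \<Theta>"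
  using assms(2) by (induction I rule: infinite_finite_induct) (auto simp: pair_fieldD[OF assms(1)])

lemma pair_field_power:
  assumes "pair_field \<Theta>" "(u, v) \<in> \<Theta>" shows "(u ^ n, v ^ n) \<in> \<Theta>"
  using assms(2) by (induction n) (auto simp: pair_fieldD[OF assms(1)])

lemma pair_field_eq_iff:
  assumes "pair_field \<Theta>" "(u, v) \<in> \<Theta>" "(u', v') \<in> \<Theta>" shows "u = u' \<longleftrightarrow> v = v'"
  using pair_fieldD(7)[OF assms(1) pair_field_diff[OF assms]] by simp

lemma pair_field_converse: "pair_field \<Theta> \<Longrightarrow> pair_field (\<Theta>\<inverse>)"
  unfolding pair_field_def by simp

lemma pair_gen_mono: "G \<subseteq> H \<Longrightarrow> pair_gen G \<subseteq> pair_gen H"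
proof
  fix g assume "G \<subseteq> H" "g \<in> pair_gen G"
  from this(2,1) show "g \<in> pair_gen H"
    by (induction rule: pair_gen.induct) (auto intro: pair_gen.intros)
qed

lemma pair_gen_le:
  assumes "G \<subseteq> pair_gen H" shows "pair_gen G \<subseteq> pair_gen H"
proof
  fix g assume "g \<in> pair_gen G"
  thus "g \<in> pair_gen H"
    using assms by (induction rule: pair_gen.induct) (auto intro: pair_gen.intros)
qed

lemma pair_gen_least:
  assumes "pair_field \<Theta>" "G \<subseteq> \<Theta>" shows "pair_gen G \<subseteq> \<Theta>"
proof
  fix g assume "g \<in> pair_gen G"
  thus "g \<in> \<Theta>"
    using assms(2) by (induction rule: pair_gen.induct) (auto intro: pair_fieldD[OF assms(1)])
qed

text \<open>Generation already builds in all closure properties, so compatibility with zero is the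
  only thing left to prove for an extended relation.\<close>

lemma pair_field_pair_gen:
  "pair_field (pair_gen G) \<longleftrightarrow> (\<forall>u v. (u, v) \<in> pair_gen G \<longrightarrow> u = 0 \<longleftrightarrow> v = 0)"
  unfolding pair_field_def by (auto intro: pair_gen.intros)

lemma pair_gen_converse: "(u, v) \<in> pair_gen G \<Longrightarrow> (v, u) \<in> pair_gen (G\<inverse>)"
proof -
  have "case z of (u, v) \<Rightarrow> (v, u) \<in> pair_gen (G\<inverse>)" if "z \<in> pair_gen G" for z
    using that by (induction rule: pair_gen.induct) (auto intro: pair_gen.intros)
  thus "(u, v) \<in> pair_gen G \<Longrightarrow> (v, u) \<in> pair_gen (G\<inverse>)" by blast
qed

text \<open>The sum, product and inverse rules reduce the claim to generators. \<open>G\<close> and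
  \<open>H\<close> are kept distinct because differentiating the field generated by derivatives up
  to one order leads into the field of the next order.\<close>

lemma pair_gen_derivation:
  assumes D: "derivation D" and G: "\<And>u v. (u, v) \<in> G \<Longrightarrow> (D u, D v) \<in> pair_gen H" and "G \<subseteq> pair_gen H"
  shows "(u, v) \<in> pair_gen G \<Longrightarrow> (D u, D v) \<in> pair_gen H"
proof -
  have sub: "pair_gen G \<subseteq> pair_gen H" by (rule pair_gen_le[OF assms(3)])
  have "(case z of (u, v) \<Rightarrow> (D u, D v) \<in> pair_gen H)" if "z \<in> pair_gen G" for z
    using that
  proof (induction rule: pair_gen.induct)
    case (mult u v u' v')
    have "(u * D u' + D u * u', v * D v' + D v * v') \<in> pair_gen H"
      using mult sub by (intro pair_gen.add pair_gen.mult) auto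
    thus ?case by (simp add: derivation_mult[OF D])
  next
    case (inverse u v)
    have "(- (D u * (inverse u * inverse u)), - (D v * (inverse v * inverse v))) \<in> pair_gen H"
      using inverse sub by (intro pair_gen.uminus pair_gen.mult pair_gen.inverse) auto
    thus ?case by (simp add: derivation_inverse[OF D])
  qed (use G in \<open>auto intro: pair_gen.intros simp: derivation_0[OF D] derivation_1[OF D]
       derivation_add[OF D] derivation_minus[OF D]\<close>)
  thus "(u, v) \<in> pair_gen G \<Longrightarrow> (D u, D v) \<in> pair_gen H" by blast
qed

section \<open>Simple extensions of partial isomorphisms\<close>

text \<open>For a pair field, \<open>q\<close> is the polynomial obtained from \<open>p\<close> by
  applying the isomorphism to the coefficients.\<close>

definition poly_pair :: "('a::field \<times> 'a) set \<Rightarrow> 'a poly \<Rightarrow> 'a poly \<Rightarrow> bool" where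
  "poly_pair \<Theta> p q \<longleftrightarrow> (\<forall>i. (coeff p i, coeff q i) \<in> \<Theta>)"

lemma poly_pair_closed:
  assumes "pair_field \<Theta>"
  shows "poly_pair \<Theta> p q \<Longrightarrow> poly_pair \<Theta> p' q' \<Longrightarrow> poly_pair \<Theta> (p + p') (q + q')"
    "poly_pair \<Theta> p q \<Longrightarrow> poly_pair \<Theta> p' q' \<Longrightarrow> poly_pair \<Theta> (p - p') (q - q')"
    "poly_pair \<Theta> p q \<Longrightarrow> poly_pair \<Theta> (- p) (- q)"
    "poly_pair \<Theta> p q \<Longrightarrow> poly_pair \<Theta> p' q' \<Longrightarrow> poly_pair \<Theta> (p * p') (q * q')"
    "(u, v) \<in> \<Theta> \<Longrightarrow> poly_pair \<Theta> (monom u n) (monom v n)"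
    "(u, v) \<in> \<Theta> \<Longrightarrow> poly_pair \<Theta> [:u:] [:v:]"
    "poly_pair \<Theta> 0 0" "poly_pair \<Theta> 1 1"
  using assms unfolding poly_pair_def coeff_mult
  by (auto intro: pair_fieldD(1-5)[OF assms] intro!: pair_field_sum[OF assms] pair_field_diff[OF assms]
      pair_fieldD(4)[OF assms]
      simp: coeff_pCons split: nat.splits)

lemma poly_pair_0_iff: "pair_field \<Theta> \<Longrightarrow> poly_pair \<Theta> p q \<Longrightarrow> p = 0 \<longleftrightarrow> q = 0"
  by (auto simp: poly_eq_iff poly_pair_def dest: pair_fieldD(7))

lemma poly_pair_degree: "pair_field \<Theta> \<Longrightarrow> poly_pair \<Theta> p q \<Longrightarrow> degree p = degree q"
  unfolding degree_def poly_pair_def using pair_fieldD(7) by metis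

lemma poly_pair_poly:
  assumes "pair_field \<Theta>" "poly_pair \<Theta> p q" "(x, y) \<in> \<Theta>"
  shows "(poly p x, poly q y) \<in> \<Theta>"
  using assms(2) unfolding poly_altdef poly_pair_degree[OF assms(1,2)] poly_pair_def
  by (intro pair_field_sum[OF assms(1)] pair_fieldD[OF assms(1)] pair_field_power[OF assms(1)] assms) auto

text \<open>Every generated pair is a pair of quotients of values of corresponding polynomials at
  \<open>x\<close> and \<open>y\<close>, so the test for zero reduces to the numerators, where it is
  the hypothesis.\<close>

lemma pair_field_adjoin:
  assumes \<Theta>: "pair_field \<Theta>"
    and xy: "\<And>p q. poly_pair \<Theta> p q \<Longrightarrow> poly p x = 0 \<longleftrightarrow> poly q y = 0"
  shows "pair_field (pair_gen (insert (x, y) \<Theta>))"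
proof -
  define W where "W = (\<lambda>(u, v). \<exists>p q r s. poly_pair \<Theta> p q \<and> poly_pair \<Theta> r s \<and> poly r x \<noteq> 0 \<and> poly s y \<noteq> 0
      \<and> u = poly p x / poly r x \<and> v = poly q y / poly s y)"
  note c = poly_pair_closed[OF \<Theta>]
  have base: "W (poly p x, poly q y)" if "poly_pair \<Theta> p q" for p q
    unfolding W_def prod.case
    by (rule exI[of _ p], rule exI[of _ q], rule exI[of _ 1], rule exI[of _ 1]) (use that c in auto)
  have "W z" if "z \<in> pair_gen (insert (x, y) \<Theta>)" for z
    using that
  proof (induction rule: pair_gen.induct)
    case (gen g)
    show ?case
    proof (cases "g = (x, y)")
      case True
      thus ?thesis using base[of "monom 1 1" "monom 1 1"] c(5)[of 1 1 1] pair_fieldD(2)[OF \<Theta>]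
        by (simp add: poly_monom)
    next
      case False
      then show ?thesis using base[of "[:fst g:]" "[:snd g:]"] c(6)[of "fst g" "snd g"] gen by simp
    qed
  next
    case zero show ?case using base[OF c(7)] by simp
  next
    case one show ?case using base[OF c(8)] by simp
  next
    case (add u v u' v')
    then obtain p q r s p' q' r' s' where *: "poly_pair \<Theta> p q" "poly_pair \<Theta> r s" "poly r x \<noteq> 0" "poly s y \<noteq> 0"
      "u = poly p x / poly r x" "v = poly q y / poly s y"
      "poly_pair \<Theta> p' q'" "poly_pair \<Theta> r' s'" "poly r' x \<noteq> 0" "poly s' y \<noteq> 0"
      "u' = poly p' x / poly r' x" "v' = poly q' y / poly s' y" unfolding W_def by blast
    show ?case unfolding W_def prod.case
      apply (rule exI[of _ "p * r' + p' * r"], rule exI[of _ "q * s' + q' * s"],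
          rule exI[of _ "r * r'"], rule exI[of _ "s * s'"])
      using * c by (simp add: add_frac_eq mult_ac)
  next
    case (mult u v u' v')
    then obtain p q r s p' q' r' s' where *: "poly_pair \<Theta> p q" "poly_pair \<Theta> r s" "poly r x \<noteq> 0" "poly s y \<noteq> 0"
      "u = poly p x / poly r x" "v = poly q y / poly s y"
      "poly_pair \<Theta> p' q'" "poly_pair \<Theta> r' s'" "poly r' x \<noteq> 0" "poly s' y \<noteq> 0"
      "u' = poly p' x / poly r' x" "v' = poly q' y / poly s' y" unfolding W_def by blast
    show ?case unfolding W_def prod.case
      apply (rule exI[of _ "p * p'"], rule exI[of _ "q * q'"],
          rule exI[of _ "r * r'"], rule exI[of _ "s * s'"])
      using * c by simp
  next
    case (uminus u v)
    then obtain p q r s where *: "poly_pair \<Theta> p q" "poly_pair \<Theta> r s" "poly r x \<noteq> 0" "poly s y \<noteq> 0"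
      "u = poly p x / poly r x" "v = poly q y / poly s y" unfolding W_def by blast
    show ?case unfolding W_def prod.case
      apply (rule exI[of _ "- p"], rule exI[of _ "- q"], rule exI[of _ r], rule exI[of _ s])
      using * c by simp
  next
    case (inverse u v)
    then obtain p q r s where *: "poly_pair \<Theta> p q" "poly_pair \<Theta> r s" "poly r x \<noteq> 0" "poly s y \<noteq> 0"
      "u = poly p x / poly r x" "v = poly q y / poly s y" unfolding W_def by blast
    show ?case
    \<comment> \<open>Since \<open>inverse 0 = 0\<close>, a vanishing numerator cannot be moved to
      the denominator; the hypothesis makes both numerators vanish together, and the pair is
      \<open>(0, 0)\<close>.\<close>
    proof (cases "poly p x = 0")
      case True
      hence "poly q y = 0" using xy[OF *(1)] by simp
      thus ?thesis using True * base[OF c(7)] by simp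
    next
      case False
      show ?thesis unfolding W_def prod.case
        apply (rule exI[of _ r], rule exI[of _ s], rule exI[of _ p], rule exI[of _ q])
        using * False xy[OF *(1)] by auto
    qed
  qed
  hence "u = 0 \<longleftrightarrow> v = 0" if "(u, v) \<in> pair_gen (insert (x, y) \<Theta>)" for u v
    using that xy unfolding W_def by fastforce
  thus ?thesis unfolding pair_field_pair_gen by blast
qed

text \<open>On either side a polynomial vanishes only if it is the zero polynomial, and being zero
  is preserved by the isomorphism.\<close>

lemma pair_field_adjoin_transcendental:
  assumes \<Theta>: "pair_field \<Theta>"
    and x: "\<And>p. p \<noteq> 0 \<Longrightarrow> (\<And>i. coeff p i \<in> Domain \<Theta>) \<Longrightarrow> poly p x \<noteq> 0"
    and y: "\<And>p. p \<noteq> 0 \<Longrightarrow> (\<And>i. coeff p i \<in> Range \<Theta>) \<Longrightarrow> poly p y \<noteq> 0"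
  shows "pair_field (pair_gen (insert (x, y) \<Theta>))"
proof (rule pair_field_adjoin[OF \<Theta>])
  fix p q assume pq: "poly_pair \<Theta> p q"
  hence "coeff p i \<in> Domain \<Theta>" "coeff q i \<in> Range \<Theta>" for i
    unfolding poly_pair_def by (auto)
  hence "poly p x = 0 \<longleftrightarrow> p = 0" "poly q y = 0 \<longleftrightarrow> q = 0"
    using x[of p] y[of q] by fastforce+
  thus "poly p x = 0 \<longleftrightarrow> poly q y = 0" using poly_pair_0_iff[OF \<Theta> pq] by simp
qed

text \<open>Long division uses only field operations on coefficients, so running it on both sides at
  once produces corresponding quotients and remainders.\<close>

lemma poly_pair_division:
  assumes \<Theta>: "pair_field \<Theta>" and fg: "poly_pair \<Theta> f g" "f \<noteq> 0" and "poly_pair \<Theta> p q"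
  shows "\<exists>s s' r r'. poly_pair \<Theta> s s' \<and> poly_pair \<Theta> r r' \<and> p = s * f + r \<and> q = s' * g + r'
     \<and> (r = 0 \<or> degree r < degree f)"
  using assms(4)
proof (induction "degree p" arbitrary: p q rule: less_induct)
  case less
  note c = poly_pair_closed[OF \<Theta>]
  show ?case
  proof (cases "p = 0 \<or> degree p < degree f")
    case True
    show ?thesis by (rule exI[of _ 0], rule exI[of _ 0], rule exI[of _ p], rule exI[of _ q])
        (use True c less.prems in auto)
  next
    case False
    define n where "n = degree p - degree f"
    define m where "m = monom (lead_coeff p / lead_coeff f) n"
    define m' where "m' = monom (lead_coeff q / lead_coeff g) n"
    have dg: "degree g = degree f" "degree q = degree p"
      using poly_pair_degree[OF \<Theta>] fg less.prems by metis+
    have g0: "g \<noteq> 0" using poly_pair_0_iff[OF \<Theta> fg(1)] fg(2) by simp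
    have mm: "poly_pair \<Theta> m m'" unfolding m_def m'_def dg
      using less.prems fg(1) unfolding poly_pair_def[of _ p] poly_pair_def[of _ f]
      by (intro c(5) pair_field_divide[OF \<Theta>]) auto
    define p1 where "p1 = p - m * f"
    define q1 where "q1 = q - m' * g"
    have pq1: "poly_pair \<Theta> p1 q1" unfolding p1_def q1_def
      by (intro c less.prems mm fg)
    have m0: "m \<noteq> 0" using False fg(2) unfolding m_def by simp
    have degm: "degree m = n" using False fg(2) unfolding m_def by (intro degree_monom_eq) auto
    hence deg: "degree (m * f) = degree p"
      using False fg(2) m0 by (simp add: degree_mult_eq n_def)
    have lc: "coeff (m * f) (degree p) = lead_coeff p"
    proof -
      have "coeff (m * f) (degree p) = lead_coeff (m * f)" using deg by simp
      also have "\<dots> = lead_coeff m * lead_coeff f" by (rule lead_coeff_mult)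
      also have "\<dots> = lead_coeff p" using fg(2) unfolding degm by (simp add: m_def)
      finally show ?thesis .
    qed
    have p1: "p1 = 0 \<or> degree p1 < degree p"
    proof (rule disjCI)
      assume "\<not> degree p1 < degree p"
      moreover have "degree p1 \<le> degree p" unfolding p1_def
        using deg by (metis degree_diff_le order_refl)
      ultimately have "degree p1 = degree p" by simp
      moreover have "coeff p1 (degree p) = 0" unfolding p1_def using lc by simp
      ultimately show "p1 = 0" by (metis leading_coeff_0_iff)
    qed
    have "\<exists>s s' r r'. poly_pair \<Theta> s s' \<and> poly_pair \<Theta> r r' \<and> p1 = s * f + r \<and> q1 = s' * g + r'
     \<and> (r = 0 \<or> degree r < degree f)"
    proof (cases "p1 = 0")
      case True
      hence "q1 = 0" using poly_pair_0_iff[OF \<Theta> pq1] by simp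
      thus ?thesis using True c by (intro exI[of _ 0]) auto
    next
      case False
      thus ?thesis using less.hyps[OF _ pq1] p1 by simp
    qed
    then obtain s s' r r' where *: "poly_pair \<Theta> s s'" "poly_pair \<Theta> r r'" "p1 = s * f + r" "q1 = s' * g + r'"
      "r = 0 \<or> degree r < degree f" by blast
    show ?thesis
      apply (rule exI[of _ "s + m"], rule exI[of _ "s' + m'"], rule exI[of _ r], rule exI[of _ r'])
      using * mm c unfolding p1_def q1_def by (auto simp: algebra_simps)
  qed
qed

text \<open>Minimality is assumed at \<open>x\<close> only and has to be carried over to
  \<open>y\<close>. A polynomial \<open>g2\<close> of least degree with root \<open>y\<close>
  divides \<open>g\<close>, so its partner \<open>f2\<close> divides \<open>f\<close>, and the
  minimality of \<open>f\<close> leaves no room for a proper factor. The remainder modulo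
  \<open>f\<close> and \<open>g\<close> then decides vanishing on both sides.\<close>

lemma pair_field_adjoin_algebraic:
  assumes \<Theta>: "pair_field \<Theta>" and fg: "poly_pair \<Theta> f g" "f \<noteq> 0" and "poly f x = 0" "poly g y = 0"
    and min: "\<And>p. p \<noteq> 0 \<Longrightarrow> (\<And>i. coeff p i \<in> Domain \<Theta>) \<Longrightarrow> poly p x = 0 \<Longrightarrow> degree f \<le> degree p"
  shows "pair_field (pair_gen (insert (x, y) \<Theta>))"
proof (rule pair_field_adjoin[OF \<Theta>])
  have dom: "\<And>i. coeff p i \<in> Domain \<Theta>" if "poly_pair \<Theta> p q" for p q
    using that unfolding poly_pair_def by blast
  have g0: "g \<noteq> 0" using poly_pair_0_iff[OF \<Theta> fg(1)] fg(2) by simp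
  define P where "P = (\<lambda>n. \<exists>p q. poly_pair \<Theta> p q \<and> q \<noteq> 0 \<and> poly q y = 0 \<and> degree q = n)"
  have "P (degree g)" unfolding P_def using fg g0 assms by blast
  hence "P (LEAST n. P n)" by (rule LeastI)
  then obtain f2 g2 where f2: "poly_pair \<Theta> f2 g2" "g2 \<noteq> 0" "poly g2 y = 0" "degree g2 = (LEAST n. P n)"
    unfolding P_def by blast
  have min2: "degree g2 \<le> degree q" if "poly_pair \<Theta> p q" "q \<noteq> 0" "poly q y = 0" for p q
    unfolding f2(4) by (rule Least_le) (use that in \<open>auto simp: P_def\<close>)
  have f20: "f2 \<noteq> 0" using poly_pair_0_iff[OF \<Theta> f2(1)] f2(2) by simp
  have d2: "degree f2 = degree g2" using poly_pair_degree[OF \<Theta> f2(1)] .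
  have dpos: "degree f2 > 0" unfolding d2 using f2(2,3)
    by (auto elim!: degree_eq_zeroE intro!: gr0I)
  have "degree f \<le> degree f2"
  proof -
    obtain s s' r r' where *: "poly_pair \<Theta> s s'" "poly_pair \<Theta> r r'" "f = s * f2 + r" "g = s' * g2 + r'"
      "r = 0 \<or> degree r < degree f2" using poly_pair_division[OF \<Theta> f2(1) f20 fg(1)] by blast
    have "poly r' y = 0" using *(4) assms f2 by simp
    hence "r = 0"
      using min2[OF *(2)] *(5) d2 poly_pair_degree[OF \<Theta> *(2)] poly_pair_0_iff[OF \<Theta> *(2)] by fastforce
    hence f: "f = s * f2" using *(3) by simp
    hence s0: "s \<noteq> 0" using fg by auto
    hence "degree f = degree s + degree f2" using f f20 by (simp add: degree_mult_eq)
    \<comment> \<open>The cofactor has smaller degree than \<open>f\<close>, because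
      \<open>f2\<close> has a root and hence positive degree.\<close>
    hence "poly s x \<noteq> 0" using min[OF s0 dom[OF *(1)]] dpos by auto
    hence "poly f2 x = 0" using f assms by simp
    thus ?thesis using min[OF f20 dom[OF f2(1)]] by simp
  qed
  fix p q assume pq: "poly_pair \<Theta> p q"
  obtain s s' r r' where *: "poly_pair \<Theta> s s'" "poly_pair \<Theta> r r'" "p = s * f + r" "q = s' * g + r'"
    "r = 0 \<or> degree r < degree f" using poly_pair_division[OF \<Theta> fg pq] by blast
  note ** = poly_pair_degree[OF \<Theta> *(2)] poly_pair_0_iff[OF \<Theta> *(2)]
  have "poly p x = 0 \<longleftrightarrow> r = 0"
    using * assms min[of r] dom[OF *(2)] by fastforce
  moreover have "poly q y = 0 \<longleftrightarrow> r' = 0"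
    using * assms min2[OF *(2)] \<open>degree f \<le> degree f2\<close> d2 ** by fastforce
  ultimately show "poly p x = 0 \<longleftrightarrow> poly q y = 0" using ** by simp
qed

text \<open>Differentiating \<open>f(x) = 0\<close> expresses \<open>D x\<close> through
  \<open>x\<close>, the coefficients of \<open>f\<close> and their derivatives, with denominator
  \<open>poly (pderiv f) x\<close>; the same formula holds at \<open>y\<close>.\<close>

lemma pair_field_derivation_algebraic:
  assumes D: "derivation D" and \<Theta>: "pair_field \<Theta>'" "\<And>u v. (u, v) \<in> \<Theta> \<Longrightarrow> (D u, D v) \<in> \<Theta>'" "\<Theta> \<subseteq> \<Theta>'"
    and xy: "(x, y) \<in> \<Theta>'" and fg: "poly_pair \<Theta> f g" "poly f x = 0" "poly g y = 0" "poly (pderiv f) x \<noteq> 0"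
  shows "(D x, D y) \<in> \<Theta>'"
proof -
  have fg': "poly_pair \<Theta>' f g" using fg \<Theta> unfolding poly_pair_def by auto
  have d: "poly_pair \<Theta>' (pderiv f) (pderiv g)"
    unfolding poly_pair_def coeff_pderiv
  proof
    fix i
    have "(of_nat k, of_nat k) \<in> \<Theta>'" for k
      by (induction k) (auto intro: pair_fieldD[OF \<Theta>(1)])
    note this[of "Suc i"]
    thus "(of_nat (Suc i) * coeff f (Suc i), of_nat (Suc i) * coeff g (Suc i)) \<in> \<Theta>'"
      using fg' unfolding poly_pair_def by (intro pair_fieldD(4)[OF \<Theta>(1)]) auto
  qed
  have m: "poly_pair \<Theta>' (map_poly D f) (map_poly D g)"
    unfolding poly_pair_def using fg(1) \<Theta>(2)
    by (auto simp: coeff_map_poly derivation_0[OF D] poly_pair_def)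
  note e = poly_pair_poly[OF \<Theta>(1) _ xy]
  have y: "poly (pderiv g) y \<noteq> 0" using pair_fieldD(7)[OF \<Theta>(1) e[OF d]] fg(4) by simp
  have "D x = - (poly (map_poly D f) x / poly (pderiv f) x)"
    using derivation_poly[OF D, of f x] fg(2,4) derivation_0[OF D]
    by (simp add: field_simps add_eq_0_iff)
  moreover have "D y = - (poly (map_poly D g) y / poly (pderiv g) y)"
    using derivation_poly[OF D, of g y] fg(3) y derivation_0[OF D]
    by (simp add: field_simps add_eq_0_iff)
  ultimately show ?thesis
    using e[OF d] e[OF m] by (simp add: pair_fieldD[OF \<Theta>(1)] pair_field_divide[OF \<Theta>(1)])
qed

text \<open>In characteristic 0 the derivative of a nonconstant polynomial is nonzero and has
  smaller degree, so a common root would contradict minimality.\<close>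

lemma pderiv_nonzero_at_root:
  fixes f :: "'a::field_char_0 poly"
  assumes \<Theta>: "pair_field \<Theta>" and f: "f \<noteq> 0" "\<And>i. coeff f i \<in> Domain \<Theta>" "poly f x = 0"
    and min: "\<And>p. p \<noteq> 0 \<Longrightarrow> (\<And>i. coeff p i \<in> Domain \<Theta>) \<Longrightarrow> poly p x = 0 \<Longrightarrow> degree f \<le> degree p"
  shows "poly (pderiv f) x \<noteq> 0"
proof
  assume 0: "poly (pderiv f) x = 0"
  have dpos: "degree f > 0" using f(1,3)
    by (auto elim!: degree_eq_zeroE intro!: gr0I)
  have "pderiv f \<noteq> 0" using dpos by (simp add: pderiv_eq_0_iff)
  moreover have "coeff (pderiv f) i \<in> Domain \<Theta>" for i
  proof -
    obtain v where v: "(coeff f (Suc i), v) \<in> \<Theta>" using f(2) by blast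
    have "(of_nat k, of_nat k) \<in> \<Theta>" for k
      by (induction k) (auto intro: pair_fieldD[OF \<Theta>])
    from pair_fieldD(4)[OF \<Theta> this v] show ?thesis unfolding coeff_pderiv by blast
  qed
  ultimately have "degree f \<le> degree (pderiv f)" using min 0 by blast
  thus False using dpos by (simp add: degree_pderiv)
qed

section \<open>Multivariate polynomials\<close>

definition mon_eval :: "(nat \<Rightarrow>\<^sub>0 nat) \<Rightarrow> (nat \<Rightarrow> 'a::comm_ring_1) \<Rightarrow> 'a" where
  "mon_eval m x = (\<Prod>i\<in>Poly_Mapping.keys m. x i ^ Poly_Mapping.lookup m i)"

lemma mon_eval_superset:
  assumes "finite S" "Poly_Mapping.keys m \<subseteq> S"
  shows "mon_eval m x = (\<Prod>i\<in>S. x i ^ Poly_Mapping.lookup m i)"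
  unfolding mon_eval_def
  by (rule prod.mono_neutral_left) (use assms in \<open>auto simp: in_keys_iff\<close>)

lemma mon_eval_0 [simp]: "mon_eval 0 x = 1"
  by (simp add: mon_eval_def)

lemma mon_eval_add: "mon_eval (m + n) x = mon_eval m x * mon_eval n x"
proof -
  let ?S = "Poly_Mapping.keys m \<union> Poly_Mapping.keys n"
  have "finite ?S" "Poly_Mapping.keys (m + n) \<subseteq> ?S" by (auto simp: in_keys_iff lookup_add)
  thus ?thesis
    by (simp add: mon_eval_superset[of ?S] lookup_add power_add prod.distrib)
qed

lemma mpeval_superset:
  assumes "finite S" "Poly_Mapping.keys p \<subseteq> S"
  shows "mpeval p x = (\<Sum>m\<in>S. Poly_Mapping.lookup p m * mon_eval m x)"
  unfolding mpeval_def mon_eval_def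
  by (rule sum.mono_neutral_left) (use assms in \<open>auto simp: in_keys_iff\<close>)

lemma mpeval_0 [simp]: "mpeval 0 x = 0"
  by (simp add: mpeval_def)

lemma mpeval_add: "mpeval (p + q) x = mpeval p x + mpeval q x"
proof -
  let ?S = "Poly_Mapping.keys p \<union> Poly_Mapping.keys q"
  have "finite ?S" "Poly_Mapping.keys (p + q) \<subseteq> ?S" by (auto simp: in_keys_iff lookup_add)
  thus ?thesis
    by (simp add: mpeval_superset[of ?S] lookup_add distrib_right sum.distrib)
qed

lemma mpeval_sum: "mpeval (sum f I) x = (\<Sum>i\<in>I. mpeval (f i) x)"
  by (induction I rule: infinite_finite_induct) (auto simp: mpeval_add)

lemma mpeval_single: "mpeval (Poly_Mapping.single m c) x = c * mon_eval m x"
  by (subst mpeval_superset[of "{m}"]) auto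

lemma mpoly_expand:
  assumes "finite S" "Poly_Mapping.keys p \<subseteq> S"
  shows "p = (\<Sum>m\<in>S. Poly_Mapping.single m (Poly_Mapping.lookup p m))"
proof (rule poly_mapping_eqI)
  fix k
  show "Poly_Mapping.lookup p k = Poly_Mapping.lookup (\<Sum>m\<in>S. Poly_Mapping.single m (Poly_Mapping.lookup p m)) k"
    using assms by (auto simp: lookup_sum lookup_single when_def in_keys_iff)
qed

lemma mpoly_mult_expand:
  fixes p q :: "'a::comm_ring_1 mpoly"
  assumes "finite S" "Poly_Mapping.keys p \<subseteq> S" "finite T" "Poly_Mapping.keys q \<subseteq> T"
  shows "p * q = (\<Sum>m\<in>S. \<Sum>n\<in>T. Poly_Mapping.single (m + n) (Poly_Mapping.lookup p m * Poly_Mapping.lookup q n))"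
  by (subst mpoly_expand[OF assms(1,2)], subst mpoly_expand[OF assms(3,4)])
    (simp add: sum_product mult_single)

lemma mpeval_mult: "mpeval (p * q) x = mpeval p x * mpeval q x"
proof -
  have "mpeval (p * q) x = (\<Sum>m\<in>Poly_Mapping.keys p. \<Sum>n\<in>Poly_Mapping.keys q.
     (Poly_Mapping.lookup p m * Poly_Mapping.lookup q n) * (mon_eval m x * mon_eval n x))"
    by (subst mpoly_mult_expand[of "Poly_Mapping.keys p" p "Poly_Mapping.keys q" q])
      (simp_all add: mpeval_sum mpeval_single mon_eval_add)
  also have "\<dots> = mpeval p x * mpeval q x"
    unfolding mpeval_superset[OF finite_keys order_refl] sum_product by (simp add: mult_ac)
  finally show ?thesis .
qed

lemma mpeval_1 [simp]: "mpeval 1 x = 1"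
  using mpeval_single[of 0 1 x] by simp

lemma mpeval_power: "mpeval (p ^ n) x = mpeval p x ^ n"
  by (induction n) (auto simp: mpeval_mult)

lemma mpeval_uminus: "mpeval (- p) x = - mpeval p x"
  using mpeval_add[of p "- p" x] by (simp add: eq_neg_iff_add_eq_0 add.commute)

lemma mpeval_prod: "mpeval (prod f I) x = (\<Prod>i\<in>I. mpeval (f i) x)"
  by (induction I rule: infinite_finite_induct) (auto simp: mpeval_mult)

definition mvar :: "nat \<Rightarrow> 'a::comm_ring_1 mpoly" where
  "mvar i = Poly_Mapping.single (Poly_Mapping.single i 1) 1"

lemma mpeval_mvar [simp]: "mpeval (mvar i) x = x i"
  by (simp add: mvar_def mpeval_single mon_eval_def)

lemma mpeval_cong: "(\<And>i. i \<in> mpvars p \<Longrightarrow> x i = y i) \<Longrightarrow> mpeval p x = mpeval p y"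
  unfolding mpeval_def mpvars_def
  by (intro sum.cong prod.cong arg_cong2[of _ _ _ _ "(*)"] arg_cong2[of _ _ _ _ "(^)"] refl) blast

lemma finite_mpvars: "finite (mpvars p)"
  by (simp add: mpvars_def)

lemma mpvars_0 [simp]: "mpvars 0 = {}"
  and mpvars_1 [simp]: "mpvars (1::'a::comm_ring_1 mpoly) = {}"
  and mpvars_uminus [simp]: "mpvars (- p) = mpvars (p :: 'a::comm_ring_1 mpoly)"
  by (auto simp: mpvars_def in_keys_iff)

lemma mpvars_mvar [simp]: "mpvars (mvar i :: 'a::comm_ring_1 mpoly) = {i}"
  by (simp add: mpvars_def mvar_def)

lemma mpvars_const [simp]: "mpvars (Poly_Mapping.single 0 c) = {}"
  by (simp add: mpvars_def)

lemma mpvars_add: "mpvars (p + q) \<subseteq> mpvars p \<union> mpvars (q :: 'a::comm_ring_1 mpoly)"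
  using keys_add[of p q] unfolding mpvars_def by blast

lemma mpvars_mult: "mpvars (p * q) \<subseteq> mpvars p \<union> mpvars (q :: 'a::comm_ring_1 mpoly)"
proof
  fix i assume "i \<in> mpvars (p * q)"
  then obtain m where m: "m \<in> Poly_Mapping.keys (p * q)" "i \<in> Poly_Mapping.keys m"
    unfolding mpvars_def by blast
  then obtain a b where "a \<in> Poly_Mapping.keys p" "b \<in> Poly_Mapping.keys q" "m = a + b"
    using keys_mult[of p q] by blast
  thus "i \<in> mpvars p \<union> mpvars q" using m(2) keys_add[of a b] unfolding mpvars_def by blast
qed

lemma mpvars_sum:
  "(\<And>i. i \<in> I \<Longrightarrow> mpvars (f i :: 'a::comm_ring_1 mpoly) \<subseteq> V) \<Longrightarrow> mpvars (sum f I) \<subseteq> V"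
  by (induction I rule: infinite_finite_induct) (use mpvars_add in force)+

lemma mpvars_prod:
  "(\<And>i. i \<in> I \<Longrightarrow> mpvars (f i :: 'a::comm_ring_1 mpoly) \<subseteq> V) \<Longrightarrow> mpvars (prod f I) \<subseteq> V"
  by (induction I rule: infinite_finite_induct) (use mpvars_mult in force)+

lemma mpvars_power: "mpvars (p :: 'a::comm_ring_1 mpoly) \<subseteq> V \<Longrightarrow> mpvars (p ^ n) \<subseteq> V"
  by (induction n) (use mpvars_mult in force)+

definition mp_pair :: "('a::field \<times> 'a) set \<Rightarrow> 'a mpoly \<Rightarrow> 'a mpoly \<Rightarrow> bool" where
  "mp_pair \<Theta> p q \<longleftrightarrow> (\<forall>m. (Poly_Mapping.lookup p m, Poly_Mapping.lookup q m) \<in> \<Theta>)"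

lemma mp_pair_add:
  "pair_field \<Theta> \<Longrightarrow> mp_pair \<Theta> p q \<Longrightarrow> mp_pair \<Theta> p' q' \<Longrightarrow> mp_pair \<Theta> (p + p') (q + q')"
  unfolding mp_pair_def by (auto simp: lookup_add pair_fieldD)

lemma mp_pair_0: "pair_field \<Theta> \<Longrightarrow> mp_pair \<Theta> 0 0"
  unfolding mp_pair_def by (auto simp: pair_fieldD)

lemma mp_pair_uminus:
  "pair_field \<Theta> \<Longrightarrow> mp_pair \<Theta> p q \<Longrightarrow> mp_pair \<Theta> (- p) (- q)"
  unfolding mp_pair_def by (auto simp: pair_fieldD)

lemma mp_pair_single:
  "pair_field \<Theta> \<Longrightarrow> (u, v) \<in> \<Theta> \<Longrightarrow> mp_pair \<Theta> (Poly_Mapping.single m u) (Poly_Mapping.single m v)"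
  unfolding mp_pair_def by (auto simp: pair_fieldD lookup_single when_def)

lemma mp_pair_1: "pair_field \<Theta> \<Longrightarrow> mp_pair \<Theta> 1 1"
  using mp_pair_single[of \<Theta> 1 1 0] by (simp add: pair_fieldD)

lemma mp_pair_mvar: "pair_field \<Theta> \<Longrightarrow> mp_pair \<Theta> (mvar i) (mvar i)"
  unfolding mvar_def by (simp add: mp_pair_single pair_fieldD)

lemma mp_pair_sum:
  "pair_field \<Theta> \<Longrightarrow> (\<And>i. i \<in> I \<Longrightarrow> mp_pair \<Theta> (f i) (g i)) \<Longrightarrow> mp_pair \<Theta> (sum f I) (sum g I)"
  by (induction I rule: infinite_finite_induct) (auto intro: mp_pair_add mp_pair_0)

lemma mp_pair_mult:
  assumes "pair_field \<Theta>" "mp_pair \<Theta> p q" "mp_pair \<Theta> p' q'"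
  shows "mp_pair \<Theta> (p * p') (q * q')"
proof -
  let ?S = "Poly_Mapping.keys p \<union> Poly_Mapping.keys q" and ?T = "Poly_Mapping.keys p' \<union> Poly_Mapping.keys q'"
  have "p * p' = (\<Sum>m\<in>?S. \<Sum>n\<in>?T. Poly_Mapping.single (m + n) (Poly_Mapping.lookup p m * Poly_Mapping.lookup p' n))"
    "q * q' = (\<Sum>m\<in>?S. \<Sum>n\<in>?T. Poly_Mapping.single (m + n) (Poly_Mapping.lookup q m * Poly_Mapping.lookup q' n))"
    by (rule mpoly_mult_expand; simp)+
  thus ?thesis using assms
    by (auto intro!: mp_pair_sum mp_pair_single pair_fieldD(4)[OF assms(1)] simp: mp_pair_def[of _ p q] mp_pair_def[of _ p' q'])
qed

lemma mp_pair_power: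
  "pair_field \<Theta> \<Longrightarrow> mp_pair \<Theta> p q \<Longrightarrow> mp_pair \<Theta> (p ^ n) (q ^ n)"
  by (induction n) (auto intro: mp_pair_mult mp_pair_1)

lemma mp_pair_keys: "pair_field \<Theta> \<Longrightarrow> mp_pair \<Theta> p q \<Longrightarrow> Poly_Mapping.keys p = Poly_Mapping.keys q"
  unfolding mp_pair_def set_eq_iff in_keys_iff using pair_fieldD(7) by metis

lemma mp_pair_vars: "pair_field \<Theta> \<Longrightarrow> mp_pair \<Theta> p q \<Longrightarrow> mpvars p = mpvars q"
  unfolding mpvars_def by (simp add: mp_pair_keys)

lemma mp_pair_mpeval:
  assumes "pair_field \<Theta>'" "\<Theta> \<subseteq> \<Theta>'" "mp_pair \<Theta> p q" "\<And>i. i \<in> mpvars p \<Longrightarrow> (x i, y i) \<in> \<Theta>'"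
  shows "(mpeval p x, mpeval q y) \<in> \<Theta>'"
proof -
  have \<Theta>: "mp_pair \<Theta>' p q" using assms(2,3) unfolding mp_pair_def by auto
  have "(mon_eval m x, mon_eval m y) \<in> \<Theta>'" if "m \<in> Poly_Mapping.keys p" for m
  proof -
    have "((\<Prod>i\<in>I. x i ^ Poly_Mapping.lookup m i), (\<Prod>i\<in>I. y i ^ Poly_Mapping.lookup m i)) \<in> \<Theta>'"
      if "I \<subseteq> Poly_Mapping.keys m" for I
      using finite_subset[OF that] that
      by (induction I rule: infinite_finite_induct)
        (use \<open>m \<in> _\<close> in \<open>auto intro!: pair_fieldD(2,4)[OF assms(1)] pair_field_power[OF assms(1)] assms(4) simp: mpvars_def\<close>)
    thus ?thesis unfolding mon_eval_def by blast
  qed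
  thus ?thesis using \<Theta>
    unfolding mpeval_superset[OF finite_keys order_refl] mp_pair_keys[OF assms(1) \<Theta>, symmetric]
    by (intro pair_field_sum[OF assms(1)] pair_fieldD(4)[OF assms(1)]) (auto simp: mp_pair_def)
qed

lemma mp_pair_ex:
  assumes "pair_field \<Theta>" "\<And>m. Poly_Mapping.lookup p m \<in> Domain \<Theta>"
  shows "\<exists>q. mp_pair \<Theta> p q"
proof -
  define h where "h u = (SOME v. (u, v) \<in> \<Theta>)" for u
  have h: "(u, h u) \<in> \<Theta>" if "u \<in> Domain \<Theta>" for u
    using that unfolding h_def by (auto intro: someI)
  have "(Poly_Mapping.lookup p m, Poly_Mapping.lookup (Poly_Mapping.map h p) m) \<in> \<Theta>" for m
    using h[OF assms(2), of m] pair_fieldD(1)[OF assms(1)] by (auto simp: Poly_Mapping.map.rep_eq when_def)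
  thus ?thesis unfolding mp_pair_def by blast
qed

section \<open>Quotients of polynomial values and algebraic independence\<close>

abbreviation mp_over :: "'a::field set \<Rightarrow> 'a mpoly \<Rightarrow> bool" where
  "mp_over B p \<equiv> mp_pair (Id_on B) p p"

lemma mp_over_iff: "mp_over B p \<longleftrightarrow> (\<forall>m. Poly_Mapping.lookup p m \<in> B)"
  by (auto simp: mp_pair_def Id_on_iff)

lemma pair_field_Id_on_Domain: "pair_field \<Theta> \<Longrightarrow> pair_field (Id_on (Domain \<Theta>))"
  unfolding pair_field_def by (simp add: Id_on_iff Domain_iff) meson

lemma pair_field_Id_on_Range: "pair_field \<Theta> \<Longrightarrow> pair_field (Id_on (Range \<Theta>))"
  using pair_field_Id_on_Domain[OF pair_field_converse] by (simp add: Domain_converse)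

lemma Domain_pair_gen:
  assumes "Domain G \<subseteq> Domain (pair_gen H)"
  shows "Domain (pair_gen G) \<subseteq> Domain (pair_gen H)"
proof -
  have "fst z \<in> Domain (pair_gen H)" if "z \<in> pair_gen G" for z
    using that
  proof (induction rule: pair_gen.induct)
    case (gen g)
    hence "fst g \<in> Domain G" by (metis Domain.DomainI prod.collapse)
    thus ?case using assms by blast
  qed (auto intro: pair_gen.intros)
  thus ?thesis by force
qed

lemma Domain_pair_gen_mono: "Domain G \<subseteq> Domain H \<Longrightarrow> Domain (pair_gen G) \<subseteq> Domain (pair_gen H)"
  by (rule Domain_pair_gen) (blast intro: pair_gen.gen)

text \<open>For a field \<open>B\<close>, membership in the field generated over \<open>B\<close> by
  the \<open>v i\<close> with \<open>i\<close> in \<open>I\<close>, with the quotient kept explicit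
  so that denominators can be cleared.\<close>

definition is_frac :: "'a::field set \<Rightarrow> (nat \<Rightarrow> 'a) \<Rightarrow> nat set \<Rightarrow> 'a \<Rightarrow> bool" where
  "is_frac B v I u \<longleftrightarrow> (\<exists>g h. mp_over B g \<and> mp_over B h \<and> mpvars g \<subseteq> I \<and> mpvars h \<subseteq> I \<and>
     mpeval h v \<noteq> 0 \<and> u = mpeval g v / mpeval h v)"

lemma is_frac_pair_gen:
  assumes B: "pair_field (Id_on B)" and G: "Domain G \<subseteq> B \<union> v ` I"
    and u: "u \<in> Domain (pair_gen G)"
  shows "is_frac B v I u"
proof -
  note c = mp_pair_add[OF B] mp_pair_mult[OF B] mp_pair_uminus[OF B] mp_pair_0[OF B] mp_pair_1[OF B]
  have base: "is_frac B v I (mpeval g v)" if "mp_over B g" "mpvars g \<subseteq> I" for g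
    unfolding is_frac_def by (rule exI[of _ g], rule exI[of _ 1]) (use that c in auto)
  have "is_frac B v I (fst z)" if "z \<in> pair_gen G" for z
    using that
  proof (induction rule: pair_gen.induct)
    case (gen g)
    then consider "fst g \<in> B" | i where "i \<in> I" "fst g = v i" using G by (cases g) auto
    thus ?case
    proof cases
      case 1
      moreover have "0 \<in> B" using pair_fieldD(1)[OF B] by (simp add: Id_on_iff)
      ultimately show ?thesis using base[of "Poly_Mapping.single 0 (fst g)"]
        by (auto simp: mp_over_iff mpeval_single lookup_single when_def)
    next
      case 2
      thus ?thesis using base[of "mvar i"] by (simp add: mp_pair_mvar[OF B])
    qed
  next
    case zero thus ?case using base[of 0] c by simp
  next
    case one thus ?case using base[of 1] c by simp
  next
    case (add a b a' b')
    then obtain g h g' h' where *: "mp_over B g" "mp_over B h" "mpvars g \<subseteq> I" "mpvars h \<subseteq> I"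
     "mpeval h v \<noteq> 0" "a = mpeval g v / mpeval h v"
     "mp_over B g'" "mp_over B h'" "mpvars g' \<subseteq> I" "mpvars h' \<subseteq> I"
     "mpeval h' v \<noteq> 0" "a' = mpeval g' v / mpeval h' v" unfolding is_frac_def by auto
    have "mpvars (g * h' + g' * h) \<subseteq> I" "mpvars (h * h') \<subseteq> I"
      using * mpvars_add[of "g * h'" "g' * h"] mpvars_mult[of g h'] mpvars_mult[of g' h] mpvars_mult[of h h'] by blast+
    thus ?case unfolding is_frac_def using *
      by (intro exI[of _ "g * h' + g' * h"] exI[of _ "h * h'"])
        (auto simp: mpeval_add mpeval_mult add_frac_eq intro: c)
  next
    case (mult a b a' b')
    then obtain g h g' h' where *: "mp_over B g" "mp_over B h" "mpvars g \<subseteq> I" "mpvars h \<subseteq> I"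
     "mpeval h v \<noteq> 0" "a = mpeval g v / mpeval h v"
     "mp_over B g'" "mp_over B h'" "mpvars g' \<subseteq> I" "mpvars h' \<subseteq> I"
     "mpeval h' v \<noteq> 0" "a' = mpeval g' v / mpeval h' v" unfolding is_frac_def by auto
    have "mpvars (g * g') \<subseteq> I" "mpvars (h * h') \<subseteq> I"
      using * mpvars_mult[of g g'] mpvars_mult[of h h'] by blast+
    thus ?case unfolding is_frac_def using *
      by (intro exI[of _ "g * g'"] exI[of _ "h * h'"]) (auto simp: mpeval_mult intro: c)
  next
    case (uminus a b)
    then obtain g h where *: "mp_over B g" "mp_over B h" "mpvars g \<subseteq> I" "mpvars h \<subseteq> I"
     "mpeval h v \<noteq> 0" "a = mpeval g v / mpeval h v" unfolding is_frac_def by auto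
    thus ?case unfolding is_frac_def
      by (intro exI[of _ "- g"] exI[of _ h]) (auto simp: mpeval_uminus intro: c)
  next
    case (inverse a b)
    then obtain g h where *: "mp_over B g" "mp_over B h" "mpvars g \<subseteq> I" "mpvars h \<subseteq> I"
     "mpeval h v \<noteq> 0" "a = mpeval g v / mpeval h v" unfolding is_frac_def by auto
    show ?case
    proof (cases "mpeval g v = 0")
      case True
      thus ?thesis using base[of 0] c * by simp
    next
      case False
      thus ?thesis unfolding is_frac_def using * by (intro exI[of _ h] exI[of _ g]) auto
    qed
  qed
  thus ?thesis using u by force
qed

lemma common_denominator:
  fixes n :: nat
  assumes B: "pair_field (Id_on B)" and "\<And>j. is_frac B v I (a j)"
  shows "\<exists>G h. mp_over B h \<and> mpvars h \<subseteq> I \<and> mpeval h v \<noteq> 0 \<and>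
     (\<forall>j<n. mp_over B (G j) \<and> mpvars (G j) \<subseteq> I \<and> a j * mpeval h v = mpeval (G j) v)"
proof (induction n)
  case 0
  show ?case by (rule exI[of _ "\<lambda>_. 0"], rule exI[of _ 1]) (auto simp: mp_pair_1[OF B])
next
  case (Suc n)
  then obtain G h where *: "mp_over B h" "mpvars h \<subseteq> I" "mpeval h v \<noteq> 0"
     "\<And>j. j < n \<Longrightarrow> mp_over B (G j) \<and> mpvars (G j) \<subseteq> I \<and> a j * mpeval h v = mpeval (G j) v" by blast
  obtain g h' where **: "mp_over B g" "mp_over B h'" "mpvars g \<subseteq> I" "mpvars h' \<subseteq> I"
     "mpeval h' v \<noteq> 0" "a n = mpeval g v / mpeval h' v" using assms(2)[of n] unfolding is_frac_def by auto
  have "mpvars (h * h') \<subseteq> I" "mpvars (g * h) \<subseteq> I" "j < n \<Longrightarrow> mpvars (G j * h') \<subseteq> I" for j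
    using mpvars_mult[of h h'] mpvars_mult[of g h] mpvars_mult[of "G j" h'] * ** by blast+
  thus ?case using * **
    by (intro exI[of _ "\<lambda>j. if j < n then G j * h' else g * h"] exI[of _ "h * h'"])
      (auto simp: mpeval_mult less_Suc_eq mp_pair_mult[OF B] mult.assoc[symmetric])
qed

text \<open>Algebraic independence over \<open>B\<close> of the family \<open>v i\<close>,
  \<open>i\<close> in \<open>I\<close>.\<close>

definition generic :: "'a::field set \<Rightarrow> (nat \<Rightarrow> 'a) \<Rightarrow> nat set \<Rightarrow> bool" where
  "generic B v I \<longleftrightarrow> (\<forall>g. mp_over B g \<longrightarrow> mpvars g \<subseteq> I \<longrightarrow> g \<noteq> 0 \<longrightarrow> mpeval g v \<noteq> 0)"

text \<open>A one-variable polynomial over the field generated by the \<open>v j\<close> becomes a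
  polynomial over \<open>B\<close> with main variable \<open>i\<close>. As \<open>i\<close> lies
  outside \<open>I\<close>, changing coordinate \<open>i\<close> leaves the coefficients alone, so
  the last clause can be used at every \<open>z\<close>.\<close>

lemma clear_denominators:
  fixes v :: "nat \<Rightarrow> 'a::field_char_0"
  assumes B: "pair_field (Id_on B)" and i: "i \<notin> I" and p: "\<And>j. is_frac B v I (coeff p j)"
  obtains G h where "mp_over B h" "mpvars h \<subseteq> I" "mpeval h v \<noteq> 0"
    "\<And>j. j \<le> degree p \<Longrightarrow> mp_over B (G j)" "\<And>j. j \<le> degree p \<Longrightarrow> mpvars (G j) \<subseteq> I"
    "\<And>j. j \<le> degree p \<Longrightarrow> mpeval (G j) v = coeff p j * mpeval h v"
    "mp_over B (\<Sum>j\<le>degree p. G j * mvar i ^ j)" "mpvars (\<Sum>j\<le>degree p. G j * mvar i ^ j) \<subseteq> insert i I"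
    "\<And>z. mpeval (\<Sum>j\<le>degree p. G j * mvar i ^ j) (v(i := z)) = mpeval h v * poly p z"
proof -
  define n where "n = Suc (degree p)"
  obtain G h where Gh: "mp_over B h \<and> mpvars h \<subseteq> I \<and> mpeval h v \<noteq> 0 \<and>
     (\<forall>j<n. mp_over B (G j) \<and> mpvars (G j) \<subseteq> I \<and> coeff p j * mpeval h v = mpeval (G j) v)"
    using common_denominator[where a = "coeff p" and n = n, OF B p] by (elim exE)
  hence h: "mp_over B h" "mpvars h \<subseteq> I" "mpeval h v \<noteq> 0" and
     G: "\<And>j. j \<le> degree p \<Longrightarrow> mp_over B (G j) \<and> mpvars (G j) \<subseteq> I \<and> mpeval (G j) v = coeff p j * mpeval h v"
    by (simp_all add: n_def less_Suc_eq_le)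
  define Q where "Q = (\<Sum>j\<le>degree p. G j * mvar i ^ j)"
  have Qz: "mpeval Q (v(i := z)) = mpeval h v * poly p z" for z
  proof -
    have "mpeval (G j) (v(i := z)) = coeff p j * mpeval h v" if "j \<le> degree p" for j
    proof -
      have "mpeval (G j) (v(i := z)) = mpeval (G j) v"
        by (rule mpeval_cong) (use G[OF that] i in auto)
      thus ?thesis using G[OF that] by simp
    qed
    thus ?thesis unfolding Q_def poly_altdef
      by (simp add: mpeval_sum mpeval_mult mpeval_power sum_distrib_left mult_ac)
  qed
  have "mp_over B Q" unfolding Q_def
    by (intro mp_pair_sum[OF B] mp_pair_mult[OF B] mp_pair_power[OF B] mp_pair_mvar[OF B]) (use G in auto)
  moreover have "mpvars Q \<subseteq> insert i I" unfolding Q_def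
  proof (rule mpvars_sum)
    fix j assume "j \<in> {..degree p}"
    hence "mpvars (G j) \<subseteq> I" using G by auto
    thus "mpvars (G j * mvar i ^ j) \<subseteq> insert i I"
      using mpvars_mult[of "G j" "mvar i ^ j"] mpvars_power[of "mvar i" "{i}" j] by fastforce
  qed
  ultimately show ?thesis using that[of h G] h G Qz unfolding Q_def by simp
qed

lemma transcendental_if_generic:
  fixes v :: "nat \<Rightarrow> 'a::field_char_0"
  assumes B: "pair_field (Id_on B)" and gen: "generic B v (insert i I)" and i: "i \<notin> I"
    and p: "p \<noteq> 0" "\<And>j. is_frac B v I (coeff p j)"
  shows "poly p (v i) \<noteq> 0"
proof
  assume 0: "poly p (v i) = 0"
  obtain G h where h: "mpeval h v \<noteq> 0" and Q: "mp_over B (\<Sum>j\<le>degree p. G j * mvar i ^ j)"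
    "mpvars (\<Sum>j\<le>degree p. G j * mvar i ^ j) \<subseteq> insert i I"
    "\<And>z. mpeval (\<Sum>j\<le>degree p. G j * mvar i ^ j) (v(i := z)) = mpeval h v * poly p z"
    by (rule clear_denominators[OF B i p(2)]) blast
  have "mpeval (\<Sum>j\<le>degree p. G j * mvar i ^ j) v = 0" using Q(3)[of "v i"] 0 by simp
  \<comment> \<open>Genericity kills the formal polynomial and not just one value, so
    \<open>p\<close> vanishes at every \<open>z\<close>, which is impossible over an infinite
    field.\<close>
  hence "(\<Sum>j\<le>degree p. G j * mvar i ^ j) = 0" using gen Q(1,2) unfolding generic_def by blast
  hence "poly p z = 0" for z using Q(3)[of z] h by simp
  thus False using p(1) poly_all_0_iff_0 by blast
qed

section \<open>Definability and saturation\<close>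

text \<open>Definability is stated for functions of the valuation, so that closure lemmas take the
  place of explicit syntax and types can be given as sets of predicates.\<close>

definition term_definable :: "('a::comm_ring_1 \<Rightarrow> 'a) \<Rightarrow> 'a set \<Rightarrow> ((nat \<Rightarrow> 'a) \<Rightarrow> 'a) \<Rightarrow> bool" where
  "term_definable D B F \<longleftrightarrow> (\<exists>t. dtparams t \<subseteq> B \<and> (\<forall>e. dteval D e t = F e))"

definition fm_definable :: "('a::comm_ring_1 \<Rightarrow> 'a) \<Rightarrow> 'a set \<Rightarrow> ((nat \<Rightarrow> 'a) \<Rightarrow> bool) \<Rightarrow> bool" where
  "fm_definable D B P \<longleftrightarrow> (\<exists>\<phi>. dparams \<phi> \<subseteq> B \<and> (\<forall>e. dsat D e \<phi> = P e))"

lemma term_definable_var: "term_definable D B (\<lambda>e. e n)"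
  unfolding term_definable_def by (rule exI[of _ "DVar n"]) auto

lemma term_definable_const: "c \<in> B \<Longrightarrow> term_definable D B (\<lambda>e. c)"
  unfolding term_definable_def by (rule exI[of _ "DConst c"]) auto

lemma term_definable_dteval: "dtparams t \<subseteq> B \<Longrightarrow> term_definable D B (\<lambda>e. dteval D e t)"
  unfolding term_definable_def by (rule exI[of _ t]) auto

lemma term_definable_add: "term_definable D B F \<Longrightarrow> term_definable D B G \<Longrightarrow> term_definable D B (\<lambda>e. F e + G e)"
  unfolding term_definable_def by (metis dteval.simps(3) dtparams.simps(3) Un_least)

lemma term_definable_mult: "term_definable D B F \<Longrightarrow> term_definable D B G \<Longrightarrow> term_definable D B (\<lambda>e. F e * G e)"
  unfolding term_definable_def by (metis dteval.simps(4) dtparams.simps(4) Un_least)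

lemma term_definable_D: "term_definable D B F \<Longrightarrow> term_definable D B (\<lambda>e. D (F e))"
  unfolding term_definable_def by (metis dteval.simps(6) dtparams.simps(6))

lemma term_definable_sum:
  "0 \<in> B \<Longrightarrow> (\<And>i. i \<in> I \<Longrightarrow> term_definable D B (F i)) \<Longrightarrow> term_definable D B (\<lambda>e. \<Sum>i\<in>I. F i e)"
  by (induction I rule: infinite_finite_induct) (auto intro: term_definable_add term_definable_const)

lemma term_definable_power:
  "1 \<in> B \<Longrightarrow> term_definable D B F \<Longrightarrow> term_definable D B (\<lambda>e. F e ^ n)"
  by (induction n) (auto intro: term_definable_mult term_definable_const)

lemma term_definable_prod:
  "1 \<in> B \<Longrightarrow> (\<And>i. i \<in> I \<Longrightarrow> term_definable D B (F i)) \<Longrightarrow> term_definable D B (\<lambda>e. \<Prod>i\<in>I. F i e)"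
  by (induction I rule: infinite_finite_induct) (auto intro: term_definable_mult term_definable_const)

lemma term_definable_deval:
  assumes "pair_field (Id_on B)" "mp_over B g"
  shows "term_definable D B (\<lambda>e. deval D g (e n))"
proof -
  have B: "0 \<in> B" "1 \<in> B" using pair_fieldD(1,2)[OF assms(1)] by auto
  have "term_definable D B (\<lambda>e. (D ^^ i) (e n))" for i
    by (induction i) (auto intro: term_definable_var term_definable_D)
  thus ?thesis unfolding deval_def mpeval_def using assms(2)
    by (intro term_definable_sum term_definable_mult term_definable_prod term_definable_power term_definable_const B)
      (auto simp: mp_over_iff)
qed

lemma fm_definable_eq: "term_definable D B F \<Longrightarrow> term_definable D B G \<Longrightarrow> fm_definable D B (\<lambda>e. F e = G e)"
  unfolding term_definable_def fm_definable_def by (metis dsat.simps(1) dparams.simps(1) Un_least)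

lemma fm_definable_not: "fm_definable D B P \<Longrightarrow> fm_definable D B (\<lambda>e. \<not> P e)"
  unfolding fm_definable_def by (metis dsat.simps(2) dparams.simps(2))

lemma fm_definable_and: "fm_definable D B P \<Longrightarrow> fm_definable D B Q \<Longrightarrow> fm_definable D B (\<lambda>e. P e \<and> Q e)"
  unfolding fm_definable_def by (metis dsat.simps(3) dparams.simps(3) Un_least)

lemma fm_definable_ex: "fm_definable D B P \<Longrightarrow> fm_definable D B (\<lambda>e. \<exists>a. P (e(n := a)))"
  unfolding fm_definable_def by (metis dsat.simps(4) dparams.simps(4))

lemma saturatedD:
  fixes B :: "'a::comm_ring_1 set"
  assumes "saturated D" "(card_of B, card_of (UNIV::'a set)) \<in> ordLess"
    and def: "\<And>P. P \<in> \<P> \<Longrightarrow> fm_definable D B P"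
    and fin: "\<And>\<F>. finite \<F> \<Longrightarrow> \<F> \<subseteq> \<P> \<Longrightarrow> \<exists>a. \<forall>P\<in>\<F>. P (\<lambda>_. a)"
  shows "\<exists>a. \<forall>P\<in>\<P>. P (\<lambda>_. a)"
proof -
  have "\<forall>P\<in>\<P>. \<exists>\<phi>. dparams \<phi> \<subseteq> B \<and> (\<lambda>e. dsat D e \<phi>) = P"
    using def unfolding fm_definable_def fun_eq_iff by simp
  then obtain f where f: "\<forall>P\<in>\<P>. dparams (f P) \<subseteq> B \<and> (\<lambda>e. dsat D e (f P)) = P"
    by (rule bchoice[THEN exE])
  have sat: "dsat D e (f P) = P e" if "P \<in> \<P>" for P e
    using f that by (metis (mono_tags, lifting))
  have "\<exists>a. \<forall>\<phi>\<in>f ` \<P>. dsat D (\<lambda>_. a) \<phi>"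
  proof (rule assms(1)[unfolded saturated_def, rule_format, OF assms(2)])
    show "dparams \<phi> \<subseteq> B" if "\<phi> \<in> f ` \<P>" for \<phi> using that f by auto
    fix F assume "finite F \<and> F \<subseteq> f ` \<P>"
    then obtain \<F> where \<F>: "\<F> \<subseteq> \<P>" "finite \<F>" "F = f ` \<F>" by (meson finite_subset_image)
    from fin[OF this(2,1)] obtain a where "\<forall>P\<in>\<F>. P (\<lambda>_. a)" by (elim exE)
    hence "\<forall>P\<in>\<F>. dsat D (\<lambda>_. a) (f P)" using sat \<F>(1) by (simp add: subset_iff)
    thus "\<exists>a. \<forall>\<phi>\<in>F. dsat D (\<lambda>_. a) \<phi>" unfolding \<F>(3) by blast
  qed
  then obtain a where "\<forall>P\<in>\<P>. dsat D (\<lambda>_. a) (f P)" by blast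
  hence "\<forall>P\<in>\<P>. P (\<lambda>_. a)" using sat by simp
  thus ?thesis by (rule exI)
qed

section \<open>Extending differential embeddings\<close>

text \<open>Genericity is an infinite set of inequations over \<open>R\<close>. Finitely many of
  them amount to a single one, for the product of the polynomials, and this is the shape in which
  Blum's axioms deliver solutions.\<close>

lemma saturated_generic:
  fixes D :: "'a::field_char_0 \<Rightarrow> 'a"
  assumes "saturated D" and R: "pair_field (Id_on R)" "(card_of R, card_of (UNIV::'a set)) \<in> ordLess"
    and Fs: "\<And>f. f \<in> Fs \<Longrightarrow> mp_over R f"
    and ex: "\<And>g. g \<noteq> 0 \<Longrightarrow> mpvars g \<subseteq> V \<Longrightarrow> \<exists>a. (\<forall>f\<in>Fs. deval D f a = 0) \<and> deval D g a \<noteq> 0"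
  shows "\<exists>a. (\<forall>f\<in>Fs. deval D f a = 0) \<and> generic R (\<lambda>j. (D ^^ j) a) V"
proof -
  define Gs where "Gs = {g. mp_over R g \<and> mpvars g \<subseteq> V \<and> g \<noteq> 0}"
  define P1 where "P1 = (\<lambda>f e. deval D f (e (0::nat)) = 0) ` Fs"
  define P2 where "P2 = (\<lambda>g e. \<not> deval D g (e (0::nat)) = 0) ` Gs"
  have "0 \<in> R" using pair_fieldD(1)[OF R(1)] by (simp add: Id_on_iff)
  hence def: "fm_definable D R P" if "P \<in> P1 \<union> P2" for P
    using that Fs unfolding P1_def P2_def Gs_def
    by (auto intro!: fm_definable_not fm_definable_eq term_definable_deval[OF R(1)] term_definable_const)
  have "\<exists>a. \<forall>P\<in>P1 \<union> P2. P (\<lambda>_. a)"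
  proof (rule saturatedD[OF assms(1) R(2) def])
    fix \<F> assume \<F>: "finite \<F>" "\<F> \<subseteq> P1 \<union> P2"
    have "finite (\<F> \<inter> P2)" "\<F> \<inter> P2 \<subseteq> (\<lambda>g e. \<not> deval D g (e (0::nat)) = 0) ` Gs" using \<F> P2_def by auto
    then obtain \<Gamma> where \<Gamma>: "\<Gamma> \<subseteq> Gs" "finite \<Gamma>" "\<F> \<inter> P2 = (\<lambda>g e. \<not> deval D g (e (0::nat)) = 0) ` \<Gamma>"
      by (meson finite_subset_image)
    have "\<Prod>\<Gamma> \<noteq> 0" "mpvars (\<Prod>\<Gamma>) \<subseteq> V" using \<Gamma>(1,2) by (auto simp: Gs_def intro!: mpvars_prod)
    then obtain a where a: "\<forall>f\<in>Fs. deval D f a = 0" "deval D (\<Prod>\<Gamma>) a \<noteq> 0" using ex by blast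
    have "P (\<lambda>_. a)" if "P \<in> \<F>" for P
    proof (cases "P \<in> P1")
      case True
      thus ?thesis using a(1) by (auto simp: P1_def)
    next
      case False
      hence "P \<in> \<F> \<inter> P2" using that \<F> by blast
      thus ?thesis unfolding \<Gamma>(3) using a(2) \<Gamma>(2) by (auto simp: deval_def mpeval_prod)
    qed
    thus "\<exists>a. \<forall>P\<in>\<F>. P (\<lambda>_. a)" by blast
  qed
  then obtain a where a: "\<forall>P\<in>P1 \<union> P2. P (\<lambda>_. a)" by blast
  have "deval D f a = 0" if "f \<in> Fs" for f using a that unfolding P1_def by auto
  moreover have "mpeval g (\<lambda>j. (D ^^ j) a) \<noteq> 0" if "g \<in> Gs" for g
    using a that unfolding P2_def by (auto simp: deval_def)
  ultimately show ?thesis unfolding generic_def Gs_def by blast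
qed

text \<open>Algebraic closedness is Blum's axiom for an equation of order 0 with the inequation
  \<open>1 \<noteq> 0\<close>.\<close>

lemma diff_closed_root:
  fixes D :: "'a::field_char_0 \<Rightarrow> 'a" and p :: "'a poly"
  assumes "diff_closed D" "degree p > 0"
  shows "\<exists>z. poly p z = 0"
proof -
  define F :: "'a mpoly" where "F = (\<Sum>j\<le>degree p. Poly_Mapping.single 0 (coeff p j) * mvar 0 ^ j)"
  have F: "mpeval F v = poly p (v 0)" for v
    by (simp add: F_def mpeval_sum mpeval_mult mpeval_power mpeval_single poly_altdef)
  have "mpvars F \<noteq> {}"
  proof
    assume "mpvars F = {}"
    hence "mpeval F (\<lambda>_. z) = mpeval F (\<lambda>_. 0)" for z by (intro mpeval_cong) auto
    hence "poly (p - [:poly p 0:]) z = 0" for z using F by simp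
    hence "p - [:poly p 0:] = 0" using poly_all_0_iff_0 by blast
    hence "p = [:poly p 0:]" by simp
    hence "degree p = 0" by (metis degree_pCons_0)
    thus False using assms(2) by simp
  qed
  moreover have "mpvars (1 :: 'a mpoly) = {}" by simp
  ultimately obtain a where "deval D F a = 0"
    using assms(1) unfolding diff_closed_def by (metis zero_neq_one)
  thus ?thesis using F unfolding deval_def by auto
qed

lemma diff_closedD:
  assumes "diff_closed D" "mpvars f \<noteq> {}" "g \<noteq> 0" "mpvars g = {} \<or> dorder g < dorder f"
  shows "\<exists>a. deval D f a = 0 \<and> deval D g a \<noteq> 0"
  using assms(1)[unfolded diff_closed_def, THEN conjunct2, rule_format, OF assms(2-4)] .

lemma dorder_less: "mpvars g \<subseteq> {..<n} \<Longrightarrow> mpvars g = {} \<or> dorder g < n"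
  using Max_in[OF finite_mpvars, of g] by (auto simp: dorder_def)

text \<open>Blum's axiom is applied to the equation that sets the derivative of order
  \<open>N\<close> to zero, where \<open>N\<close> exceeds every variable of
  \<open>g\<close>.\<close>

lemma diff_closed_avoid:
  fixes D :: "'a::field_char_0 \<Rightarrow> 'a"
  assumes "diff_closed D" "g \<noteq> 0" shows "\<exists>a. deval D g a \<noteq> 0"
proof -
  obtain N where N: "mpvars g \<subseteq> {..<N}"
    using finite_mpvars[of g] unfolding finite_nat_iff_bounded by (elim exE)
  have "mpvars (mvar N :: 'a mpoly) \<noteq> {}" by simp
  moreover have "mpvars g = {} \<or> dorder g < dorder (mvar N :: 'a mpoly)"
    using dorder_less[OF N] by (simp add: dorder_def)
  ultimately show ?thesis using diff_closedD[OF assms(1) _ assms(2)] by blast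
qed

lemma diff_pair_fieldD:
  assumes "diff_pair_field D \<Theta>"
  shows "pair_field \<Theta>" "(u, v) \<in> \<Theta> \<Longrightarrow> (D u, D v) \<in> \<Theta>"
  using assms by (auto simp: diff_pair_field_def)

text \<open>If the derivatives of \<open>x\<close> are algebraically independent over the domain,
  saturation supplies an equally independent \<open>y\<close>. Otherwise let \<open>n\<close> be the
  first order at which the derivative is algebraic over the lower ones. Its minimal polynomial, with
  denominators cleared and moved to the range, has order \<open>n\<close>, and Blum's axiom with
  saturation gives a solution \<open>y\<close> that is generic below order \<open>n\<close>.
  Separability then determines the next derivative, so adjoining the derivatives up to order
  \<open>n\<close> already gives a differential field.\<close>

lemma diff_pair_field_extend:
  fixes D :: "'a::field_char_0 \<Rightarrow> 'a"
  assumes dc: "diff_closed D" and sat: "saturated D" and \<Theta>: "diff_pair_field D \<Theta>"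
    and card: "(card_of (Range \<Theta>), card_of (UNIV::'a set)) \<in> ordLess"
  shows "\<exists>y \<Theta>'. diff_pair_field D \<Theta>' \<and> \<Theta> \<subseteq> \<Theta>' \<and> (x, y) \<in> \<Theta>'"
proof -
  have D: "derivation D" using dc by (simp add: diff_closed_def)
  note \<Theta>f = diff_pair_fieldD(1)[OF \<Theta>]
  define xs where "xs j = (D ^^ j) x" for j
  define H where "H y I = \<Theta> \<union> {((D ^^ j) x, (D ^^ j) y) |j. j \<in> I}" for y I
  define T where "T y i = pair_gen (H y {..<i})" for y i
  \<comment> \<open>This is \<open>Domain (T y i)\<close> written without \<open>y\<close>, so that
    algebraicity can be settled before \<open>y\<close> is chosen.\<close>
  define E where "E i = Domain (pair_gen (Id_on (Domain \<Theta>) \<union> {(xs j, xs j) |j. j \<in> {..<i}}))" for i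
  define alg where "alg i \<longleftrightarrow> (\<exists>p. p \<noteq> 0 \<and> (\<forall>k. coeff p k \<in> E i) \<and> poly p (xs i) = 0)" for i
  have mem: "((D ^^ j) x, (D ^^ j) y) \<in> pair_gen (H y I)" if "j \<in> I" for j y I
    using that unfolding H_def by (blast intro: pair_gen.gen)
  have BD: "pair_field (Id_on (Domain \<Theta>))" and BR: "pair_field (Id_on (Range \<Theta>))"
    by (rule pair_field_Id_on_Domain[OF \<Theta>f], rule pair_field_Id_on_Range[OF \<Theta>f])
  have DT: "Domain (T y i) = E i" for y i
  proof
    show "Domain (T y i) \<subseteq> E i" unfolding T_def E_def
      by (rule Domain_pair_gen_mono) (auto simp: H_def xs_def)
    show "E i \<subseteq> Domain (T y i)" unfolding T_def E_def
      by (rule Domain_pair_gen_mono) (auto simp: H_def xs_def)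
  qed
  have Efrac: "is_frac (Domain \<Theta>) xs {..<i} u" if "u \<in> E i" for u i
    by (rule is_frac_pair_gen[OF BD _ that[unfolded E_def]]) auto
  have RT: "is_frac (Range \<Theta>) (\<lambda>j. (D ^^ j) y) {..<i} v" if "v \<in> Range (T y i)" for v y i
  proof -
    from that obtain u where "(u, v) \<in> T y i" by (rule RangeE)
    hence "(v, u) \<in> pair_gen ((H y {..<i})\<inverse>)" unfolding T_def by (rule pair_gen_converse)
    hence "v \<in> Domain (pair_gen ((H y {..<i})\<inverse>))" by blast
    thus ?thesis by (rule is_frac_pair_gen[OF BR, rotated]) (auto simp: H_def)
  qed
  have sub: "pair_field (T y (Suc i))" if "pair_field (pair_gen (insert ((D ^^ i) x, (D ^^ i) y) (T y i)))" for y i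
  proof -
    have "T y (Suc i) \<subseteq> pair_gen (insert ((D ^^ i) x, (D ^^ i) y) (T y i))"
      unfolding T_def[of y "Suc i"] by (rule pair_gen_mono) (auto simp: H_def T_def less_Suc_eq intro: pair_gen.gen)
    thus ?thesis using that unfolding T_def pair_field_pair_gen by blast
  qed
  \<comment> \<open>Below the first algebraic order both sequences of derivatives are independent,
    so every step of the tower is a transcendental adjunction.\<close>
  have tower: "pair_field (T y i)"
    if "\<And>j. j < i \<Longrightarrow> \<not> alg j" "generic (Range \<Theta>) (\<lambda>j. (D ^^ j) y) {..<i}" for y i
    using that
  proof (induction i)
    case 0
    have "T y 0 \<subseteq> \<Theta>" unfolding T_def by (rule pair_gen_least[OF \<Theta>f]) (auto simp: H_def)
    hence "u = 0 \<longleftrightarrow> v = 0" if "(u, v) \<in> T y 0" for u v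
      using that by (intro pair_fieldD(7)[OF \<Theta>f]) (rule subsetD)
    thus ?case unfolding T_def pair_field_pair_gen by simp
  next
    case (Suc i)
    have g: "generic (Range \<Theta>) (\<lambda>j. (D ^^ j) y) {..<i}"
      using Suc.prems(2) unfolding generic_def lessThan_Suc by blast
    have IH: "pair_field (T y i)" using Suc.IH[OF Suc.prems(1) g] by simp
    show ?case
    proof (rule sub, rule pair_field_adjoin_transcendental[OF IH])
      fix p :: "'a poly" assume "p \<noteq> 0" "\<And>k. coeff p k \<in> Domain (T y i)"
      thus "poly p ((D ^^ i) x) \<noteq> 0" using Suc.prems(1)[of i] unfolding alg_def DT xs_def by auto
    next
      fix p :: "'a poly" assume p: "p \<noteq> 0" "\<And>k. coeff p k \<in> Range (T y i)"
      show "poly p ((D ^^ i) y) \<noteq> 0"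
        by (rule transcendental_if_generic[OF BR, of "\<lambda>j. (D ^^ j) y" i "{..<i}"])
          (use p RT Suc.prems(2) in \<open>auto simp: lessThan_Suc\<close>)
    qed
  qed
  have closed: "diff_pair_field D (pair_gen (H y I))"
    if "pair_field (pair_gen (H y I))" "\<And>j. j \<in> I \<Longrightarrow> ((D ^^ Suc j) x, (D ^^ Suc j) y) \<in> pair_gen (H y I)" for y I
    unfolding diff_pair_field_def
  proof (intro conjI allI impI that(1))
    fix u v assume uv: "(u, v) \<in> pair_gen (H y I)"
    show "(D u, D v) \<in> pair_gen (H y I)"
    proof (rule pair_gen_derivation[OF D _ _ uv])
      fix u v assume "(u, v) \<in> H y I"
      then consider "(u, v) \<in> \<Theta>" | j where "j \<in> I" "u = (D ^^ j) x" "v = (D ^^ j) y" unfolding H_def by blast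
      thus "(D u, D v) \<in> pair_gen (H y I)"
      proof cases
        case 1
        thus ?thesis using diff_pair_fieldD(2)[OF \<Theta>] by (auto simp: H_def intro: pair_gen.gen)
      next
        case 2
        thus ?thesis using that(2)[of j] by simp
      qed
    qed (auto intro: pair_gen.gen)
  qed
  show ?thesis
  proof (cases "\<exists>i. alg i")
    case False
    have "\<exists>y. (\<forall>f\<in>{}. deval D f y = 0) \<and> generic (Range \<Theta>) (\<lambda>j. (D ^^ j) y) UNIV"
      by (rule saturated_generic[OF sat BR card]) (use diff_closed_avoid[OF dc] in auto)
    then obtain y where y: "generic (Range \<Theta>) (\<lambda>j. (D ^^ j) y) UNIV" by blast
    hence Tf: "pair_field (T y i)" for i
      by (intro tower) (use False in \<open>auto simp: generic_def\<close>)
    have mono: "T y i \<subseteq> T y j" if "i \<le> j" for i j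
      unfolding T_def by (rule pair_gen_mono) (use that in \<open>auto simp: H_def\<close>)
    \<comment> \<open>Each generated pair uses finitely many derivatives; the whole relation is the
      union of the increasing chain \<open>T y i\<close>, and compatibility with zero passes to the
      union.\<close>
    have un: "\<exists>i. z \<in> T y i" if "z \<in> pair_gen (H y UNIV)" for z
      using that
    proof (induction rule: pair_gen.induct)
      case (gen g)
      then consider "g \<in> \<Theta>" | j where "g = ((D ^^ j) x, (D ^^ j) y)" unfolding H_def by blast
      thus ?case
      proof cases
        case 1 thus ?thesis unfolding T_def by (auto simp: H_def intro: pair_gen.gen)
      next
        case 2 thus ?thesis unfolding T_def using mem[of j "{..<Suc j}" y] by auto
      qed
    next
      case (add u v u' v')
      then obtain i j where "(u, v) \<in> T y i" "(u', v') \<in> T y j" by blast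
      hence "(u, v) \<in> T y (max i j)" "(u', v') \<in> T y (max i j)" using mono[of i "max i j"] mono[of j "max i j"] by auto
      thus ?case unfolding T_def by (blast intro: pair_gen.add)
    next
      case (mult u v u' v')
      then obtain i j where "(u, v) \<in> T y i" "(u', v') \<in> T y j" by blast
      hence "(u, v) \<in> T y (max i j)" "(u', v') \<in> T y (max i j)" using mono[of i "max i j"] mono[of j "max i j"] by auto
      thus ?case unfolding T_def by (blast intro: pair_gen.mult)
    qed (unfold T_def, (blast intro: pair_gen.intros)+)
    have "pair_field (pair_gen (H y UNIV))"
      unfolding pair_field_pair_gen using un pair_fieldD(7)[OF Tf] by blast
    hence "diff_pair_field D (pair_gen (H y UNIV))"
      by (rule closed) (rule mem, simp)
    moreover have "(x, y) \<in> pair_gen (H y UNIV)"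
      using mem[of 0 UNIV y] by simp
    moreover have "\<Theta> \<subseteq> pair_gen (H y UNIV)" by (auto simp: H_def intro: pair_gen.gen)
    ultimately show ?thesis by blast
  next
    case True
    define n where "n = (LEAST i. alg i)"
    have n: "alg n" "\<And>i. i < n \<Longrightarrow> \<not> alg i"
      unfolding n_def using True by (auto intro: LeastI dest: not_less_Least)
    define P where "P k \<longleftrightarrow> (\<exists>p. p \<noteq> 0 \<and> (\<forall>k. coeff p k \<in> E n) \<and> poly p (xs n) = 0 \<and> degree p = k)" for k
    have "\<exists>k. P k" using n(1) unfolding alg_def P_def by blast
    hence "P (LEAST k. P k)" by (meson LeastI)
    then obtain f where f: "f \<noteq> 0" "\<And>k. coeff f k \<in> E n" "poly f (xs n) = 0" "degree f = (LEAST k. P k)"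
      unfolding P_def by blast
    have fmin: "degree f \<le> degree p" if "p \<noteq> 0" "\<And>k. coeff p k \<in> E n" "poly p (xs n) = 0" for p
      unfolding f(4) by (rule Least_le) (use that in \<open>auto simp: P_def\<close>)
    have nn: "n \<notin> {..<n}" by simp
    obtain G h where h: "mp_over (Domain \<Theta>) h" "mpvars h \<subseteq> {..<n}" "mpeval h xs \<noteq> 0"
      and G: "\<And>j. j \<le> degree f \<Longrightarrow> mp_over (Domain \<Theta>) (G j)" "\<And>j. j \<le> degree f \<Longrightarrow> mpvars (G j) \<subseteq> {..<n}"
        "\<And>j. j \<le> degree f \<Longrightarrow> mpeval (G j) xs = coeff f j * mpeval h xs"
      and Q: "mp_over (Domain \<Theta>) (\<Sum>j\<le>degree f. G j * mvar n ^ j)"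
        "mpvars (\<Sum>j\<le>degree f. G j * mvar n ^ j) \<subseteq> insert n {..<n}"
        "\<And>z. mpeval (\<Sum>j\<le>degree f. G j * mvar n ^ j) (xs(n := z)) = mpeval h xs * poly f z"
      by (rule clear_denominators[OF BD nn Efrac[OF f(2)]]) blast
    define F where "F = (\<Sum>j\<le>degree f. G j * mvar n ^ j)"
    \<comment> \<open>The order must be exactly \<open>n\<close>, or Blum's axiom would not admit
      inequations in all variables below \<open>n\<close>. Without variable \<open>n\<close>, the
      root of \<open>f\<close> would make it vanish everywhere.\<close>
    have "n \<in> mpvars F"
    proof (rule ccontr)
      assume "n \<notin> mpvars F"
      hence "mpeval F (xs(n := z)) = mpeval F (xs(n := xs n))" for z by (intro mpeval_cong) auto
      hence "mpeval h xs * poly f z = mpeval h xs * poly f (xs n)" for z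
        unfolding Q(3)[symmetric] F_def .
      hence "poly f z = 0" for z using f(3) h(3) by simp
      thus False using f(1) poly_all_0_iff_0 by blast
    qed
    have "\<exists>q. j \<le> degree f \<longrightarrow> mp_pair \<Theta> (G j) q" for j
      using mp_pair_ex[OF \<Theta>f] G(1)[of j] unfolding mp_over_iff by blast
    then obtain G' where G': "\<And>j. j \<le> degree f \<Longrightarrow> mp_pair \<Theta> (G j) (G' j)" by metis
    define F' where "F' = (\<Sum>j\<le>degree f. G' j * mvar n ^ j)"
    have FF': "mp_pair \<Theta> F F'" unfolding F_def F'_def
      by (intro mp_pair_sum[OF \<Theta>f] mp_pair_mult[OF \<Theta>f] mp_pair_power[OF \<Theta>f] mp_pair_mvar[OF \<Theta>f]) (use G' in auto)
    have v: "n \<in> mpvars F'" "mpvars F' \<subseteq> {..n}"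
      using \<open>n \<in> mpvars F\<close> Q(2) mp_pair_vars[OF \<Theta>f FF'] unfolding F_def by auto
    hence ord: "dorder F' = n" unfolding dorder_def using finite_mpvars[of F']
      by (intro Max_eqI) auto
    have "\<exists>y. (\<forall>f\<in>{F'}. deval D f y = 0) \<and> generic (Range \<Theta>) (\<lambda>j. (D ^^ j) y) {..<n}"
    proof (rule saturated_generic[OF sat BR card])
      show "mp_over (Range \<Theta>) f" if "f \<in> {F'}" for f
        using that FF' unfolding mp_over_iff by (auto simp: mp_pair_def)
      fix g :: "'a mpoly" assume g: "g \<noteq> 0" "mpvars g \<subseteq> {..<n}"
      have "mpvars g = {} \<or> dorder g < dorder F'"
        unfolding ord by (rule dorder_less[OF g(2)])
      thus "\<exists>a. (\<forall>f\<in>{F'}. deval D f a = 0) \<and> deval D g a \<noteq> 0"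
        using diff_closedD[OF dc _ g(1)] v(1) by blast
    qed
    then obtain y where y: "deval D F' y = 0" "generic (Range \<Theta>) (\<lambda>j. (D ^^ j) y) {..<n}" by blast
    have Tn: "pair_field (T y n)" by (rule tower[OF n(2) y(2)])
    \<comment> \<open>\<open>p\<close> is \<open>f\<close> scaled by the common denominator; in this
      form each coefficient has an explicit partner in \<open>p'\<close>.\<close>
    define p where "p = (\<Sum>j\<le>degree f. monom (mpeval (G j) xs) j)"
    define p' where "p' = (\<Sum>j\<le>degree f. monom (mpeval (G' j) (\<lambda>j. (D ^^ j) y)) j)"
    have p: "p = smult (mpeval h xs) f"
      by (rule poly_eqI) (simp add: p_def coeff_sum coeff_monom G(3) mult.commute coeff_eq_0)
    have pp: "poly_pair (T y n) p p'"
      unfolding poly_pair_def p_def p'_def coeff_sum coeff_monom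
    proof (intro allI pair_field_sum[OF Tn])
      fix i j assume "j \<in> {..degree f}"
      hence j: "mp_pair \<Theta> (G j) (G' j)" "mpvars (G j) \<subseteq> {..<n}" using G G' by auto
      have "(mpeval (G j) xs, mpeval (G' j) (\<lambda>j. (D ^^ j) y)) \<in> T y n"
        by (rule mp_pair_mpeval[OF Tn _ j(1)])
          (use j(2) in \<open>auto simp: T_def H_def xs_def intro!: pair_gen.gen\<close>)
      thus "(if j = i then mpeval (G j) xs else 0, if j = i then mpeval (G' j) (\<lambda>j. (D ^^ j) y) else 0) \<in> T y n"
        using pair_fieldD(1)[OF Tn] by (cases "j = i") auto
    qed
    have p0: "p \<noteq> 0" "poly p ((D ^^ n) x) = 0" using f h p by (auto simp: xs_def)
    have p'0: "poly p' ((D ^^ n) y) = 0"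
    proof -
      have "poly p' ((D ^^ n) y) = deval D F' y"
        by (simp add: p'_def poly_sum poly_monom deval_def F'_def mpeval_sum mpeval_mult mpeval_power)
      thus ?thesis using y by simp
    qed
    have pmin: "degree p \<le> degree q" if "q \<noteq> 0" "\<And>i. coeff q i \<in> Domain (T y n)" "poly q ((D ^^ n) x) = 0" for q
      using fmin[of q] that p h(3) unfolding DT xs_def by simp
    have Tsn: "pair_field (T y (Suc n))"
      by (rule sub, rule pair_field_adjoin_algebraic[OF Tn pp p0(1) p0(2) p'0 pmin])
    have dp: "poly (pderiv p) ((D ^^ n) x) \<noteq> 0"
    proof (rule pderiv_nonzero_at_root[OF Tn p0(1) _ p0(2) pmin])
      show "coeff p i \<in> Domain (T y n)" for i using pp unfolding poly_pair_def by blast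
    qed
    have step: "(D u, D v) \<in> T y (Suc n)" if "(u, v) \<in> T y n" for u v
      unfolding T_def
    proof (rule pair_gen_derivation[OF D _ _ that[unfolded T_def]])
      fix u v assume "(u, v) \<in> H y {..<n}"
      then consider "(u, v) \<in> \<Theta>" | j where "j < n" "u = (D ^^ j) x" "v = (D ^^ j) y" unfolding H_def by blast
      thus "(D u, D v) \<in> pair_gen (H y {..<Suc n})"
      proof cases
        case 1
        thus ?thesis using diff_pair_fieldD(2)[OF \<Theta>] by (auto simp: H_def intro: pair_gen.gen)
      next
        case 2
        thus ?thesis using mem[of "Suc j" "{..<Suc n}" y] by simp
      qed
    qed (auto simp: H_def intro!: pair_gen.gen)
    have Tmono: "T y n \<subseteq> T y (Suc n)"
      unfolding T_def by (rule pair_gen_mono) (auto simp: H_def)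
    \<comment> \<open>The derivative of order \<open>n\<close> is the only generator whose
      derivative is not again a generator; its minimal polynomial supplies it.\<close>
    have last: "(D ((D ^^ n) x), D ((D ^^ n) y)) \<in> T y (Suc n)"
      by (rule pair_field_derivation_algebraic[OF D Tsn step _ _ pp p0(2) p'0 dp])
        (use Tmono mem[of n "{..<Suc n}" y] in \<open>simp_all add: T_def\<close>)
    have "diff_pair_field D (pair_gen (H y {..<Suc n}))"
    proof (rule closed)
      show "pair_field (pair_gen (H y {..<Suc n}))" using Tsn by (simp add: T_def)
      fix j assume "j \<in> {..<Suc n}"
      then consider "j = n" | "Suc j < Suc n" by fastforce
      thus "((D ^^ Suc j) x, (D ^^ Suc j) y) \<in> pair_gen (H y {..<Suc n})"
      proof cases
        case 1 thus ?thesis using last by (simp add: T_def)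
      next
        case 2 thus ?thesis by (intro mem) simp
      qed
    qed
    moreover have "(x, y) \<in> pair_gen (H y {..<Suc n})"
      using mem[of 0 "{..<Suc n}" y] by simp
    moreover have "\<Theta> \<subseteq> pair_gen (H y {..<Suc n})" by (auto simp: H_def intro: pair_gen.gen)
    ultimately show ?thesis by blast
  qed
qed

section \<open>From fields of pairs to embeddings of \<open>L\<close>\<close>

lemma diff_pair_field_restrict:
  assumes "diff_pair_field D \<Theta>" "diff_subfield D L"
  shows "diff_pair_field D {(u, v) \<in> \<Theta>. u \<in> L}"
  using assms unfolding diff_pair_field_def pair_field_def diff_subfield_def by simp

text \<open>The parameters of the types to be realised lie in the range, so saturation requires the
  range to be small; it is an image of a subset of \<open>L\<close>.\<close>

lemma card_Range_pair_field:
  assumes "pair_field \<Theta>" "Domain \<Theta> \<subseteq> L" "(card_of L, card_of (UNIV::'b set)) \<in> ordLess"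
  shows "(card_of (Range \<Theta>), card_of (UNIV::'b set)) \<in> ordLess"
proof -
  have "Range \<Theta> \<subseteq> (\<lambda>u. SOME v. (u, v) \<in> \<Theta>) ` L"
  proof
    fix v assume "v \<in> Range \<Theta>"
    then obtain u where uv: "(u, v) \<in> \<Theta>" by blast
    hence "(u, SOME v. (u, v) \<in> \<Theta>) \<in> \<Theta>" by (rule someI)
    hence "(SOME v. (u, v) \<in> \<Theta>) = v" using pair_field_eq_iff[OF assms(1) uv] by blast
    thus "v \<in> (\<lambda>u. SOME v. (u, v) \<in> \<Theta>) ` L" using uv assms(2) by blast
  qed
  hence "(card_of (Range \<Theta>), card_of L) \<in> ordLeq"
    using card_of_mono1 card_of_image ordLeq_transitive by blast
  thus ?thesis using assms(3) ordLeq_ordLess_trans by blast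
qed

lemma diff_pair_field_extend_finite:
  fixes D :: "'a::field_char_0 \<Rightarrow> 'a"
  assumes dc: "diff_closed D" and sat: "saturated D" and L: "diff_subfield D L"
    and card: "(card_of L, card_of (UNIV::'a set)) \<in> ordLess"
    and "finite F" "F \<subseteq> L" "diff_pair_field D \<Theta>" "Domain \<Theta> \<subseteq> L"
  shows "\<exists>\<Theta>'. diff_pair_field D \<Theta>' \<and> \<Theta> \<subseteq> \<Theta>' \<and> Domain \<Theta>' \<subseteq> L \<and> F \<subseteq> Domain \<Theta>'"
  using assms(5-)
proof (induction F)
  case empty
  thus ?case by blast
next
  case (insert x F)
  then obtain \<Theta>1 where 1: "diff_pair_field D \<Theta>1" "\<Theta> \<subseteq> \<Theta>1" "Domain \<Theta>1 \<subseteq> L" "F \<subseteq> Domain \<Theta>1" by auto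
  have "(card_of (Range \<Theta>1), card_of (UNIV::'a set)) \<in> ordLess"
    using card_Range_pair_field diff_pair_fieldD(1)[OF 1(1)] 1(3) card by blast
  then obtain y \<Theta>2 where 2: "diff_pair_field D \<Theta>2" "\<Theta>1 \<subseteq> \<Theta>2" "(x, y) \<in> \<Theta>2"
    using diff_pair_field_extend[OF dc sat 1(1)] by blast
  \<comment> \<open>The one-element extension says nothing about the size of its domain; restricting
    to \<open>L\<close> bounds it again before the next element.\<close>
  let ?T = "{(u, v) \<in> \<Theta>2. u \<in> L}"
  have "diff_pair_field D ?T" using diff_pair_field_restrict[OF 2(1) L] .
  moreover have "\<Theta> \<subseteq> ?T" using 1 2 by auto
  moreover have "Domain ?T \<subseteq> L" by auto
  moreover have "insert x F \<subseteq> Domain ?T" using 1 2 insert.prems(1) by blast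
  ultimately show ?case by blast
qed

lemma diff_hom_of_pair_field:
  assumes "diff_pair_field D \<Theta>" "Domain \<Theta> = L" "Id_on K \<subseteq> \<Theta>" "diff_subfield D L"
  shows "\<exists>\<tau>\<in>diff_hom D K L. \<forall>(u, v)\<in>\<Theta>. \<tau> u = v"
proof -
  note \<Theta> = diff_pair_fieldD[OF assms(1)]
  define \<tau> where "\<tau> u = (SOME v. (u, v) \<in> \<Theta>)" for u
  have t: "(u, \<tau> u) \<in> \<Theta>" if "u \<in> L" for u
    using that unfolding assms(2)[symmetric] \<tau>_def by (auto intro: someI)
  have eq: "\<tau> u = v" if "(u, v) \<in> \<Theta>" for u v
    using pair_field_eq_iff[OF \<Theta>(1) that t] that assms(2) by blast
  have "\<tau> \<in> diff_hom D K L" unfolding diff_hom_def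
  proof (intro CollectI conjI ballI)
    show "inj_on \<tau> L"
    proof (rule inj_onI)
      fix u v assume "u \<in> L" "v \<in> L" "\<tau> u = \<tau> v"
      thus "u = v" using pair_field_eq_iff[OF \<Theta>(1) t t] by blast
    qed
    fix x y assume "x \<in> L" "y \<in> L"
    thus "\<tau> (x + y) = \<tau> x + \<tau> y" "\<tau> (x * y) = \<tau> x * \<tau> y"
      using t pair_fieldD[OF \<Theta>(1)] by (auto intro!: eq)
  qed (use assms t \<Theta> pair_fieldD[OF \<Theta>(1)] in \<open>auto intro!: eq\<close>)
  thus ?thesis using eq by blast
qed

lemma diff_homD:
  assumes "\<tau> \<in> diff_hom D K L"
  shows "x \<in> L \<Longrightarrow> y \<in> L \<Longrightarrow> \<tau> (x + y) = \<tau> x + \<tau> y" "x \<in> L \<Longrightarrow> y \<in> L \<Longrightarrow> \<tau> (x * y) = \<tau> x * \<tau> y"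
    "\<tau> 1 = 1" "x \<in> L \<Longrightarrow> \<tau> (D x) = D (\<tau> x)" "x \<in> K \<Longrightarrow> \<tau> x = x" "inj_on \<tau> L"
  using assms by (auto simp: diff_hom_def)

lemma pair_field_of_diff_hom:
  assumes \<tau>: "\<tau> \<in> diff_hom D K L" and L: "diff_subfield D L"
  shows "diff_pair_field D {(u, \<tau> u) |u. u \<in> L}"
proof -
  note t = diff_homD[OF \<tau>] and l = diff_subfieldD[OF L]
  have 0: "\<tau> 0 = 0" using t(1)[of 0 0] l(1) by (metis add_0 add_cancel_right_right)
  have m: "\<tau> (- u) = - \<tau> u" if "u \<in> L" for u
    using t(1)[of u "- u"] l that 0 by (simp add: eq_neg_iff_add_eq_0 add.commute)
  have z: "\<tau> u = 0 \<longleftrightarrow> u = 0" if "u \<in> L" for u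
    using t(6) that l 0 by (metis inj_onD)
  have i: "\<tau> (inverse u) = inverse (\<tau> u)" if "u \<in> L" for u
  proof (cases "u = 0")
    case False
    hence "\<tau> u * \<tau> (inverse u) = 1" using t(2)[of u "inverse u"] t(3) l that by simp
    thus ?thesis by (metis inverse_unique)
  qed (use 0 in simp)
  show ?thesis unfolding diff_pair_field_def pair_field_def
    using t l 0 m z i by auto
qed

lemma diff_hom_extension:
  fixes D :: "'a::field_char_0 \<Rightarrow> 'a"
  assumes dc: "diff_closed D" and sat: "saturated D" and L: "diff_subfield D L"
    and card: "(card_of L, card_of (UNIV::'a set)) \<in> ordLess"
    and gen: "finite F" "L = dgen D (K \<union> F)"
    and \<Theta>: "diff_pair_field D \<Theta>" "Domain \<Theta> \<subseteq> L" "Id_on K \<subseteq> \<Theta>"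
  shows "\<exists>\<tau>\<in>diff_hom D K L. \<forall>(u, v)\<in>\<Theta>. \<tau> u = v"
proof -
  have "F \<subseteq> L" using gen(2) dgen_superset by blast
  then obtain \<Theta>' where *: "diff_pair_field D \<Theta>'" "\<Theta> \<subseteq> \<Theta>'" "Domain \<Theta>' \<subseteq> L" "F \<subseteq> Domain \<Theta>'"
    using diff_pair_field_extend_finite[OF dc sat L card gen(1) _ \<Theta>(1,2)] by blast
  have "diff_subfield D (Domain \<Theta>')"
    using *(1) unfolding diff_subfield_def diff_pair_field_def pair_field_def by (auto simp: Domain_iff) blast+
  moreover have "K \<union> F \<subseteq> Domain \<Theta>'" using * \<Theta>(3) by blast
  ultimately have "Domain \<Theta>' = L" using *(3) gen(2) dgen_least by blast
  moreover have "Id_on K \<subseteq> \<Theta>'" using *(2) \<Theta>(3) by blast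
  ultimately obtain \<tau> where "\<tau> \<in> diff_hom D K L" "\<forall>(u, v)\<in>\<Theta>'. \<tau> u = v"
    using diff_hom_of_pair_field[OF *(1) _ _ L] by blast
  thus ?thesis using *(2) by (intro bexI[of _ \<tau>]) auto
qed

section \<open>Constants of a strongly normal extension\<close>

text \<open>If \<open>c\<close> is algebraic over \<open>K\<close>, it can be sent to another root
  of its minimal polynomial, which exists because the degree exceeds 1 and the root is simple. If
  \<open>c\<close> is transcendental, it can be sent to \<open>c + 1\<close>, another constant
  transcendental over \<open>K\<close>.\<close>

lemma exists_hom_moving_constant:
  fixes D :: "'a::field_char_0 \<Rightarrow> 'a"
  assumes dc: "diff_closed D" and sat: "saturated D" and L: "diff_subfield D L"
    and card: "(card_of L, card_of (UNIV::'a set)) \<in> ordLess"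
    and gen: "finite F" "L = dgen D (K \<union> F)" and K: "diff_subfield D K" "K \<subseteq> L"
    and c: "c \<in> L" "D c = 0" "c \<notin> K"
  shows "\<exists>\<tau>\<in>diff_hom D K L. \<tau> c \<noteq> c"
proof -
  have D: "derivation D" using dc by (simp add: diff_closed_def)
  have \<Theta>: "pair_field (Id_on K)" using K(1) unfolding pair_field_def diff_subfield_def by auto
  have DK: "(D u, D v) \<in> Id_on K" if "(u, v) \<in> Id_on K" for u v
    using that K(1) unfolding diff_subfield_def by auto
  have main: "\<exists>\<tau>\<in>diff_hom D K L. \<tau> c \<noteq> c"
    if y: "y \<noteq> c" "pair_field (pair_gen (insert (c, y) (Id_on K)))"
      "(D c, D y) \<in> pair_gen (insert (c, y) (Id_on K))" for y
  proof -
    let ?T = "pair_gen (insert (c, y) (Id_on K))"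
    have "diff_pair_field D ?T" unfolding diff_pair_field_def
    proof (intro conjI allI impI y)
      fix u v assume uv: "(u, v) \<in> ?T"
      show "(D u, D v) \<in> ?T"
        by (rule pair_gen_derivation[OF D _ _ uv]) (use y DK in \<open>auto intro: pair_gen.gen\<close>)
    qed
    moreover have "Domain ?T \<subseteq> L"
    proof -
      have "pair_field (Id_on L)" using L unfolding pair_field_def diff_subfield_def by auto
      hence "pair_gen (Id_on L) \<subseteq> Id_on L" by (rule pair_gen_least) simp
      moreover have "Domain ?T \<subseteq> Domain (pair_gen (Id_on L))"
        by (rule Domain_pair_gen_mono) (use c(1) K(2) in auto)
      ultimately show ?thesis by auto
    qed
    moreover have "Id_on K \<subseteq> ?T" "(c, y) \<in> ?T" by (auto intro: pair_gen.gen)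
    ultimately obtain \<tau> where "\<tau> \<in> diff_hom D K L" "\<forall>(u, v)\<in>?T. \<tau> u = v" "(c, y) \<in> ?T"
      using diff_hom_extension[OF dc sat L card gen, of ?T] by blast
    thus ?thesis using y(1) by (intro bexI[of _ \<tau>]) auto
  qed
  have poly_K: "poly_pair (Id_on K) p p" if "\<And>i. coeff p i \<in> K" for p using that by (simp add: poly_pair_def Id_on_iff)
  show ?thesis
  proof (cases "\<exists>p. p \<noteq> 0 \<and> (\<forall>i. coeff p i \<in> K) \<and> poly p c = 0")
    case True
    define P where "P k \<longleftrightarrow> (\<exists>p. p \<noteq> 0 \<and> (\<forall>i. coeff p i \<in> K) \<and> poly p c = 0 \<and> degree p = k)" for k
    have "\<exists>k. P k" using True unfolding P_def by blast
    hence "P (LEAST k. P k)" by (meson LeastI)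
    then obtain f where f: "f \<noteq> 0" "\<And>i. coeff f i \<in> K" "poly f c = 0" "degree f = (LEAST k. P k)"
      unfolding P_def by blast
    have min: "degree f \<le> degree p" if "p \<noteq> 0" "\<And>i. coeff p i \<in> Domain (Id_on K)" "poly p c = 0" for p
      unfolding f(4) by (rule Least_le) (use that in \<open>auto simp: P_def\<close>)
    have df: "poly (pderiv f) c \<noteq> 0"
      by (rule pderiv_nonzero_at_root[OF \<Theta> f(1) _ f(3) min]) (use f(2) in auto)
    obtain g where g: "f = [:- c, 1:] * g" using f(3) by (auto simp: poly_eq_0_iff_dvd)
    \<comment> \<open>A constant cofactor would make \<open>f\<close> linear and put
      \<open>c\<close> into \<open>K\<close>.\<close>
    have "degree g > 0"
    proof (rule ccontr)
      assume "\<not> degree g > 0"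
      then obtain b where b: "g = [:b:]" by (auto elim: degree_eq_zeroE)
      hence "f = [:- c * b, b:]" using g by simp
      hence "- c * b \<in> K" "b \<in> K" using f(2)[of 0] f(2)[of 1] by auto
      moreover have "b \<noteq> 0" using b g f(1) by auto
      ultimately have "- ((- c * b) / b) \<in> K"
        by (intro diff_subfieldD(5,9)[OF K(1)])
      thus False using c(3) \<open>b \<noteq> 0\<close> by simp
    qed
    then obtain y where y: "poly g y = 0" using diff_closed_root[OF dc] by blast
    have "y \<noteq> c"
    proof
      assume "y = c"
      hence "poly (pderiv f) c = 0" unfolding g pderiv_mult using y by (simp add: pderiv_pCons)
      thus False using df by simp
    qed
    moreover have fy: "poly f y = 0" using y g by simp
    have pf: "pair_field (pair_gen (insert (c, y) (Id_on K)))"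
      by (rule pair_field_adjoin_algebraic[OF \<Theta> poly_K[OF f(2)] f(1) f(3) fy min])
    moreover have "(D c, D y) \<in> pair_gen (insert (c, y) (Id_on K))"
      by (rule pair_field_derivation_algebraic[OF D pf _ _ _ poly_K[OF f(2)] f(3) fy df])
        (use DK in \<open>auto intro: pair_gen.gen\<close>)
    ultimately show ?thesis by (rule main)
  next
    case False
    have "pair_field (pair_gen (insert (c, c + 1) (Id_on K)))"
    proof (rule pair_field_adjoin_transcendental[OF \<Theta>])
      fix p :: "'a poly" assume p: "p \<noteq> 0" "\<And>i. coeff p i \<in> Range (Id_on K)"
      \<comment> \<open>The shift by 1 maps nonzero polynomials over \<open>K\<close> to nonzero
        polynomials over \<open>K\<close>, so an equation for \<open>c + 1\<close> would be one for
        \<open>c\<close>.\<close>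
      have 1: "coeff (pcompose p [:1, 1:]) i \<in> K" for i
      proof -
        have "poly_pair (Id_on K) (pcompose p [:1, 1:]) (pcompose p [:1, 1:])" if "\<And>i. coeff p i \<in> K" for p
          using that
        proof (induction p)
          case 0 show ?case using poly_pair_closed(7)[OF \<Theta>] by simp
        next
          case (pCons a p)
          have "a \<in> K" "\<And>i. coeff p i \<in> K" using pCons.prems[of 0] pCons.prems[of "Suc _"] by auto
          moreover have "poly_pair (Id_on K) [:1, 1:] [:1, 1:]"
            using diff_subfieldD[OF K(1)] by (auto simp: poly_pair_def coeff_pCons split: nat.splits)
          ultimately show ?case using pCons.IH unfolding pcompose_pCons
            by (intro poly_pair_closed[OF \<Theta>]) auto
        qed
        thus ?thesis using p unfolding poly_pair_def by auto
      qed
      have "pcompose p [:1, 1:] \<noteq> 0" using p(1) pcompose_eq_0[of p "[:1, 1:]"] by auto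
      hence "poly (pcompose p [:1, 1:]) c \<noteq> 0" using False 1 by blast
      thus "poly p (c + 1) \<noteq> 0" by (simp add: poly_pcompose add.commute)
    qed (use False in auto)
    moreover have "(D c, D (c + 1)) \<in> pair_gen (insert (c, c + 1) (Id_on K))"
      using c(2) derivation_1[OF D] by (simp add: derivation_add[OF D] pair_gen.zero)
    ultimately show ?thesis by (intro main[of "c + 1"]) auto
  qed
qed

section \<open>Linear disjointness from the constants\<close>

text \<open>The Wronskian argument without determinants. After dividing by \<open>l k\<close>,
  differentiation kills the term of \<open>k\<close> and leaves a shorter relation, with the same
  coefficients, among the derivatives. By induction there is one with constants of \<open>L\<close>;
  undoing the differentiation costs a single constant of integration, which lies in
  \<open>L\<close>.\<close>

lemma constant_dependence_descends:
  assumes D: "derivation D" and L: "diff_subfield D L"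
    and "finite I" "\<And>i. i \<in> I \<Longrightarrow> l i \<in> L" "\<And>i. i \<in> I \<Longrightarrow> D (c i) = 0"
    "(\<Sum>i\<in>I. c i * l i) = 0" "k \<in> I" "c k \<noteq> 0"
  shows "\<exists>e. (\<forall>i\<in>I. e i \<in> L \<and> D (e i) = 0) \<and> (\<exists>i\<in>I. e i \<noteq> 0) \<and> (\<Sum>i\<in>I. e i * l i) = 0"
  using assms(3-)
proof (induction "card I" arbitrary: I l k rule: less_induct)
  case less
  note l = diff_subfieldD[OF L]
  note D0 = derivation_0[OF D] and D1 = derivation_1[OF D]
  show ?case
  proof (cases "l k = 0")
    case True
    show ?thesis
      by (rule exI[of _ "\<lambda>i. if i = k then 1 else 0"])
        (use True less.prems l D0 D1 in \<open>auto intro!: sum.neutral\<close>)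
  next
    case False
    define m where "m i = l i / l k" for i
    have m: "m i \<in> L" if "i \<in> I" for i unfolding m_def using that less.prems l by auto
    have lm: "l i = m i * l k" for i using False by (simp add: m_def)
    have mk: "m k = 1" using False by (simp add: m_def)
    have sm: "(\<Sum>i\<in>I. c i * m i) = 0"
      using less.prems(4) False unfolding m_def times_divide_eq_right sum_divide_distrib[symmetric] by simp
    have "D (\<Sum>i\<in>I. c i * m i) = (\<Sum>i\<in>I. c i * D (m i))"
      unfolding derivation_sum[OF D] by (rule sum.cong) (use less.prems(3) in \<open>auto simp: derivation_mult[OF D]\<close>)
    hence "(\<Sum>i\<in>I. c i * D (m i)) = 0" using sm D0 by simp
    hence sd: "(\<Sum>i\<in>I - {k}. c i * D (m i)) = 0"
      using less.prems(1,5) mk D1 by (simp add: sum.remove)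
    \<comment> \<open>The shorter relation must be nontrivial; otherwise the normalised relation
      would read \<open>c k = 0\<close>.\<close>
    have "\<exists>j\<in>I - {k}. c j \<noteq> 0"
    proof (rule ccontr)
      assume "\<not> ?thesis"
      hence "(\<Sum>i\<in>I. c i * m i) = c k" using less.prems(1,5) mk by (simp add: sum.remove)
      thus False using sm less.prems(6) by simp
    qed
    then obtain j where j: "j \<in> I - {k}" "c j \<noteq> 0" by blast
    have "card (I - {k}) < card I" using less.prems(1,5) by (rule card_Diff1_less)
    from less.hyps[OF this _ _ _ sd j] obtain e where
      e: "\<forall>i\<in>I - {k}. e i \<in> L \<and> D (e i) = 0" "\<exists>i\<in>I - {k}. e i \<noteq> 0" "(\<Sum>i\<in>I - {k}. e i * D (m i)) = 0"
      using less.prems m l(7) by auto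
    \<comment> \<open>The derivative of \<open>s\<close> is the shorter relation, so
      \<open>s\<close> is constant, and \<open>- s\<close> is the coefficient to put at
      \<open>k\<close>, where \<open>m k = 1\<close>.\<close>
    define s where "s = (\<Sum>i\<in>I - {k}. e i * m i)"
    have sL: "s \<in> L" unfolding s_def using e(1) m l(4) by (intro diff_subfield_sum[OF L]) auto
    have "D s = (\<Sum>i\<in>I - {k}. e i * D (m i))"
      unfolding s_def derivation_sum[OF D] by (rule sum.cong) (use e(1) in \<open>auto simp: derivation_mult[OF D]\<close>)
    hence Ds: "D s = 0" using e(3) by simp
    define e' where "e' = e(k := - s)"
    have "(\<Sum>i\<in>I. e' i * m i) = e' k * m k + (\<Sum>i\<in>I - {k}. e' i * m i)"
      using less.prems(1,5) by (simp add: sum.remove)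
    also have "(\<Sum>i\<in>I - {k}. e' i * m i) = s" unfolding s_def by (rule sum.cong) (auto simp: e'_def)
    finally have "(\<Sum>i\<in>I. e' i * m i) = 0" using mk by (simp add: e'_def)
    hence "(\<Sum>i\<in>I. e' i * m i) * l k = 0" by simp
    hence "(\<Sum>i\<in>I. e' i * l i) = 0" unfolding sum_distrib_right lm[symmetric] mult.assoc .
    moreover have "\<forall>i\<in>I. e' i \<in> L \<and> D (e' i) = 0"
      using e(1) sL Ds l by (auto simp: e'_def derivation_minus[OF D])
    moreover have "\<exists>i\<in>I. e' i \<noteq> 0" using e(2) by (auto simp: e'_def)
    ultimately show ?thesis by blast
  qed
qed

text \<open>Relations with coefficients in \<open>C\<close> are combinations of relations with
  coefficients in the constants of \<open>L\<close>, so whatever satisfies the latter satisfies the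
  former. Each step subtracts a multiple of a relation over \<open>L\<close> to remove one
  coefficient.\<close>

lemma constant_relations_transfer:
  assumes D: "derivation D" and L: "diff_subfield D L"
    and "finite I" "\<And>i. i \<in> I \<Longrightarrow> l i \<in> L" "\<And>i. i \<in> I \<Longrightarrow> D (c i) = 0" "(\<Sum>i\<in>I. c i * l i) = 0"
    "\<And>e. (\<And>i. i \<in> I \<Longrightarrow> e i \<in> L \<and> D (e i) = 0) \<Longrightarrow> (\<Sum>i\<in>I. e i * l i) = 0 \<Longrightarrow> (\<Sum>i\<in>I. e i * l' i) = 0"
  shows "(\<Sum>i\<in>I. c i * l' i) = 0"
  using assms(3-)
proof (induction "card I" arbitrary: I c rule: less_induct)
  case less
  show ?case
  proof (cases "\<exists>k\<in>I. c k \<noteq> 0")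
    case False
    thus ?thesis by simp
  next
    case True
    then obtain k where "k \<in> I" "c k \<noteq> 0" by blast
    from constant_dependence_descends[OF D L less.prems(1-4) this] obtain e k where
      e: "\<And>i. i \<in> I \<Longrightarrow> e i \<in> L \<and> D (e i) = 0" "(\<Sum>i\<in>I. e i * l i) = 0" and k: "k \<in> I" "e k \<noteq> 0" by blast
    have e': "(\<Sum>i\<in>I. e i * l' i) = 0" by (rule less.prems(5)[OF e])
    \<comment> \<open>The multiple is chosen so that the coefficient at \<open>k\<close> becomes
      zero.\<close>
    define b where "b i = c i - c k / e k * e i" for i
    have Db: "D (b i) = 0" if "i \<in> I" for i
    proof -
      have "D (c k / e k) = 0"
        using derivation_divide[OF D k(2)] less.prems(3)[OF k(1)] e(1)[OF k(1)] by simp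
      thus ?thesis using that less.prems(3) e(1)
        by (simp add: b_def derivation_diff[OF D] derivation_mult[OF D] del: times_divide_eq_left)
    qed
    have bk: "b k = 0" using k by (simp add: b_def)
    have bs: "(\<Sum>i\<in>I. b i * z i) = (\<Sum>i\<in>I. c i * z i) - c k / e k * (\<Sum>i\<in>I. e i * z i)" for z
      by (simp add: b_def left_diff_distrib sum_subtractf sum_distrib_left mult.assoc)
    have rem: "(\<Sum>i\<in>I. b i * z i) = (\<Sum>i\<in>I - {k}. b i * z i)" for z
      using bk less.prems(1) k(1) by (simp add: sum.remove)
    have "(\<Sum>i\<in>I - {k}. b i * l' i) = 0"
    proof (rule less.hyps)
      show "card (I - {k}) < card I" using less.prems(1) k(1) by (rule card_Diff1_less)
      show "(\<Sum>i\<in>I - {k}. b i * l i) = 0" unfolding rem[symmetric] bs using e(2) less.prems(4) by simp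
      fix d assume d: "\<And>i. i \<in> I - {k} \<Longrightarrow> d i \<in> L \<and> D (d i) = 0" "(\<Sum>i\<in>I - {k}. d i * l i) = 0"
      \<comment> \<open>Extension by zero turns a relation on \<open>I - {k}\<close> into one on
        \<open>I\<close>, where the transfer hypothesis is available.\<close>
      have dd: "(\<Sum>i\<in>I. (d(k := 0)) i * z i) = (\<Sum>i\<in>I - {k}. d i * z i)" for z
        using less.prems(1) k(1) by (simp add: sum.remove)
      have "(\<Sum>i\<in>I. (d(k := 0)) i * l' i) = 0"
        by (rule less.prems(5)) (use d dd diff_subfieldD(1)[OF L] derivation_0[OF D] in auto)
      thus "(\<Sum>i\<in>I - {k}. d i * l' i) = 0" unfolding dd .
    qed (use less.prems Db in auto)
    thus ?thesis unfolding rem[symmetric] bs using e' by simp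
  qed
qed

section \<open>Fields of fractions of rings of pairs\<close>

text \<open>Unlike a pair field, such a relation need not be the graph of a map; compatibility with
  zero is established before fractions are formed.\<close>

definition diff_pair_ring :: "('a::field \<Rightarrow> 'a) \<Rightarrow> ('a \<times> 'a) set \<Rightarrow> bool" where
  "diff_pair_ring D \<Gamma> \<longleftrightarrow> (0, 0) \<in> \<Gamma> \<and> (1, 1) \<in> \<Gamma> \<and>
     (\<forall>u v u' v'. (u, v) \<in> \<Gamma> \<longrightarrow> (u', v') \<in> \<Gamma> \<longrightarrow> (u + u', v + v') \<in> \<Gamma> \<and> (u * u', v * v') \<in> \<Gamma>) \<and>
     (\<forall>u v. (u, v) \<in> \<Gamma> \<longrightarrow> (- u, - v) \<in> \<Gamma> \<and> (D u, D v) \<in> \<Gamma>)"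

definition pair_frac :: "('a::field \<times> 'a) set \<Rightarrow> ('a \<times> 'a) set" where
  "pair_frac \<Gamma> = {(u / u', v / v') |u v u' v'. (u, v) \<in> \<Gamma> \<and> (u', v') \<in> \<Gamma> \<and> u' \<noteq> 0}"

lemma diff_pair_ringD:
  assumes "diff_pair_ring D \<Gamma>"
  shows "(0, 0) \<in> \<Gamma>" "(1, 1) \<in> \<Gamma>"
    "(u, v) \<in> \<Gamma> \<Longrightarrow> (u', v') \<in> \<Gamma> \<Longrightarrow> (u + u', v + v') \<in> \<Gamma>"
    "(u, v) \<in> \<Gamma> \<Longrightarrow> (u', v') \<in> \<Gamma> \<Longrightarrow> (u * u', v * v') \<in> \<Gamma>"
    "(u, v) \<in> \<Gamma> \<Longrightarrow> (- u, - v) \<in> \<Gamma>" "(u, v) \<in> \<Gamma> \<Longrightarrow> (D u, D v) \<in> \<Gamma>"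
    "(u, v) \<in> \<Gamma> \<Longrightarrow> (u', v') \<in> \<Gamma> \<Longrightarrow> (u - u', v - v') \<in> \<Gamma>"
  using assms unfolding diff_pair_ring_def diff_conv_add_uminus[of u u'] diff_conv_add_uminus[of v v'] by blast+

lemma pair_frac_superset: "diff_pair_ring D \<Gamma> \<Longrightarrow> \<Gamma> \<subseteq> pair_frac \<Gamma>"
proof
  fix z assume "diff_pair_ring D \<Gamma>" "z \<in> \<Gamma>"
  moreover obtain u v where "z = (u, v)" by (cases z)
  ultimately have "z = (u / 1, v / 1)" "(u, v) \<in> \<Gamma>" "(1, 1) \<in> \<Gamma>"
    using diff_pair_ringD(2) by auto
  thus "z \<in> pair_frac \<Gamma>" unfolding pair_frac_def by (metis (mono_tags, lifting) mem_Collect_eq zero_neq_one)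
qed

lemma pair_fracI: "(u, v) \<in> \<Gamma> \<Longrightarrow> (u', v') \<in> \<Gamma> \<Longrightarrow> u' \<noteq> 0 \<Longrightarrow> (u / u', v / v') \<in> pair_frac \<Gamma>"
  unfolding pair_frac_def by blast

lemma diff_pair_field_pair_frac:
  assumes D: "derivation D" and \<Gamma>: "diff_pair_ring D \<Gamma>" and z: "\<And>u v. (u, v) \<in> \<Gamma> \<Longrightarrow> u = 0 \<longleftrightarrow> v = 0"
  shows "diff_pair_field D (pair_frac \<Gamma>)"
proof -
  note r = diff_pair_ringD[OF \<Gamma>]
  have E: "\<exists>a b a' b'. (a, b) \<in> \<Gamma> \<and> (a', b') \<in> \<Gamma> \<and> a' \<noteq> 0 \<and> b' \<noteq> 0 \<and> u = a / a' \<and> v = b / b'"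
    if "(u, v) \<in> pair_frac \<Gamma>" for u v
    using that z unfolding pair_frac_def by blast
  show ?thesis unfolding diff_pair_field_def pair_field_def
  proof (intro conjI allI impI)
    show "(0, 0) \<in> pair_frac \<Gamma>" "(1, 1) \<in> pair_frac \<Gamma>" using pair_frac_superset[OF \<Gamma>] r by blast+
    fix u v assume "(u, v) \<in> pair_frac \<Gamma>"
    then obtain a b a' b' where 1: "(a, b) \<in> \<Gamma>" "(a', b') \<in> \<Gamma>" "a' \<noteq> 0" "b' \<noteq> 0" "u = a / a'" "v = b / b'"
      using E by blast
    show "(- u, - v) \<in> pair_frac \<Gamma>" using pair_fracI[OF r(5)[OF 1(1)] 1(2,3)] 1 by simp
    show "(inverse u, inverse v) \<in> pair_frac \<Gamma>"
    proof (cases "a = 0")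
      case True
      thus ?thesis using z[OF 1(1)] 1(5,6) \<open>(0, 0) \<in> pair_frac \<Gamma>\<close> by simp
    next
      case False
      thus ?thesis using pair_fracI[OF 1(2,1)] 1(5,6) by simp
    qed
    show "u = 0 \<longleftrightarrow> v = 0" using z[OF 1(1)] 1 by simp
    have "((D a * a' - a * D a') / (a' * a'), (D b * b' - b * D b') / (b' * b')) \<in> pair_frac \<Gamma>"
      by (rule pair_fracI) (use 1 r in auto)
    thus "(D u, D v) \<in> pair_frac \<Gamma>" using 1 by (simp add: derivation_divide[OF D])
    fix u2 v2 assume "(u2, v2) \<in> pair_frac \<Gamma>"
    then obtain c d c' d' where 2: "(c, d) \<in> \<Gamma>" "(c', d') \<in> \<Gamma>" "c' \<noteq> 0" "d' \<noteq> 0" "u2 = c / c'" "v2 = d / d'"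
      using E by blast
    have "((a * c' + c * a') / (a' * c'), (b * d' + d * b') / (b' * d')) \<in> pair_frac \<Gamma>"
      by (rule pair_fracI) (use 1 2 r in auto)
    thus "(u + u2, v + v2) \<in> pair_frac \<Gamma>" using 1 2 by (simp add: add_frac_eq)
    have "((a * c) / (a' * c'), (b * d) / (b' * d')) \<in> pair_frac \<Gamma>"
      by (rule pair_fracI) (use 1 2 r in auto)
    thus "(u * u2, v * v2) \<in> pair_frac \<Gamma>" using 1 2 by simp
  qed
qed

section \<open>Linear spans over the constants\<close>

text \<open>The same constant multiplies both components: for the graph of a homomorphism this is
  the candidate for its extension by the identity on the constants.\<close>

inductive_set pair_span :: "('a::field \<Rightarrow> 'a) \<Rightarrow> ('a \<times> 'a) set \<Rightarrow> ('a \<times> 'a) set" for D G where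
  zero: "(0, 0) \<in> pair_span D G"
| step: "D c = 0 \<Longrightarrow> (u, v) \<in> G \<Longrightarrow> (w, w') \<in> pair_span D G \<Longrightarrow> (c * u + w, c * v + w') \<in> pair_span D G"

definition cspan :: "('a::field \<Rightarrow> 'a) \<Rightarrow> 'a set \<Rightarrow> 'a set" where
  "cspan D X = {w. (w, w) \<in> pair_span D (Id_on X)}"

lemma pair_span_add:
  assumes "(u, v) \<in> pair_span D G" "(u', v') \<in> pair_span D G"
  shows "(u + u', v + v') \<in> pair_span D G"
  using assms(1)
proof (induction rule: pair_span.induct)
  case (step c u v w w')
  from pair_span.step[OF step(1,2,4)] show ?case by (simp add: add.assoc)
qed (use assms(2) in auto)

lemma pair_span_scale:
  assumes D: "derivation D" and c: "D c = 0" and "(u, v) \<in> pair_span D G"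
  shows "(c * u, c * v) \<in> pair_span D G"
  using assms(3)
proof (induction rule: pair_span.induct)
  case (step d u v w w')
  have "D (c * d) = 0" using c step(1) by (simp add: derivation_mult[OF D])
  from pair_span.step[OF this step(2,4)] show ?case by (simp add: distrib_left mult.assoc)
qed (auto intro: pair_span.zero)

lemma pair_span_uminus:
  assumes D: "derivation D" and "(u, v) \<in> pair_span D G"
  shows "(- u, - v) \<in> pair_span D G"
  using pair_span_scale[OF D _ assms(2), of "- 1"] derivation_minus[OF D] derivation_1[OF D] by simp

lemma pair_span_superset:
  assumes "derivation D" "(u, v) \<in> G" shows "(u, v) \<in> pair_span D G"
  using pair_span.step[of D 1 u v G 0 0, OF derivation_1[OF assms(1)] assms(2) pair_span.zero] by simp

lemma pair_span_mono: "G \<subseteq> H \<Longrightarrow> pair_span D G \<subseteq> pair_span D H"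
proof (rule subrelI)
  fix u v assume "G \<subseteq> H" "(u, v) \<in> pair_span D G"
  from this(2,1) show "(u, v) \<in> pair_span D H"
    by (induction rule: pair_span.induct) (auto intro: pair_span.intros)
qed

lemma diff_pair_ring_pair_span:
  assumes D: "derivation D" and G: "diff_pair_ring D G"
  shows "diff_pair_ring D (pair_span D G)"
proof -
  note r = diff_pair_ringD[OF G]
  have mult1: "(a * u, b * v) \<in> pair_span D G" if ab: "(a, b) \<in> G" and "(u, v) \<in> pair_span D G" for a b u v
    using that(2)
  proof (induction rule: pair_span.induct)
    case (step c u v w w')
    from pair_span.step[OF step(1) r(4)[OF ab step(2)] step(4)] show ?case
      by (simp add: distrib_left mult_ac)
  qed (auto intro: pair_span.zero)
  have mult: "(a * u, b * v) \<in> pair_span D G"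
    if "(a, b) \<in> pair_span D G" and uv: "(u, v) \<in> pair_span D G" for a b u v
    using that(1)
  proof (induction rule: pair_span.induct)
    case (step c a b w w')
    from pair_span_add[OF pair_span_scale[OF D step(1) mult1[OF step(2) uv]] step(4)] show ?case
      by (simp only: distrib_right mult.assoc)
  qed (auto intro: pair_span.zero)
  have der: "(D a, D b) \<in> pair_span D G" if "(a, b) \<in> pair_span D G" for a b
    using that
  proof (induction rule: pair_span.induct)
    case (step c a b w w')
    from pair_span.step[OF step(1) r(6)[OF step(2)] step(4)] show ?case
      using step(1) by (simp add: derivation_add[OF D] derivation_mult[OF D])
  qed (auto simp: derivation_0[OF D] intro: pair_span.zero)
  show ?thesis unfolding diff_pair_ring_def
    by (simp add: pair_span_add mult der pair_span_uminus[OF D] pair_span.zero pair_span_superset[OF D r(2)])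
qed

lemma pair_span_sum:
  assumes "(w, w') \<in> pair_span D G"
  shows "\<exists>(n::nat) c u v. (\<forall>i<n. D (c i) = 0 \<and> (u i, v i) \<in> G) \<and> w = (\<Sum>i<n. c i * u i) \<and> w' = (\<Sum>i<n. c i * v i)"
  using assms
proof (induction rule: pair_span.induct)
  case zero
  show ?case by (rule exI[of _ 0]) simp
next
  case (step c0 a b w w')
  then obtain n c u v where *: "\<forall>i<n. D (c i) = 0 \<and> (u i, v i) \<in> G" "w = (\<Sum>i<n. c i * u i)" "w' = (\<Sum>i<n::nat. c i * v i)"
    by blast
  show ?case
    by (rule exI[of _ "Suc n"], rule exI[of _ "c(n := c0)"], rule exI[of _ "u(n := a)"], rule exI[of _ "v(n := b)"])
      (use * step in \<open>auto simp: less_Suc_eq add.commute\<close>)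
qed

lemma pair_span_Id_on: "(u, v) \<in> pair_span D (Id_on X) \<Longrightarrow> u = v \<and> u \<in> cspan D X"
proof -
  have "u = v" if "(u, v) \<in> pair_span D (Id_on X)" for u v
    using that by (induction rule: pair_span.induct) auto
  thus "(u, v) \<in> pair_span D (Id_on X) \<Longrightarrow> u = v \<and> u \<in> cspan D X" unfolding cspan_def by fastforce
qed

lemma cspan_mono: "X \<subseteq> Y \<Longrightarrow> cspan D X \<subseteq> cspan D Y"
  unfolding cspan_def using pair_span_mono[of "Id_on X" "Id_on Y"] by (auto simp: Id_on_def)

lemma cspan_empty: "cspan D {} = {0}"
proof -
  have "u = 0 \<and> v = 0" if "(u, v) \<in> pair_span D (Id_on {})" for u v
    using that by (induction rule: pair_span.induct) auto
  thus ?thesis unfolding cspan_def by (auto intro: pair_span.zero)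
qed

text \<open>Splitting off one generator at a time makes membership in a finite span expressible by
  existential quantifiers.\<close>

lemma cspan_insert:
  assumes D: "derivation D"
  shows "y \<in> cspan D (insert l X) \<longleftrightarrow> (\<exists>c w. D c = 0 \<and> y = c * l + w \<and> w \<in> cspan D X)"
proof
  have "\<exists>c w. D c = 0 \<and> y = c * l + w \<and> w \<in> cspan D X" if "(y, z) \<in> pair_span D (Id_on (insert l X))" for y z
    using that
  proof (induction rule: pair_span.induct)
    case zero
    show ?case by (rule exI[of _ 0], rule exI[of _ 0]) (auto simp: derivation_0[OF D] cspan_def intro: pair_span.zero)
  next
    case (step c u v w w')
    then obtain c' w2 where *: "D c' = 0" "w = c' * l + w2" "w2 \<in> cspan D X" by auto
    show ?case
    proof (cases "u = l")
      case True
      thus ?thesis using * step(1)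
        by (intro exI[of _ "c + c'"] exI[of _ w2]) (auto simp: derivation_add[OF D] algebra_simps)
    next
      case False
      hence "(u, u) \<in> Id_on X" using step(2) by auto
      hence "c * u + w2 \<in> cspan D X" using * step(1) unfolding cspan_def by (auto intro: pair_span.step)
      thus ?thesis using * by (intro exI[of _ c'] exI[of _ "c * u + w2"]) (auto simp: algebra_simps)
    qed
  qed
  thus "y \<in> cspan D (insert l X) \<Longrightarrow> \<exists>c w. D c = 0 \<and> y = c * l + w \<and> w \<in> cspan D X"
    unfolding cspan_def by blast
  assume "\<exists>c w. D c = 0 \<and> y = c * l + w \<and> w \<in> cspan D X"
  then obtain c w where *: "D c = 0" "y = c * l + w" "w \<in> cspan D X" by blast
  have "(w, w) \<in> pair_span D (Id_on (insert l X))" using *(3) cspan_mono[of X "insert l X" D] unfolding cspan_def by auto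
  from pair_span.step[OF *(1) _ this, of l l] show "y \<in> cspan D (insert l X)" unfolding cspan_def *(2) by auto
qed

lemma cspan_finite_support:
  assumes "y \<in> cspan D X"
  shows "\<exists>Y. finite Y \<and> Y \<subseteq> X \<and> y \<in> cspan D Y"
proof -
  have "\<exists>Y. finite Y \<and> Y \<subseteq> X \<and> y \<in> cspan D Y" if "(y, z) \<in> pair_span D (Id_on X)" for y z
    using that
  proof (induction rule: pair_span.induct)
    case zero
    show ?case by (rule exI[of _ "{}"]) (simp add: cspan_empty)
  next
    case (step c u v w w')
    then obtain Y where "finite Y" "Y \<subseteq> X" "w \<in> cspan D Y" by auto
    moreover have "(w, w) \<in> pair_span D (Id_on (insert u Y))"
      using \<open>w \<in> cspan D Y\<close> cspan_mono[of Y "insert u Y" D] unfolding cspan_def by auto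
    from pair_span.step[OF step(1) _ this, of u u] have "c * u + w \<in> cspan D (insert u Y)" unfolding cspan_def by auto
    ultimately show ?case using step(2) by (intro exI[of _ "insert u Y"]) auto
  qed
  from this[of y y] assms show ?thesis unfolding cspan_def by auto
qed

lemma cspan_sum:
  assumes D: "derivation D" and "finite X" "y \<in> cspan D X"
  shows "\<exists>c. (\<forall>l. D (c l) = 0) \<and> y = (\<Sum>l\<in>X. c l * l)"
  using assms(2,3)
proof (induction X arbitrary: y)
  case empty
  thus ?case by (intro exI[of _ "\<lambda>_. 0"]) (auto simp: cspan_empty derivation_0[OF D])
next
  case (insert l X)
  then obtain c0 w where *: "D c0 = 0" "y = c0 * l + w" "w \<in> cspan D X" unfolding cspan_insert[OF D] by blast
  then obtain c where c: "\<forall>l. D (c l) = 0" "w = (\<Sum>l\<in>X. c l * l)" using insert.IH by blast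
  have "(\<Sum>i\<in>X. (c(l := c0)) i * i) = (\<Sum>l\<in>X. c l * l)" by (rule sum.cong) (use insert in auto)
  thus ?case using * c insert by (intro exI[of _ "c(l := c0)"]) auto
qed

text \<open>The span of a differential ring over the constants is again a differential ring and
  contains both; its quotients form a differential field.\<close>

lemma dgen_constants_fraction:
  assumes D: "derivation D" and R: "diff_pair_ring D (Id_on R)"
    and x: "x \<in> dgen D (R \<union> consts_of D UNIV)"
  shows "\<exists>p\<in>cspan D R. \<exists>q\<in>cspan D R. q \<noteq> 0 \<and> x = p / q"
proof -
  let ?T = "pair_frac (pair_span D (Id_on R))"
  note S = diff_pair_ring_pair_span[OF D R]
  have T: "diff_pair_field D ?T"
    by (rule diff_pair_field_pair_frac[OF D S]) (use pair_span_Id_on in blast)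
  have T_id: "u = v" if "(u, v) \<in> ?T" for u v
    using that pair_span_Id_on unfolding pair_frac_def by blast
  have "diff_subfield D {u. (u, u) \<in> ?T}"
    using T unfolding diff_subfield_def diff_pair_field_def pair_field_def by auto
  moreover have "R \<union> consts_of D UNIV \<subseteq> {u. (u, u) \<in> ?T}"
  proof -
    have "(u, u) \<in> pair_span D (Id_on R)" if "u \<in> R \<union> consts_of D UNIV" for u
    proof (cases "u \<in> R")
      case True
      thus ?thesis by (intro pair_span_superset[OF D]) auto
    next
      case False
      hence "D u = 0" using that by (auto simp: consts_of_def)
      from pair_span.step[of D u 1 1 "Id_on R" 0 0, OF this diff_pair_ringD(2)[OF R] pair_span.zero]
      show ?thesis by simp
    qed
    thus ?thesis using pair_frac_superset[OF S] by blast
  qed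
  ultimately have "(x, x) \<in> ?T" using x dgen_least by blast
  then obtain u v u' v' where "(u, v) \<in> pair_span D (Id_on R)" "(u', v') \<in> pair_span D (Id_on R)" "u' \<noteq> 0" "x = u / u'"
    unfolding pair_frac_def by blast
  thus ?thesis using pair_span_Id_on by blast
qed

lemma fm_definable_cspan:
  assumes D: "derivation D" and X: "finite X" "X \<subseteq> B" and "0 \<in> B"
  shows "fm_definable D B (\<lambda>e. e m \<in> cspan D X)"
  using X
proof (induction X arbitrary: m)
  case empty
  thus ?case unfolding cspan_empty using assms(4) by (auto intro!: fm_definable_eq term_definable_var term_definable_const)
next
  case (insert l X)
  \<comment> \<open>The variables above \<open>m\<close> hold the coefficient of \<open>l\<close>
    and the remaining sum; quantifying over them leaves \<open>e m\<close> untouched.\<close>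
  let ?P = "\<lambda>e. D (e (Suc m)) = 0 \<and> e m = e (Suc m) * l + e (Suc (Suc m)) \<and> e (Suc (Suc m)) \<in> cspan D X"
  have "fm_definable D B ?P" using insert assms(4)
    by (intro fm_definable_and fm_definable_eq term_definable_D term_definable_var term_definable_add term_definable_mult term_definable_const) auto
  from fm_definable_ex[OF fm_definable_ex[OF this, of "Suc (Suc m)"], of "Suc m"] show ?case
    unfolding cspan_insert[OF D] by (simp)
qed

section \<open>Embeddings of a strongly normal extension\<close>

lemma dteval_in:
  assumes "diff_subfield D F" "dtparams t \<subseteq> F" "\<And>i. e i \<in> F"
  shows "dteval D e t \<in> F"
  using assms(2) by (induction t) (auto simp: assms(3) diff_subfieldD[OF assms(1)])

lemma diff_pair_ring_terms:
  assumes "0 \<in> K" "1 \<in> K"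
  shows "diff_pair_ring D {(dteval D e t, dteval D e' t) |t. dtparams t \<subseteq> K}" (is "diff_pair_ring D ?T")
  unfolding diff_pair_ring_def
proof (intro conjI allI impI)
  have I: "(dteval D e t, dteval D e' t) \<in> ?T" if "dtparams t \<subseteq> K" for t using that by blast
  show "(0, 0) \<in> ?T" using I[of "DConst 0"] assms by simp
  show "(1, 1) \<in> ?T" using I[of "DConst 1"] assms by simp
  fix u v assume "(u, v) \<in> ?T"
  then obtain t where t: "u = dteval D e t" "v = dteval D e' t" "dtparams t \<subseteq> K" by blast
  show "(- u, - v) \<in> ?T" using I[of "DNeg t"] t by simp
  show "(D u, D v) \<in> ?T" using I[of "DDer t"] t by simp
  fix u2 v2 assume "(u2, v2) \<in> ?T"
  then obtain s where s: "u2 = dteval D e s" "v2 = dteval D e' s" "dtparams s \<subseteq> K" by blast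
  show "(u + u2, v + v2) \<in> ?T" using I[of "DAdd t s"] t s by simp
  show "(u * u2, v * v2) \<in> ?T" using I[of "DMul t s"] t s by simp
qed

lemma diff_hom_0:
  assumes "\<tau> \<in> diff_hom D K L" "diff_subfield D L"
  shows "\<tau> 0 = 0" "x \<in> L \<Longrightarrow> \<tau> x = 0 \<longleftrightarrow> x = 0" "x \<in> L \<Longrightarrow> \<tau> (- x) = - \<tau> x"
    "x \<in> L \<Longrightarrow> \<tau> (inverse x) = inverse (\<tau> x)"
proof -
  note p = diff_pair_fieldD(1)[OF pair_field_of_diff_hom[OF assms]]
  show "\<tau> 0 = 0" using pair_fieldD(1)[OF p] by auto
  show "\<tau> x = 0 \<longleftrightarrow> x = 0" if "x \<in> L" using pair_fieldD(7)[OF p, of x "\<tau> x"] that by auto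
  show "\<tau> (- x) = - \<tau> x" if "x \<in> L" using pair_fieldD(5)[OF p, of x "\<tau> x"] that by auto
  show "\<tau> (inverse x) = inverse (\<tau> x)" if "x \<in> L" using pair_fieldD(6)[OF p, of x "\<tau> x"] that by auto
qed

lemma diff_hom_sum:
  assumes "\<tau> \<in> diff_hom D K L" "diff_subfield D L" "\<And>i. i \<in> I \<Longrightarrow> f i \<in> L"
  shows "\<tau> (sum f I) = (\<Sum>i\<in>I. \<tau> (f i))"
  using assms(3)
  by (induction I rule: infinite_finite_induct)
    (auto simp: diff_hom_0[OF assms(1,2)] diff_homD[OF assms(1)] diff_subfield_sum[OF assms(2)])

lemma dteval_diff_hom:
  assumes "\<tau> \<in> diff_hom D K L" "diff_subfield D L" "K \<subseteq> L" "dtparams t \<subseteq> K" "\<And>i. e i \<in> L"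
  shows "dteval D (\<lambda>i. \<tau> (e i)) t = \<tau> (dteval D e t)"
  using assms(4)
proof (induction t)
  case (DAdd s t)
  thus ?case using dteval_in[OF assms(2) _ assms(5)] assms(3) diff_homD[OF assms(1)] by force
next
  case (DMul s t)
  thus ?case using dteval_in[OF assms(2) _ assms(5)] assms(3) diff_homD[OF assms(1)] by force
next
  case (DNeg t)
  thus ?case using dteval_in[OF assms(2) _ assms(5)] assms(3) diff_hom_0[OF assms(1,2)] by force
next
  case (DDer t)
  thus ?case using dteval_in[OF assms(2) _ assms(5)] assms(3) diff_homD[OF assms(1)] by force
qed (use diff_homD[OF assms(1)] in auto)

lemma diff_hom_mono: "\<tau> \<in> diff_hom D N M \<Longrightarrow> K \<subseteq> N \<Longrightarrow> L \<subseteq> M \<Longrightarrow> \<tau> \<in> diff_hom D K L"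
  unfolding diff_hom_def by (blast intro: inj_on_subset)

lemma diff_subfield_Domain:
  assumes "diff_pair_field D \<Theta>" shows "diff_subfield D (Domain \<Theta>)" "diff_subfield D (Range \<Theta>)"
    "diff_subfield D {x. (x, x) \<in> \<Theta>}"
  using assms unfolding diff_subfield_def diff_pair_field_def pair_field_def
  by (auto simp: Domain_iff Range_iff) blast+

locale strongly_normal_extension =
  fixes D :: "'a::field_char_0 \<Rightarrow> 'a" and K L :: "'a set" and fs :: "'a list"
  assumes dc: "diff_closed D" and sat: "saturated D"
    and card: "(card_of L, card_of (UNIV::'a set)) \<in> ordLess"
    and K: "diff_subfield D K" and L: "diff_subfield D L" and KL: "K \<subseteq> L"
    and gen: "L = dgen D (K \<union> set fs)"
    and str: "\<And>\<tau>. \<tau> \<in> diff_hom D K L \<Longrightarrow> strong D L \<tau>"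
begin

lemma D: "derivation D" using dc by (simp add: diff_closed_def)

abbreviation "C \<equiv> consts_of D UNIV"

definition "M = dgen D (L \<union> C)"
definition "N = dgen D (K \<union> C)"
text \<open>Valuations are total, so the finite tuple of generators is padded with zeros, which
  every embedding fixes.\<close>

definition "a i = (if i < length fs then fs ! i else 0)"
definition "R0 = {dteval D a t |t. dtparams t \<subseteq> K}"

lemma C_iff: "c \<in> C \<longleftrightarrow> D c = 0" by (simp add: consts_of_def)

lemma M: "diff_subfield D M" "L \<subseteq> M" "C \<subseteq> M"
  using diff_subfield_dgen dgen_superset unfolding M_def by blast+

lemma N: "diff_subfield D N" "K \<subseteq> N" "C \<subseteq> N" "N \<subseteq> M"
  using diff_subfield_dgen dgen_superset dgen_mono[of "K \<union> C" "L \<union> C" D] KL unfolding N_def M_def by blast+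

text \<open>If \<open>e\<close> and \<open>e'\<close> satisfy the same differential equations over
  \<open>K\<close>, the values of terms correspond, their fractions form a partial isomorphism, and
  this extends to all of \<open>L\<close>. The family \<open>e\<close> may generate a proper
  subfield: the lemma serves for a single element as well as for the generators.\<close>

lemma hom_of_terms:
  assumes "\<And>i. e i \<in> L" "\<And>t. dtparams t \<subseteq> K \<Longrightarrow> dteval D e t = 0 \<longleftrightarrow> dteval D e' t = 0"
  shows "\<exists>\<tau>\<in>diff_hom D K L. \<forall>i. \<tau> (e i) = e' i"
proof -
  define \<Gamma> where "\<Gamma> = {(dteval D e t, dteval D e' t) |t. dtparams t \<subseteq> K}"
  have I: "(dteval D e t, dteval D e' t) \<in> \<Gamma>" if "dtparams t \<subseteq> K" for t
    using that unfolding \<Gamma>_def by blast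
  have \<Gamma>: "diff_pair_ring D \<Gamma>" unfolding \<Gamma>_def by (rule diff_pair_ring_terms) (rule diff_subfieldD[OF K])+
  have T: "diff_pair_field D (pair_frac \<Gamma>)"
    by (rule diff_pair_field_pair_frac[OF D \<Gamma>]) (use assms(2) in \<open>auto simp: \<Gamma>_def\<close>)
  note sup = pair_frac_superset[OF \<Gamma>]
  have "u \<in> L" if "(u, v) \<in> \<Gamma>" for u v
    using that dteval_in[OF L, of _ e] assms(1) KL unfolding \<Gamma>_def by auto
  hence "Domain (pair_frac \<Gamma>) \<subseteq> L" unfolding pair_frac_def by (auto intro!: diff_subfieldD(9)[OF L])
  moreover have "Id_on K \<subseteq> pair_frac \<Gamma>"
  proof
    fix z assume "z \<in> Id_on K"
    then obtain k where "k \<in> K" "z = (k, k)" by auto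
    hence "z \<in> \<Gamma>" using I[of "DConst k"] by simp
    thus "z \<in> pair_frac \<Gamma>" using sup by blast
  qed
  ultimately obtain \<tau> where \<tau>: "\<tau> \<in> diff_hom D K L" "\<forall>(u, v)\<in>pair_frac \<Gamma>. \<tau> u = v"
    using diff_hom_extension[OF dc sat L card _ gen T] by blast
  have "\<tau> (e i) = e' i" for i
  proof -
    have "(e i, e' i) \<in> pair_frac \<Gamma>" using I[of "DVar i"] sup by auto
    thus ?thesis using \<tau>(2) by auto
  qed
  thus ?thesis using \<tau>(1) by blast
qed

lemma constants_in_K: assumes "c \<in> L" "D c = 0" shows "c \<in> K"
proof (rule ccontr)
  assume "c \<notin> K"
  then obtain \<tau> where "\<tau> \<in> diff_hom D K L" "\<tau> c \<noteq> c"
    using exists_hom_moving_constant[OF dc sat L card _ gen K KL assms] by auto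
  thus False using str assms unfolding strong_def consts_of_def by auto
qed

lemma a_in_L: "a i \<in> L"
  using gen dgen_superset[of "K \<union> set fs" D] diff_subfieldD(1)[OF L] unfolding a_def by (auto)

lemma a_in_R0: "a i \<in> R0"
  unfolding R0_def by (auto intro!: exI[of _ "DVar i"])

lemma K_subset_R0: "K \<subseteq> R0"
proof
  fix k assume "k \<in> K"
  hence "dtparams (DConst k) \<subseteq> K" "k = dteval D a (DConst k)" by auto
  thus "k \<in> R0" unfolding R0_def by blast
qed

lemma R0_subset_L: "R0 \<subseteq> L"
  unfolding R0_def using dteval_in[OF L, of _ a] a_in_L KL by auto

lemma diff_pair_ring_R0: "diff_pair_ring D (Id_on R0)"
proof -
  have "Id_on R0 = {(dteval D a t, dteval D a t) |t. dtparams t \<subseteq> K}" unfolding R0_def by auto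
  thus ?thesis using diff_pair_ring_terms[OF diff_subfieldD(1,2)[OF K]] by simp
qed

lemma M_fraction: "x \<in> M \<Longrightarrow> \<exists>p\<in>cspan D R0. \<exists>q\<in>cspan D R0. q \<noteq> 0 \<and> x = p / q"
proof (rule dgen_constants_fraction[OF D diff_pair_ring_R0])
  have "set fs \<subseteq> R0" using a_in_R0 unfolding a_def in_set_conv_nth subset_iff by metis
  hence "K \<union> set fs \<subseteq> dgen D (R0 \<union> C)" using K_subset_R0 dgen_superset[of "R0 \<union> C" D] by blast
  hence "L \<subseteq> dgen D (R0 \<union> C)" unfolding gen by (rule dgen_least[OF diff_subfield_dgen])
  hence "M \<subseteq> dgen D (R0 \<union> C)" unfolding M_def
    using dgen_superset[of "R0 \<union> C" D] by (intro dgen_least[OF diff_subfield_dgen]) auto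
  thus "x \<in> M \<Longrightarrow> x \<in> dgen D (R0 \<union> C)" by blast
qed

lemma hom_dgen: "\<tau> \<in> diff_hom D K L \<Longrightarrow> dgen D (\<tau> ` L \<union> C) = M"
  using str unfolding strong_def M_def by auto

lemma hom_image_M: "\<tau> \<in> diff_hom D K L \<Longrightarrow> x \<in> L \<Longrightarrow> \<tau> x \<in> M"
  using hom_dgen[of \<tau>] dgen_superset[of "\<tau> ` L \<union> C" D] by blast

text \<open>Compactness: if no finite subset of \<open>R0\<close> worked, the type of \<open>x\<close> over \<open>K\<close> together with
  the negations of all finite representations would be realised, contradicting strong normality.\<close>

lemma uniform_representation:
  assumes "x \<in> L"
  shows "\<exists>X. finite X \<and> X \<subseteq> R0 \<and>
     (\<forall>\<tau>\<in>diff_hom D K L. \<exists>p\<in>cspan D X. \<exists>q\<in>cspan D X. q \<noteq> 0 \<and> \<tau> x * q = p)"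
proof (rule ccontr)
  assume neg: "\<not> ?thesis"
  \<comment> \<open>Multiplying out the denominator avoids division, for which there is no symbol in
    the language.\<close>
  define Pr where "Pr X e \<longleftrightarrow> (\<exists>p. \<exists>q. p \<in> cspan D X \<and> q \<in> cspan D X \<and> \<not> q = 0 \<and> e (0::nat) * q = p)" for X e
  have Pr_iff: "Pr X (\<lambda>_. z) \<longleftrightarrow> (\<exists>p\<in>cspan D X. \<exists>q\<in>cspan D X. q \<noteq> 0 \<and> z * q = p)" for X z
    unfolding Pr_def by auto
  have neg': "\<not> (\<exists>X. finite X \<and> X \<subseteq> R0 \<and> (\<forall>\<tau>\<in>diff_hom D K L. Pr X (\<lambda>_. \<tau> x)))"
    unfolding Pr_iff by (rule neg)
  have mono: "Pr X e \<Longrightarrow> X \<subseteq> Y \<Longrightarrow> Pr Y e" for X Y e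
    unfolding Pr_def using cspan_mono by blast
  define T where "T = {t. dtparams t \<subseteq> K}"
  define X where "X = {X. finite X \<and> X \<subseteq> R0}"
  \<comment> \<open>These predicates fix which differential equations over \<open>K\<close> hold,
    that is, the isomorphism type of \<open>x\<close> over \<open>K\<close>.\<close>
  define P1 where "P1 = (\<lambda>t e. dteval D e t = 0 \<longleftrightarrow> dteval D (\<lambda>_. x) t = 0) ` T"
  define P2 where "P2 = (\<lambda>X e. \<not> Pr X e) ` X"
  have L0: "0 \<in> L" by (rule diff_subfieldD(1)[OF L])
  have "\<exists>y. \<forall>P\<in>P1 \<union> P2. P (\<lambda>_. y)"
  proof (rule saturatedD[OF sat card])
    fix P assume "P \<in> P1 \<union> P2"
    then consider t where "t \<in> T" "P = (\<lambda>e. dteval D e t = 0 \<longleftrightarrow> dteval D (\<lambda>_. x) t = 0)"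
      | Y where "Y \<in> X" "P = (\<lambda>e. \<not> Pr Y e)" unfolding P1_def P2_def by blast
    thus "fm_definable D L P"
    proof cases
      case 1
      have t: "dtparams t \<subseteq> L" using 1(1) KL unfolding T_def by blast
      have f: "fm_definable D L (\<lambda>e. dteval D e t = 0)"
        by (intro fm_definable_eq term_definable_dteval term_definable_const L0 t)
      show ?thesis
      proof (cases "dteval D (\<lambda>_. x) t = 0")
        case True thus ?thesis using 1(2) f by simp
      next
        case False thus ?thesis using 1(2) fm_definable_not[OF f] by simp
      qed
    next
      case 2
      have Y: "finite Y" "Y \<subseteq> L" using 2(1) R0_subset_L unfolding X_def by auto
      have "fm_definable D L (\<lambda>e. e (1::nat) \<in> cspan D Y \<and> e 2 \<in> cspan D Y \<and> \<not> e 2 = 0 \<and> e (0::nat) * e 2 = e 1)"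
        by (intro fm_definable_and fm_definable_not fm_definable_eq fm_definable_cspan[OF D Y L0] term_definable_mult term_definable_var term_definable_const L0)
      from fm_definable_ex[OF fm_definable_ex[OF this, of 2], of 1] have "fm_definable D L (\<lambda>e. Pr Y e)"
        unfolding Pr_def by simp
      thus ?thesis unfolding 2(2) by (rule fm_definable_not)
    qed
  next
    fix \<F> assume \<F>: "finite \<F>" "\<F> \<subseteq> P1 \<union> P2"
    have "finite (\<F> \<inter> P2)" "\<F> \<inter> P2 \<subseteq> (\<lambda>X e. \<not> Pr X e) ` X" using \<F> P2_def by auto
    then obtain \<Gamma> where \<Gamma>: "\<Gamma> \<subseteq> X" "finite \<Gamma>" "\<F> \<inter> P2 = (\<lambda>X e. \<not> Pr X e) ` \<Gamma>"
      by (meson finite_subset_image)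
    \<comment> \<open>One embedding that escapes the union of the finitely many sets escapes each of
      them, because the spans are monotone.\<close>
    have "finite (\<Union>\<Gamma>) \<and> \<Union>\<Gamma> \<subseteq> R0" using \<Gamma>(1,2) unfolding X_def by auto
    then obtain \<tau> where \<tau>: "\<tau> \<in> diff_hom D K L" and nPr: "\<not> Pr (\<Union>\<Gamma>) (\<lambda>_. \<tau> x)"
      using neg' by auto
    have "P (\<lambda>_. \<tau> x)" if "P \<in> \<F>" for P
    proof (cases "P \<in> P1")
      case True
      then obtain t where t: "t \<in> T" "P = (\<lambda>e. dteval D e t = 0 \<longleftrightarrow> dteval D (\<lambda>_. x) t = 0)"
        unfolding P1_def by blast
      have "dteval D (\<lambda>_. \<tau> x) t = \<tau> (dteval D (\<lambda>_. x) t)"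
        by (rule dteval_diff_hom[OF \<tau>(1) L KL]) (use t assms in \<open>auto simp: T_def\<close>)
      moreover have "dteval D (\<lambda>_. x) t \<in> L"
        by (rule dteval_in[OF L]) (use t assms KL in \<open>auto simp: T_def\<close>)
      ultimately show ?thesis unfolding t(2) using diff_hom_0(2)[OF \<tau>(1) L] by simp
    next
      case False
      hence "P \<in> \<F> \<inter> P2" using that \<F> by blast
      then obtain Y where "Y \<in> \<Gamma>" "P = (\<lambda>e. \<not> Pr Y e)" unfolding \<Gamma>(3) by blast
      thus ?thesis using nPr mono[of Y _ "\<Union>\<Gamma>"] by blast
    qed
    thus "\<exists>a. \<forall>P\<in>\<F>. P (\<lambda>_. a)" by blast
  qed
  then obtain y where y: "\<forall>P\<in>P1 \<union> P2. P (\<lambda>_. y)" by blast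
  have "dteval D (\<lambda>_. x) t = 0 \<longleftrightarrow> dteval D (\<lambda>_. y) t = 0" if "dtparams t \<subseteq> K" for t
  proof -
    have "(\<lambda>e. dteval D e t = 0 \<longleftrightarrow> dteval D (\<lambda>_. x) t = 0) \<in> P1"
      using that unfolding P1_def T_def by blast
    from y[rule_format, OF UnI1, OF this] show ?thesis by simp
  qed
  \<comment> \<open>A realisation of the type is the image of \<open>x\<close> under some embedding;
    strong normality puts it into \<open>M\<close>, where it has a representation with finite
    support.\<close>
  from hom_of_terms[OF assms this] obtain \<tau> where \<tau>: "\<tau> \<in> diff_hom D K L" "\<tau> x = y" by auto
  hence "y \<in> M" using hom_image_M assms by blast
  then obtain p q where pq: "p \<in> cspan D R0" "q \<in> cspan D R0" "q \<noteq> 0" "y = p / q" using M_fraction by blast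
  obtain Y Z where YZ: "finite Y" "Y \<subseteq> R0" "p \<in> cspan D Y" "finite Z" "Z \<subseteq> R0" "q \<in> cspan D Z"
    using cspan_finite_support[OF pq(1)] cspan_finite_support[OF pq(2)] by blast
  have "p \<in> cspan D (Y \<union> Z)" "q \<in> cspan D (Y \<union> Z)"
    using YZ(3,6) cspan_mono[of Y "Y \<union> Z" D] cspan_mono[of Z "Y \<union> Z" D] by auto
  hence "Pr (Y \<union> Z) (\<lambda>_. y)" 
    unfolding Pr_def using pq(3,4) by (intro exI[of _ p] exI[of _ q]) auto
  moreover have "Y \<union> Z \<in> X" using YZ unfolding X_def by auto
  ultimately have "(\<lambda>e. \<not> Pr (Y \<union> Z) e) \<in> P2" unfolding P2_def by blast
  from y[rule_format, OF UnI2, OF this] \<open>Pr (Y \<union> Z) (\<lambda>_. y)\<close> show False by simp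
qed

lemma uniform_representation_generators:
  "\<exists>X. finite X \<and> X \<subseteq> R0 \<and>
     (\<forall>\<tau>\<in>diff_hom D K L. \<forall>i. \<exists>p\<in>cspan D X. \<exists>q\<in>cspan D X. q \<noteq> 0 \<and> \<tau> (a i) * q = p)"
proof -
  have "\<forall>i. \<exists>X. finite X \<and> X \<subseteq> R0 \<and>
     (\<forall>\<tau>\<in>diff_hom D K L. \<exists>p\<in>cspan D X. \<exists>q\<in>cspan D X. q \<noteq> 0 \<and> \<tau> (a i) * q = p)"
    using uniform_representation[OF a_in_L] by blast
  then obtain X where X: "\<And>i. finite (X i)" "\<And>i. X i \<subseteq> R0"
    "\<And>i \<tau>. \<tau> \<in> diff_hom D K L \<Longrightarrow> \<exists>p\<in>cspan D (X i). \<exists>q\<in>cspan D (X i). q \<noteq> 0 \<and> \<tau> (a i) * q = p"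
    by metis
  define Y where "Y = (\<Union>i\<le>length fs. X i)"
  have "\<exists>p\<in>cspan D Y. \<exists>q\<in>cspan D Y. q \<noteq> 0 \<and> \<tau> (a i) * q = p" if "\<tau> \<in> diff_hom D K L" for \<tau> i
  proof -
    \<comment> \<open>All entries of \<open>a\<close> from index \<open>length fs\<close> on are
      zero, so this one index covers them.\<close>
    define j where "j = min i (length fs)"
    have "a i = a j" by (auto simp: j_def a_def)
    moreover have "cspan D (X j) \<subseteq> cspan D Y"
      unfolding Y_def by (intro cspan_mono UN_upper) (simp add: j_def)
    ultimately show ?thesis using X(3)[OF that, of j] by (metis subsetD)
  qed
  moreover have "finite Y" "Y \<subseteq> R0" unfolding Y_def using X by auto
  ultimately show ?thesis by blast
qed

section \<open>The Galois group\<close>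

lemma gal_iff: "\<sigma> \<in> gal_set D K L \<longleftrightarrow> \<sigma> \<in> extensional M \<and> \<sigma> \<in> diff_hom D N M \<and> \<sigma> ` M = M"
proof
  assume "\<sigma> \<in> gal_set D K L"
  thus "\<sigma> \<in> extensional M \<and> \<sigma> \<in> diff_hom D N M \<and> \<sigma> ` M = M"
    unfolding gal_set_def diff_hom_def Let_def M_def[symmetric] N_def[symmetric] bij_betw_def
    using diff_subfieldD(2)[OF N(1)] by auto
next
  assume "\<sigma> \<in> extensional M \<and> \<sigma> \<in> diff_hom D N M \<and> \<sigma> ` M = M"
  thus "\<sigma> \<in> gal_set D K L"
    unfolding gal_set_def diff_hom_def Let_def M_def[symmetric] N_def[symmetric] bij_betw_def by auto
qed

lemma gal_hom: "\<sigma> \<in> gal_set D K L \<Longrightarrow> \<sigma> \<in> diff_hom D K L"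
  using gal_iff diff_hom_mono N(2) M(2) by blast

lemma gal_fixes_C: "\<sigma> \<in> gal_set D K L \<Longrightarrow> c \<in> C \<Longrightarrow> \<sigma> c = c"
  using gal_iff N(3) diff_homD(5) by blast

lemma gal_M: "\<sigma> \<in> gal_set D K L \<Longrightarrow> x \<in> M \<Longrightarrow> \<sigma> x \<in> M"
  using gal_iff by blast

text \<open>The elements on which the two maps agree form a differential field that contains
  \<open>K\<close>, \<open>C\<close> and the generators.\<close>

lemma gal_eqI:
  assumes \<sigma>: "\<sigma> \<in> gal_set D K L" "\<sigma>' \<in> gal_set D K L" and eq: "\<And>i. \<sigma> (a i) = \<sigma>' (a i)"
  shows "\<sigma> = \<sigma>'"
proof -
  have h: "\<sigma> \<in> diff_hom D N M" "\<sigma>' \<in> diff_hom D N M" using \<sigma> gal_iff by auto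
  define F where "F = {x \<in> M. \<sigma> x = \<sigma>' x}"
  have F: "diff_subfield D F" unfolding diff_subfield_def F_def
    using diff_subfieldD[OF M(1)] diff_homD[OF h(1)] diff_homD[OF h(2)]
      diff_hom_0(3,4)[OF h(1) M(1)] diff_hom_0(3,4)[OF h(2) M(1)]
      diff_hom_0(1)[OF h(1) M(1)] diff_hom_0(1)[OF h(2) M(1)] by auto
  have fs: "set fs \<subseteq> F"
  proof
    fix x assume "x \<in> set fs"
    then obtain i where "x = a i" unfolding a_def in_set_conv_nth by metis
    thus "x \<in> F" unfolding F_def using eq a_in_L M(2) by auto
  qed
  have "K \<subseteq> F" "C \<subseteq> F" unfolding F_def using diff_homD(5)[OF h(1)] diff_homD(5)[OF h(2)] N by auto
  hence "L \<subseteq> F" unfolding gen using fs by (intro dgen_least[OF F]) auto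
  hence "M \<subseteq> F" unfolding M_def using \<open>C \<subseteq> F\<close> by (intro dgen_least[OF F]) auto
  show ?thesis
  proof (rule extensionalityI[of _ M])
    fix x assume "x \<in> M"
    thus "\<sigma> x = \<sigma>' x" using \<open>M \<subseteq> F\<close> unfolding F_def by blast
  qed (use \<sigma> gal_iff in auto)
qed

lemma gal_compose:
  assumes "\<sigma> \<in> gal_set D K L" "\<sigma>' \<in> gal_set D K L"
  shows "restrict (\<sigma> \<circ> \<sigma>') M \<in> gal_set D K L"
proof -
  have h: "\<sigma> \<in> diff_hom D N M" "\<sigma>' \<in> diff_hom D N M" and im: "\<sigma> ` M = M" "\<sigma>' ` M = M"
    using assms gal_iff by auto
  have m: "x \<in> M \<Longrightarrow> \<sigma>' x \<in> M" for x using im by blast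
  have "restrict (\<sigma> \<circ> \<sigma>') M ` M = \<sigma> ` (\<sigma>' ` M)" by (simp add: image_comp)
  moreover have "restrict (\<sigma> \<circ> \<sigma>') M \<in> diff_hom D N M"
    unfolding diff_hom_def
    using diff_homD[OF h(1)] diff_homD[OF h(2)] diff_subfieldD[OF M(1)] m N(4) diff_subfieldD[OF N(1)]
    by (auto simp: im subset_iff intro!: comp_inj_on)
  ultimately show ?thesis using im by (simp add: gal_iff)
qed

lemma gal_id: "restrict id M \<in> gal_set D K L"
  unfolding gal_iff diff_hom_def
  using diff_subfieldD[OF M(1)] N(4) by (auto simp: subset_iff inj_on_def)

lemma gal_inverse:
  assumes "\<sigma> \<in> gal_set D K L"
  shows "restrict (inv_into M \<sigma>) M \<in> gal_set D K L" (is "?s \<in> _")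
    "\<And>x. x \<in> M \<Longrightarrow> inv_into M \<sigma> (\<sigma> x) = x" "\<And>x. x \<in> M \<Longrightarrow> \<sigma> (inv_into M \<sigma> x) = x"
proof -
  have h: "\<sigma> \<in> diff_hom D N M" and im: "\<sigma> ` M = M" using assms gal_iff by auto
  have inj: "inj_on \<sigma> M" using diff_homD(6)[OF h] .
  show 1: "\<And>x. x \<in> M \<Longrightarrow> inv_into M \<sigma> (\<sigma> x) = x" using inj by simp
  show 2: "\<And>x. x \<in> M \<Longrightarrow> \<sigma> (inv_into M \<sigma> x) = x" using im by (simp add: f_inv_into_f)
  have m: "\<And>x. x \<in> M \<Longrightarrow> inv_into M \<sigma> x \<in> M" using im by (simp add: inv_into_into)
  have eq: "inv_into M \<sigma> y = x" if "x \<in> M" "\<sigma> x = y" for x y using 1 that by blast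
  have "?s \<in> diff_hom D N M" unfolding diff_hom_def
  proof (intro CollectI conjI ballI)
    show "inj_on ?s M" using inj_on_inv_into[of M \<sigma> M] im by simp
    fix x y assume "x \<in> M" "y \<in> M"
    thus "?s (x + y) = ?s x + ?s y" "?s (x * y) = ?s x * ?s y"
      using diff_subfieldD[OF M(1)] m 2 diff_homD[OF h] by (auto intro!: eq)
  qed (use diff_subfieldD[OF M(1)] m 2 diff_homD[OF h] N(4) in \<open>auto intro!: eq simp: subset_iff\<close>)
  moreover have "?s ` M = M"
  proof
    show "M \<subseteq> ?s ` M"
    proof
      fix x assume "x \<in> M"
      thus "x \<in> ?s ` M" using 1[of x] im by (intro image_eqI[of _ _ "\<sigma> x"]) auto
    qed
  qed (use m in auto)
  ultimately show "?s \<in> gal_set D K L" by (simp add: gal_iff)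
qed

lemma group_gal: "group (gal_group D K L)"
proof -
  have car: "carrier (gal_group D K L) = gal_set D K L"
    and mul: "\<And>s t. s \<otimes>\<^bsub>gal_group D K L\<^esub> t = restrict (s \<circ> t) M"
    and one: "\<one>\<^bsub>gal_group D K L\<^esub> = restrict id M"
    by (auto simp: gal_group_def Let_def M_def)
  have ext: "\<And>s. s \<in> gal_set D K L \<Longrightarrow> s \<in> extensional M" using gal_iff by blast
  show ?thesis
  proof (rule groupI, unfold car mul one)
    fix s t assume "s \<in> gal_set D K L" "t \<in> gal_set D K L"
    thus "restrict (s \<circ> t) M \<in> gal_set D K L" by (rule gal_compose)
  next
    fix s t u assume "s \<in> gal_set D K L" "t \<in> gal_set D K L" "u \<in> gal_set D K L"
    thus "restrict (restrict (s \<circ> t) M \<circ> u) M = restrict (s \<circ> restrict (t \<circ> u) M) M"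
      using gal_M by (auto simp: fun_eq_iff)
  next
    fix s assume s: "s \<in> gal_set D K L"
    show "restrict (restrict id M \<circ> s) M = s"
      by (rule extensionalityI[of _ M]) (use ext[OF s] gal_M[OF s] in auto)
    show "\<exists>t\<in>gal_set D K L. restrict (t \<circ> s) M = restrict id M"
      by (rule bexI[OF _ gal_inverse(1)[OF s]]) (use gal_inverse(2)[OF s] gal_M[OF s] in \<open>auto simp: fun_eq_iff\<close>)
  qed (rule gal_id)
qed

text \<open>The embedding is extended by the identity on \<open>C\<close>. It fixes the constants of
  \<open>L\<close>, so it preserves relations over them, and relations over \<open>C\<close> follow
  from these. The same argument on the image side gives injectivity. The equality of composita in
  the definition of strong makes the extension map onto \<open>M\<close>.\<close>

lemma hom_extends_to_gal:
  assumes \<tau>: "\<tau> \<in> diff_hom D K L"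
  shows "\<exists>\<sigma>\<in>gal_set D K L. \<forall>x\<in>L. \<sigma> x = \<tau> x"
proof -
  define G where "G = {(u, \<tau> u) |u. u \<in> L}"
  have Gf: "diff_pair_field D G" unfolding G_def by (rule pair_field_of_diff_hom[OF \<tau> L])
  have G: "diff_pair_ring D G"
    using Gf unfolding diff_pair_field_def pair_field_def diff_pair_ring_def by blast
  note S = diff_pair_ring_pair_span[OF D G]
  have fix_c: "\<tau> c = c" if "c \<in> L" "D c = 0" for c
    using str[OF \<tau>] that unfolding strong_def consts_of_def by auto
  have \<tau>L: "diff_subfield D (\<tau> ` L)"
  proof -
    have "\<tau> ` L = Range G" unfolding G_def by auto
    thus ?thesis using diff_subfield_Domain(2)[OF Gf] by simp
  qed
  have z: "w = 0 \<longleftrightarrow> w' = 0" if ww: "(w, w') \<in> pair_span D G" for w w'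
  proof -
    obtain n c u v where *: "\<forall>i<n. D (c i) = 0 \<and> (u i, v i) \<in> G" "w = (\<Sum>i<n. c i * u i)" "w' = (\<Sum>i<n::nat. c i * v i)"
      using pair_span_sum[OF ww] by blast
    have uv: "u i \<in> L" "v i = \<tau> (u i)" if "i < n" for i using * that unfolding G_def by auto
    have e\<tau>: "(\<Sum>i<n. e i * v i) = \<tau> (\<Sum>i<n. e i * u i)"
      if "\<And>i. i < n \<Longrightarrow> e i \<in> L \<and> D (e i) = 0" for e
    proof -
      have "\<tau> (\<Sum>i<n. e i * u i) = (\<Sum>i<n. \<tau> (e i * u i))"
        by (rule diff_hom_sum[OF \<tau> L]) (use that uv diff_subfieldD[OF L] in auto)
      also have "\<dots> = (\<Sum>i<n. e i * v i)"
        by (rule sum.cong) (use that uv fix_c diff_homD[OF \<tau>] in auto)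
      finally show ?thesis by simp
    qed
    have esum: "(\<Sum>i<n. e i * u i) \<in> L" if "\<And>i. i < n \<Longrightarrow> e i \<in> L \<and> D (e i) = 0" for e
      by (rule diff_subfield_sum[OF L]) (use that uv diff_subfieldD[OF L] in auto)
    show ?thesis
    proof
      assume "w = 0"
      show "w' = 0" unfolding *(3)
      proof (rule constant_relations_transfer[OF D L, of "{..<n}" u])
        fix e assume e: "\<And>i. i \<in> {..<n} \<Longrightarrow> e i \<in> L \<and> D (e i) = 0" "(\<Sum>i<n. e i * u i) = 0"
        thus "(\<Sum>i<n. e i * v i) = 0" using e\<tau>[of e] diff_hom_0(1)[OF \<tau> L] by auto
      qed (use * uv \<open>w = 0\<close> in auto)
    next
      assume "w' = 0"
      show "w = 0" unfolding *(2)
      proof (rule constant_relations_transfer[OF D \<tau>L, of "{..<n}" v])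
        fix e assume e: "\<And>i. i \<in> {..<n} \<Longrightarrow> e i \<in> \<tau> ` L \<and> D (e i) = 0" "(\<Sum>i<n. e i * v i) = 0"
        \<comment> \<open>A constant of the image comes from a constant of \<open>L\<close>, by
          injectivity of the embedding, and is fixed by it.\<close>
        have e': "e i \<in> L \<and> D (e i) = 0" if i: "i < n" for i
        proof -
          obtain d where d: "d \<in> L" "e i = \<tau> d" using e(1)[of i] i by auto
          have "\<tau> (D d) = 0" using d e(1)[of i] i diff_homD(4)[OF \<tau>] by auto
          hence "D d = 0" using diff_hom_0(2)[OF \<tau> L] diff_subfieldD(7)[OF L] d(1) by blast
          thus ?thesis using fix_c d by auto
        qed
        show "(\<Sum>i<n. e i * u i) = 0"
          using e\<tau>[OF e'] e(2) diff_hom_0(2)[OF \<tau> L esum[OF e']] by simp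
      qed (use * uv \<open>w' = 0\<close> in auto)
    qed
  qed
  define \<Theta> where "\<Theta> = pair_frac (pair_span D G)"
  have \<Theta>: "diff_pair_field D \<Theta>" unfolding \<Theta>_def by (rule diff_pair_field_pair_frac[OF D S z])
  have sup: "pair_span D G \<subseteq> \<Theta>" unfolding \<Theta>_def by (rule pair_frac_superset[OF S])
  have inL: "(u, \<tau> u) \<in> \<Theta>" if "u \<in> L" for u
    using pair_span_superset[OF D, of u "\<tau> u" G] that sup unfolding G_def by blast
  have inC: "(c, c) \<in> \<Theta>" if "c \<in> C" for c
  proof -
    have "D c = 0" using that C_iff by simp
    from pair_span.step[OF this diff_pair_ringD(2)[OF G] pair_span.zero[of D G]] show ?thesis using sup by auto
  qed
  have span_M: "u \<in> M \<and> v \<in> M" if "(u, v) \<in> pair_span D G" for u v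
    using that
  proof (induction rule: pair_span.induct)
    case (step c u v w w')
    have "u \<in> M" "v \<in> M" "c \<in> M"
      using step(1,2) M(2,3) hom_image_M[OF \<tau>] unfolding G_def C_iff[symmetric] by auto
    thus ?case using step(4) by (intro conjI diff_subfieldD(3,4)[OF M(1)]) auto
  qed (use diff_subfieldD[OF M(1)] in auto)
  hence \<Theta>M: "Domain \<Theta> \<subseteq> M" "Range \<Theta> \<subseteq> M"
    unfolding \<Theta>_def pair_frac_def by (auto intro!: diff_subfieldD(9)[OF M(1)])
  have "L \<union> C \<subseteq> Domain \<Theta>" using inL inC by blast
  hence dom: "Domain \<Theta> = M"
    using \<Theta>M(1) dgen_least[OF diff_subfield_Domain(1)[OF \<Theta>]] unfolding M_def by blast
  have "\<tau> ` L \<union> C \<subseteq> Range \<Theta>" using inL inC by blast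
  hence ran: "Range \<Theta> = M"
    using \<Theta>M(2) dgen_least[OF diff_subfield_Domain(2)[OF \<Theta>]] hom_dgen[OF \<tau>] by blast
  have "K \<union> C \<subseteq> {x. (x, x) \<in> \<Theta>}"
  proof -
    have "(k, k) \<in> \<Theta>" if "k \<in> K" for k using inL[of k] that KL diff_homD(5)[OF \<tau> that] by auto
    thus ?thesis using inC by blast
  qed
  hence "N \<subseteq> {x. (x, x) \<in> \<Theta>}" unfolding N_def by (rule dgen_least[OF diff_subfield_Domain(3)[OF \<Theta>]])
  hence "Id_on N \<subseteq> \<Theta>" by auto
  then obtain \<sigma> where \<sigma>: "\<sigma> \<in> diff_hom D N M" "\<forall>(u, v)\<in>\<Theta>. \<sigma> u = v"
    using diff_hom_of_pair_field[OF \<Theta> dom _ M(1)] by blast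
  have "\<sigma> ` M = M"
  proof -
    have "\<sigma> ` Domain \<Theta> = Range \<Theta>" using \<sigma>(2) by force
    thus ?thesis using dom ran by simp
  qed
  moreover have "restrict \<sigma> M \<in> diff_hom D N M"
    using \<sigma>(1) diff_subfieldD[OF M(1)] N(4) unfolding diff_hom_def by (auto simp: subset_iff)
  ultimately have "restrict \<sigma> M \<in> gal_set D K L" unfolding gal_iff by simp
  moreover have "restrict \<sigma> M x = \<tau> x" if "x \<in> L" for x using inL[OF that] \<sigma>(2) that M(2) by auto
  ultimately show ?thesis by blast
qed

end

section \<open>Hilbert's basis theorem\<close>

definition is_subring :: "'r::comm_ring_1 set \<Rightarrow> bool" where
  "is_subring A \<longleftrightarrow> 0 \<in> A \<and> 1 \<in> A \<and> (\<forall>x\<in>A. \<forall>y\<in>A. x + y \<in> A \<and> x * y \<in> A) \<and> (\<forall>x\<in>A. - x \<in> A)"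

inductive_set ideal_span :: "'r::comm_ring_1 set \<Rightarrow> 'r set \<Rightarrow> 'r set" for A S where
  zero: "0 \<in> ideal_span A S"
| step: "c \<in> A \<Longrightarrow> g \<in> S \<Longrightarrow> w \<in> ideal_span A S \<Longrightarrow> c * g + w \<in> ideal_span A S"

text \<open>The finite generating set is taken inside \<open>S\<close> itself: applied to a system
  of equations, it is a subsystem.\<close>

definition noetherian_subring :: "'r::comm_ring_1 set \<Rightarrow> bool" where
  "noetherian_subring A \<longleftrightarrow> is_subring A \<and> (\<forall>S. S \<subseteq> A \<longrightarrow> (\<exists>T. finite T \<and> T \<subseteq> S \<and> S \<subseteq> ideal_span A T))"

definition ring_adjoin :: "'r::comm_ring_1 set \<Rightarrow> 'r \<Rightarrow> 'r set" where
  "ring_adjoin A x = {poly p x |p. \<forall>i. coeff p i \<in> A}"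

lemma is_subringD:
  assumes "is_subring A"
  shows "0 \<in> A" "1 \<in> A" "x \<in> A \<Longrightarrow> y \<in> A \<Longrightarrow> x + y \<in> A" "x \<in> A \<Longrightarrow> y \<in> A \<Longrightarrow> x * y \<in> A"
    "x \<in> A \<Longrightarrow> - x \<in> A" "x \<in> A \<Longrightarrow> y \<in> A \<Longrightarrow> x - y \<in> A"
  using assms unfolding is_subring_def diff_conv_add_uminus[of x y] by blast+

lemma is_subring_sum:
  assumes "is_subring A" "\<And>i. i \<in> I \<Longrightarrow> f i \<in> A" shows "sum f I \<in> A"
  using assms(2) by (induction I rule: infinite_finite_induct) (auto simp: is_subringD[OF assms(1)])

lemma ideal_span_add: "u \<in> ideal_span A S \<Longrightarrow> v \<in> ideal_span A S \<Longrightarrow> u + v \<in> ideal_span A S"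
  by (induction rule: ideal_span.induct) (auto simp: add.assoc intro: ideal_span.step)

lemma ideal_span_mult:
  assumes "is_subring A" "c \<in> A"
  shows "u \<in> ideal_span A S \<Longrightarrow> c * u \<in> ideal_span A S"
proof (induction rule: ideal_span.induct)
  case (step d g w)
  from ideal_span.step[OF is_subringD(4)[OF assms step(1)] step(2,4)] show ?case
    by (simp add: distrib_left mult.assoc)
qed (auto intro: ideal_span.zero)

lemma ideal_span_superset: "is_subring A \<Longrightarrow> g \<in> S \<Longrightarrow> g \<in> ideal_span A S"
  using ideal_span.step[OF is_subringD(2) _ ideal_span.zero, of A g S] by simp

lemma ideal_span_least:
  assumes "is_subring A" "S \<subseteq> ideal_span A T" shows "ideal_span A S \<subseteq> ideal_span A T"
proof
  fix u assume "u \<in> ideal_span A S"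
  thus "u \<in> ideal_span A T"
    by (induction rule: ideal_span.induct)
      (use assms in \<open>auto intro: ideal_span.zero ideal_span_add ideal_span_mult\<close>)
qed

lemma ideal_span_mono: "S \<subseteq> T \<Longrightarrow> ideal_span A S \<subseteq> ideal_span A T"
proof
  fix u assume "S \<subseteq> T" "u \<in> ideal_span A S"
  from this(2,1) show "u \<in> ideal_span A T"
    by (induction rule: ideal_span.induct) (auto intro: ideal_span.intros)
qed

lemma ideal_span_sum: "(\<And>i. i \<in> I \<Longrightarrow> f i \<in> ideal_span A S) \<Longrightarrow> sum f I \<in> ideal_span A S"
  by (induction I rule: infinite_finite_induct) (auto intro: ideal_span.zero ideal_span_add)

lemma ideal_span_finite_support:
  "u \<in> ideal_span A S \<Longrightarrow> \<exists>T. finite T \<and> T \<subseteq> S \<and> u \<in> ideal_span A T"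
proof (induction rule: ideal_span.induct)
  case zero
  show ?case by (rule exI[of _ "{}"]) (auto intro: ideal_span.zero)
next
  case (step c g w)
  then obtain T where T: "finite T" "T \<subseteq> S" "w \<in> ideal_span A T" by blast
  hence "w \<in> ideal_span A (insert g T)" using ideal_span_mono[of T "insert g T" A] by blast
  thus ?case using T step by (intro exI[of _ "insert g T"]) (auto intro: ideal_span.step)
qed

lemma ideal_span_combination:
  "finite T \<Longrightarrow> is_subring A \<Longrightarrow> u \<in> ideal_span A T \<Longrightarrow> \<exists>c. (\<forall>g. c g \<in> A) \<and> u = (\<Sum>g\<in>T. c g * g)"
proof -
  assume T: "finite T" and A: "is_subring A"
  show "u \<in> ideal_span A T \<Longrightarrow> \<exists>c. (\<forall>g. c g \<in> A) \<and> u = (\<Sum>g\<in>T. c g * g)"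
  proof (induction rule: ideal_span.induct)
    case zero
    show ?case by (rule exI[of _ "\<lambda>_. 0"]) (auto simp: is_subringD[OF A])
  next
    case (step d h w)
    then obtain c where c: "\<And>g. c g \<in> A" "w = (\<Sum>g\<in>T. c g * g)" by blast
    have "(\<Sum>g\<in>T. (c g + (if g = h then d else 0)) * g) = w + (\<Sum>g\<in>T. if g = h then d * h else 0)"
      unfolding c(2) sum.distrib[symmetric] by (rule sum.cong) (auto simp: distrib_right)
    also have "\<dots> = d * h + w" using T step(2) by (simp add: sum.delta)
    finally show ?case
      by (intro exI[of _ "\<lambda>g. c g + (if g = h then d else 0)"]) (use c step(1) is_subringD[OF A] in auto)
  qed
qed

text \<open>It suffices to treat ideals: finitely many generators of the ideal spanned by
  \<open>S\<close> involve only finitely many members of \<open>S\<close>.\<close>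

lemma noetherian_subring_ideals:
  assumes A: "is_subring A"
    and "\<And>J. J \<subseteq> A \<Longrightarrow> ideal_span A J \<subseteq> J \<Longrightarrow> \<exists>T. finite T \<and> T \<subseteq> J \<and> J \<subseteq> ideal_span A T"
  shows "noetherian_subring A"
  unfolding noetherian_subring_def
proof (intro conjI allI impI A)
  fix S assume S: "S \<subseteq> A"
  have "ideal_span A S \<subseteq> A"
  proof
    fix u assume "u \<in> ideal_span A S"
    thus "u \<in> A" by (induction rule: ideal_span.induct) (use S is_subringD[OF A] in auto)
  qed
  moreover have "ideal_span A (ideal_span A S) \<subseteq> ideal_span A S" by (rule ideal_span_least[OF A]) simp
  ultimately obtain T where T: "finite T" "T \<subseteq> ideal_span A S" "ideal_span A S \<subseteq> ideal_span A T"
    using assms(2) by metis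
  have "\<forall>t\<in>T. \<exists>U. finite U \<and> U \<subseteq> S \<and> t \<in> ideal_span A U" using T(2) ideal_span_finite_support by blast
  then obtain U where U: "\<And>t. t \<in> T \<Longrightarrow> finite (U t) \<and> U t \<subseteq> S \<and> t \<in> ideal_span A (U t)" by metis
  define V where "V = (\<Union>t\<in>T. U t)"
  have "T \<subseteq> ideal_span A V"
  proof
    fix t assume t: "t \<in> T"
    hence "U t \<subseteq> V" unfolding V_def by blast
    thus "t \<in> ideal_span A V" using U[OF t] ideal_span_mono by blast
  qed
  hence "ideal_span A T \<subseteq> ideal_span A V" by (rule ideal_span_least[OF A])
  moreover have "S \<subseteq> ideal_span A S" using ideal_span_superset[OF A] by blast
  ultimately have "S \<subseteq> ideal_span A V" using T(3) by blast
  moreover have "finite V" "V \<subseteq> S" unfolding V_def using T(1) U by auto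
  ultimately show "\<exists>T. finite T \<and> T \<subseteq> S \<and> S \<subseteq> ideal_span A T" by blast
qed

abbreviation poly_over :: "'r::comm_ring_1 set \<Rightarrow> 'r poly \<Rightarrow> bool" where
  "poly_over A p \<equiv> \<forall>i. coeff p i \<in> A"

lemma poly_over_closed:
  assumes A: "is_subring A"
  shows "poly_over A p \<Longrightarrow> poly_over A q \<Longrightarrow> poly_over A (p + q)"
    "poly_over A p \<Longrightarrow> poly_over A q \<Longrightarrow> poly_over A (p - q)"
    "poly_over A p \<Longrightarrow> poly_over A (- p)"
    "poly_over A p \<Longrightarrow> poly_over A q \<Longrightarrow> poly_over A (p * q)"
    "c \<in> A \<Longrightarrow> poly_over A (monom c n)" "c \<in> A \<Longrightarrow> poly_over A [:c:]"
    "c \<in> A \<Longrightarrow> poly_over A p \<Longrightarrow> poly_over A (smult c p)"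
  unfolding coeff_mult
  by (auto simp: is_subringD[OF A] coeff_pCons intro!: is_subring_sum[OF A] split: nat.splits)

lemma is_subring_adjoin:
  assumes A: "is_subring A" shows "is_subring (ring_adjoin A x)" "A \<subseteq> ring_adjoin A x" "x \<in> ring_adjoin A x"
proof -
  have I: "poly p x \<in> ring_adjoin A x" if "poly_over A p" for p using that unfolding ring_adjoin_def by blast
  note c = poly_over_closed[OF A] is_subringD[OF A]
  show "A \<subseteq> ring_adjoin A x" using I[OF c(6)] by auto
  show "x \<in> ring_adjoin A x" using I[OF c(5)[of 1 1]] c by (simp add: poly_monom)
  show "is_subring (ring_adjoin A x)" unfolding is_subring_def
  proof (intro conjI ballI)
    show "0 \<in> ring_adjoin A x" "1 \<in> ring_adjoin A x" using \<open>A \<subseteq> ring_adjoin A x\<close> c by auto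
    fix u assume "u \<in> ring_adjoin A x"
    then obtain p where p: "poly_over A p" "u = poly p x" unfolding ring_adjoin_def by blast
    show "- u \<in> ring_adjoin A x" using I[OF c(3)[OF p(1)]] p(2) by simp
    fix v assume "v \<in> ring_adjoin A x"
    then obtain q where q: "poly_over A q" "v = poly q x" unfolding ring_adjoin_def by blast
    show "u + v \<in> ring_adjoin A x" "u * v \<in> ring_adjoin A x"
      using I[OF c(1)[OF p(1) q(1)]] I[OF c(4)[OF p(1) q(1)]] p(2) q(2) by simp_all
  qed
qed

text \<open>The classical argument with leading coefficients, carried out for an element
  \<open>x\<close> that may be algebraic over \<open>A\<close>. An element of the ideal may then
  have several polynomials representing it, so coefficients are collected over all representatives
  and the induction runs on the degree of a representative.\<close>

lemma noetherian_subring_adjoin: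
  assumes "noetherian_subring A"
  shows "noetherian_subring (ring_adjoin A x)"
proof -
  have A: "is_subring A" and noeth: "\<And>S. S \<subseteq> A \<Longrightarrow> \<exists>T. finite T \<and> T \<subseteq> S \<and> S \<subseteq> ideal_span A T"
    using assms unfolding noetherian_subring_def by auto
  define B where "B = ring_adjoin A x"
  note B = is_subring_adjoin[OF A, of x, folded B_def]
  note c = poly_over_closed[OF A] and a = is_subringD[OF A]
  have IB: "poly p x \<in> B" if "poly_over A p" for p using that unfolding B_def ring_adjoin_def by blast
  show ?thesis unfolding B_def[symmetric]
  proof (rule noetherian_subring_ideals[OF B(1)])
    fix J assume JB: "J \<subseteq> B" and J: "ideal_span B J \<subseteq> J"
    have J0: "0 \<in> J" using J ideal_span.zero by blast
    have Jadd: "u + v \<in> J" if "u \<in> J" "v \<in> J" for u v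
      using J ideal_span_add[OF ideal_span_superset[OF B(1) that(1)] ideal_span_superset[OF B(1) that(2)]] by blast
    have Jmult: "b * u \<in> J" if "b \<in> B" "u \<in> J" for b u
      using J ideal_span_mult[OF B(1) that(1) ideal_span_superset[OF B(1) that(2)]] by blast
    define Ld where "Ld n = {coeff p n |p. poly_over A p \<and> degree p \<le> n \<and> poly p x \<in> J}" for n
    have LdA: "Ld n \<subseteq> A" for n unfolding Ld_def by blast
    have Ld_Suc: "Ld n \<subseteq> Ld (Suc n)" for n
    proof
      fix u assume "u \<in> Ld n"
      then obtain p where p: "poly_over A p" "degree p \<le> n" "poly p x \<in> J" "u = coeff p n" unfolding Ld_def by blast
      have "poly_over A (pCons 0 p)" using p(1) a by (auto simp: coeff_pCons split: nat.splits)
      moreover have "degree (pCons 0 p) \<le> Suc n" using p(2) degree_pCons_le[of 0 p] by simp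
      moreover have "poly (pCons 0 p) x \<in> J" using Jmult[OF B(3) p(3)] by simp
      moreover have "u = coeff (pCons 0 p) (Suc n)" using p by simp
      ultimately show "u \<in> Ld (Suc n)" unfolding Ld_def by blast
    qed
    have Ld_mono: "Ld m \<subseteq> Ld n" if "m \<le> n" for m n using lift_Suc_mono_le[of Ld, OF Ld_Suc that] .
    have Ld_ideal: "ideal_span A (Ld n) \<subseteq> Ld n" for n
    proof
      fix u assume "u \<in> ideal_span A (Ld n)"
      thus "u \<in> Ld n"
      proof (induction rule: ideal_span.induct)
        case zero
        have "0 = coeff 0 n" "poly_over A 0" "degree 0 \<le> n" "poly 0 x \<in> J" using a J0 by auto
        thus ?case unfolding Ld_def by blast
      next
        case (step d g w)
        then obtain p q where pq: "poly_over A p" "degree p \<le> n" "poly p x \<in> J" "g = coeff p n"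
          "poly_over A q" "degree q \<le> n" "poly q x \<in> J" "w = coeff q n" unfolding Ld_def by blast
        have "poly_over A (smult d p + q)" by (rule c(1)[OF c(7)[OF step(1) pq(1)] pq(5)])
        moreover have "degree (smult d p + q) \<le> n"
          by (rule degree_add_le) (use pq degree_smult_le[of d p] in auto)
        moreover have "poly (smult d p + q) x \<in> J"
          using Jadd[OF Jmult[OF _ pq(3), of d] pq(7)] B(2) step(1) by auto
        moreover have "d * g + w = coeff (smult d p + q) n" using pq by simp
        ultimately show ?case unfolding Ld_def by blast
      qed
    qed
    \<comment> \<open>Finite generation of the union bounds the index at which the increasing chain
      becomes stationary.\<close>
    obtain T where T: "finite T" "T \<subseteq> (\<Union>n. Ld n)" "(\<Union>n. Ld n) \<subseteq> ideal_span A T"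
      using noeth[of "\<Union>n. Ld n"] LdA by blast
    have "\<exists>N. T \<subseteq> Ld N" using T(1,2)
    proof (induction T)
      case (insert t T)
      then obtain N n where "T \<subseteq> Ld N" "t \<in> Ld n" by auto
      thus ?case using Ld_mono[of N "max N n"] Ld_mono[of n "max N n"] by (intro exI[of _ "max N n"]) auto
    qed auto
    then obtain N where N: "T \<subseteq> Ld N" by blast
    have "ideal_span A T \<subseteq> Ld N" using ideal_span_mono[OF N] Ld_ideal by blast
    hence LdN: "Ld n \<subseteq> Ld N" for n using T(3) by blast
    have "\<forall>n. \<exists>T. finite T \<and> T \<subseteq> Ld n \<and> Ld n \<subseteq> ideal_span A T" using noeth[OF LdA] by blast
    then obtain G where G: "\<And>n. finite (G n)" "\<And>n. G n \<subseteq> Ld n" "\<And>n. Ld n \<subseteq> ideal_span A (G n)" by metis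
    have "\<forall>n. \<forall>g\<in>G n. \<exists>p. poly_over A p \<and> degree p \<le> n \<and> poly p x \<in> J \<and> g = coeff p n"
      using G(2) unfolding Ld_def by blast
    then obtain P where P: "\<And>n g. g \<in> G n \<Longrightarrow> poly_over A (P n g) \<and> degree (P n g) \<le> n \<and>
       poly (P n g) x \<in> J \<and> g = coeff (P n g) n" by metis
    define V where "V = (\<Union>n\<le>N. (\<lambda>g. poly (P n g) x) ` G n)"
    have V: "finite V" "V \<subseteq> J" unfolding V_def using G(1) P by auto
    have main: "poly p x \<in> ideal_span B V" if "poly_over A p" "degree p \<le> n" "poly p x \<in> J" for p n
      using that
    proof (induction n arbitrary: p rule: less_induct)
      case (less n)
      \<comment> \<open>Above \<open>N\<close> no new leading coefficients appear; the polynomials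
        chosen for \<open>N\<close> are shifted up by a power of the variable.\<close>
      define k where "k = min n N"
      have "k \<le> n" by (simp add: k_def)
      have "coeff p n \<in> Ld n" unfolding Ld_def using less.prems by blast
      hence "coeff p n \<in> Ld k" using LdN[of n] by (auto simp: k_def min_def)
      then obtain d where d: "\<And>g. d g \<in> A" "coeff p n = (\<Sum>g\<in>G k. d g * g)"
        using ideal_span_combination[OF G(1) A] G(3) by blast
      define q where "q = (\<Sum>g\<in>G k. monom (d g) (n - k) * P k g)"
      have qA: "poly_over A q" unfolding q_def coeff_sum
      proof (intro allI is_subring_sum[OF A])
        fix i g assume "g \<in> G k"
        thus "coeff (monom (d g) (n - k) * P k g) i \<in> A"
          using c(4)[OF c(5)[OF d(1)], of "P k g"] P by blast
      qed
      have qdeg: "degree q \<le> n" unfolding q_def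
      proof (intro degree_sum_le G(1))
        fix g assume "g \<in> G k"
        hence "degree (P k g) \<le> k" using P by blast
        moreover have "degree (monom (d g) (n - k) * P k g) \<le> degree (monom (d g) (n - k)) + degree (P k g)"
          by (rule degree_mult_le)
        moreover have "degree (monom (d g) (n - k)) \<le> n - k" by (rule degree_monom_le)
        ultimately show "degree (monom (d g) (n - k) * P k g) \<le> n"
          using \<open>k \<le> n\<close> by linarith
      qed
      have qcoeff: "coeff q n = coeff p n"
      proof -
        have "coeff (monom (d g) (n - k) * P k g) n = d g * g" if "g \<in> G k" for g
          using P[OF that] by (simp add: coeff_monom_mult k_def)
        thus ?thesis unfolding q_def coeff_sum d(2) by (rule sum.cong[OF refl])
      qed
      have qspan: "poly q x \<in> ideal_span B V"
        unfolding q_def poly_sum poly_mult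
      proof (intro ideal_span_sum ideal_span_mult[OF B(1)] ideal_span_superset[OF B(1)])
        fix g assume "g \<in> G k"
        thus "poly (P k g) x \<in> V" unfolding V_def k_def by auto
        show "poly (monom (d g) (n - k)) x \<in> B" by (rule IB[OF c(5)[OF d(1)]])
      qed
      have VJ: "ideal_span B V \<subseteq> J" using ideal_span_mono[OF V(2)] J by blast
      define r where "r = p - q"
      have rA: "poly_over A r" unfolding r_def using c(2)[OF less.prems(1) qA] .
      have "poly (- q) x \<in> J"
        using Jmult[of "- 1" "poly q x"] is_subringD[OF B(1)] qspan VJ by auto
      hence rJ: "poly r x \<in> J" unfolding r_def using Jadd[OF less.prems(3)] by force
      have rn: "coeff r n = 0" "degree r \<le> n" unfolding r_def using qcoeff less.prems(2) qdeg degree_diff_le by auto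
      have "poly r x \<in> ideal_span B V"
      proof (cases "r = 0")
        case True thus ?thesis by (simp add: ideal_span.zero)
      next
        case False
        hence "degree r < n" using rn by (metis le_neq_implies_less leading_coeff_0_iff)
        thus ?thesis using less.IH[OF _ rA _ rJ] by blast
      qed
      hence "poly r x + poly q x \<in> ideal_span B V" using qspan by (rule ideal_span_add)
      thus ?case by (simp add: r_def)
    qed
    have "J \<subseteq> ideal_span B V"
    proof
      fix u assume "u \<in> J"
      moreover then obtain p where "poly_over A p" "u = poly p x" using JB unfolding B_def ring_adjoin_def by blast
      ultimately show "u \<in> ideal_span B V" using main[of p "degree p"] by simp
    qed
    thus "\<exists>T. finite T \<and> T \<subseteq> J \<and> J \<subseteq> ideal_span B T" using V by blast
  qed
qed

section \<open>Polynomial functions on tuples\<close>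

inductive polyfun :: "'a::comm_ring_1 set \<Rightarrow> nat \<Rightarrow> ('a list \<Rightarrow> 'a) \<Rightarrow> bool" for B d where
  const: "b \<in> B \<Longrightarrow> polyfun B d (\<lambda>xs. b)"
| var: "i < d \<Longrightarrow> polyfun B d (\<lambda>xs. xs ! i)"
| add: "polyfun B d f \<Longrightarrow> polyfun B d g \<Longrightarrow> polyfun B d (\<lambda>xs. f xs + g xs)"
| mult: "polyfun B d f \<Longrightarrow> polyfun B d g \<Longrightarrow> polyfun B d (\<lambda>xs. f xs * g xs)"
| uminus: "polyfun B d f \<Longrightarrow> polyfun B d (\<lambda>xs. - f xs)"

lemma polyfun_diff: "polyfun B d f \<Longrightarrow> polyfun B d g \<Longrightarrow> polyfun B d (\<lambda>xs. f xs - g xs)"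
  using polyfun.add[OF _ polyfun.uminus, of B d f g] by simp

lemma polyfun_sum:
  "0 \<in> B \<Longrightarrow> (\<And>i. i \<in> I \<Longrightarrow> polyfun B d (f i)) \<Longrightarrow> polyfun B d (\<lambda>xs. \<Sum>i\<in>I. f i xs)"
  by (induction I rule: infinite_finite_induct) (auto intro: polyfun.intros)

text \<open>The polynomial ring over \<open>B\<close> in \<open>d\<close> variables, built by
  successive adjunction so that the basis theorem applies at each step.\<close>

primrec mp_ring :: "'a::field set \<Rightarrow> nat \<Rightarrow> 'a mpoly set" where
  "mp_ring B 0 = (\<lambda>b. Poly_Mapping.single 0 b) ` B"
| "mp_ring B (Suc d) = ring_adjoin (mp_ring B d) (mvar d)"

lemma noetherian_mp_ring:
  assumes "diff_subfield D B" shows "noetherian_subring (mp_ring B d)"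
proof (induction d)
  case 0
  note b = diff_subfieldD[OF assms]
  have A: "is_subring (mp_ring B 0)"
    unfolding is_subring_def
  proof (intro conjI ballI)
    show "0 \<in> mp_ring B 0" "1 \<in> mp_ring B 0" 
      using imageI[OF b(1), of "Poly_Mapping.single 0"] imageI[OF b(2), of "Poly_Mapping.single 0"] by simp_all
    fix u v assume "u \<in> mp_ring B 0" "v \<in> mp_ring B 0"
    then obtain s t where "s \<in> B" "t \<in> B" "u = Poly_Mapping.single 0 s" "v = Poly_Mapping.single 0 t" by auto
    thus "u + v \<in> mp_ring B 0" "u * v \<in> mp_ring B 0"
      using b by (auto simp: single_add[symmetric] mult_single)
  next
    fix u assume "u \<in> mp_ring B 0"
    then obtain s where "s \<in> B" "u = Poly_Mapping.single 0 s" by auto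
    thus "- u \<in> mp_ring B 0" using b by (auto simp: single_uminus[symmetric])
  qed
  show ?case unfolding noetherian_subring_def
  proof (intro conjI allI impI A)
    fix S assume S: "S \<subseteq> mp_ring B 0"
    show "\<exists>T. finite T \<and> T \<subseteq> S \<and> S \<subseteq> ideal_span (mp_ring B 0) T"
    proof (cases "S \<subseteq> {0}")
      case True
      thus ?thesis by (intro exI[of _ "{}"]) (auto intro: ideal_span.zero)
    next
      case False
      then obtain s where s: "Poly_Mapping.single 0 s \<in> S" "s \<in> B" "s \<noteq> 0" using S by force
      \<comment> \<open>\<open>B\<close> is a field, so any nonzero member of \<open>S\<close>
        generates everything.\<close>
      have "S \<subseteq> ideal_span (mp_ring B 0) {Poly_Mapping.single 0 s}"
      proof
        fix u assume "u \<in> S"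
        then obtain t where t: "t \<in> B" "u = Poly_Mapping.single 0 t" using S by auto
        have "Poly_Mapping.single 0 (t / s) \<in> mp_ring B 0" using t s b by auto
        from ideal_span.step[OF this singletonI ideal_span.zero, of "Poly_Mapping.single 0 s"]
        show "u \<in> ideal_span (mp_ring B 0) {Poly_Mapping.single 0 s}" using t s by (simp add: mult_single)
      qed
      thus ?thesis using s by (intro exI[of _ "{Poly_Mapping.single 0 s}"]) auto
    qed
  qed
next
  case (Suc d)
  thus ?case by (simp add: noetherian_subring_adjoin)
qed

lemma mp_ring_const:
  assumes "diff_subfield D B" "b \<in> B" shows "Poly_Mapping.single 0 b \<in> mp_ring B d"
proof (induction d)
  case (Suc d)
  thus ?case using is_subring_adjoin(2) noetherian_mp_ring[OF assms(1), of d] unfolding noetherian_subring_def by auto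
qed (use assms in auto)

lemma mp_ring_var:
  assumes "diff_subfield D B" "i < d" shows "mvar i \<in> mp_ring B d"
  using assms(2)
proof (induction d)
  case (Suc d)
  have A: "is_subring (mp_ring B d)" using noetherian_mp_ring[OF assms(1), of d] unfolding noetherian_subring_def by auto
  show ?case
  proof (cases "i = d")
    case True thus ?thesis using is_subring_adjoin(3)[OF A] by simp
  next
    case False thus ?thesis using Suc is_subring_adjoin(2)[OF A] by auto
  qed
qed simp

lemma polyfun_mpeval:
  assumes "diff_subfield D B" "polyfun B d f"
  shows "\<exists>p\<in>mp_ring B d. \<forall>xs. f xs = mpeval p (\<lambda>i. xs ! i)"
  using assms(2)
proof (induction rule: polyfun.induct)
  case (const b)
  show ?case by (rule bexI[OF _ mp_ring_const[OF assms(1) const]]) (simp add: mpeval_single)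
next
  case (var i)
  show ?case by (rule bexI[OF _ mp_ring_var[OF assms(1) var]]) simp
next
  case (add f g)
  have A: "is_subring (mp_ring B d)" using noetherian_mp_ring[OF assms(1), of d] unfolding noetherian_subring_def by auto
  obtain p q where "p \<in> mp_ring B d" "\<forall>xs. f xs = mpeval p (\<lambda>i. xs ! i)"
    "q \<in> mp_ring B d" "\<forall>xs. g xs = mpeval q (\<lambda>i. xs ! i)" using add by blast
  thus ?case using is_subringD(3)[OF A, of p q] by (intro bexI[of _ "p + q"]) (auto simp: mpeval_add)
next
  case (mult f g)
  have A: "is_subring (mp_ring B d)" using noetherian_mp_ring[OF assms(1), of d] unfolding noetherian_subring_def by auto
  obtain p q where "p \<in> mp_ring B d" "\<forall>xs. f xs = mpeval p (\<lambda>i. xs ! i)"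
    "q \<in> mp_ring B d" "\<forall>xs. g xs = mpeval q (\<lambda>i. xs ! i)" using mult by blast
  thus ?case using is_subringD(4)[OF A, of p q] by (intro bexI[of _ "p * q"]) (auto simp: mpeval_mult)
next
  case (uminus f)
  have A: "is_subring (mp_ring B d)" using noetherian_mp_ring[OF assms(1), of d] unfolding noetherian_subring_def by auto
  obtain p where "p \<in> mp_ring B d" "\<forall>xs. f xs = mpeval p (\<lambda>i. xs ! i)" using uminus by blast
  thus ?case using is_subringD(5)[OF A, of p] by (intro bexI[of _ "- p"]) (auto simp: mpeval_uminus)
qed

text \<open>Evaluation respects sums and products, so a common zero of the generators is a zero of
  every polynomial in their ideal.\<close>

lemma polyfun_finite_subsystem:
  assumes B: "diff_subfield D B" and F: "\<And>f. f \<in> F \<Longrightarrow> polyfun B d f"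
  shows "\<exists>F0. finite F0 \<and> F0 \<subseteq> F \<and> (\<forall>xs. (\<forall>f\<in>F0. f xs = 0) \<longrightarrow> (\<forall>f\<in>F. f xs = 0))"
proof -
  define S where "S = {p \<in> mp_ring B d. (\<lambda>xs. mpeval p (\<lambda>i. xs ! i)) \<in> F}"
  have A: "is_subring (mp_ring B d)" using noetherian_mp_ring[OF B, of d] unfolding noetherian_subring_def by auto
  obtain T where T: "finite T" "T \<subseteq> S" "S \<subseteq> ideal_span (mp_ring B d) T"
    using noetherian_mp_ring[OF B, of d] unfolding noetherian_subring_def S_def by (metis (no_types, lifting) mem_Collect_eq subsetI)
  define F0 where "F0 = (\<lambda>p xs. mpeval p (\<lambda>i. xs ! i)) ` T"
  have "f xs = 0" if xs: "\<forall>f\<in>F0. f xs = 0" and f: "f \<in> F" for f xs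
  proof -
    obtain p where p: "p \<in> mp_ring B d" "\<forall>xs. f xs = mpeval p (\<lambda>i. xs ! i)"
      using polyfun_mpeval[OF B F[OF f]] by blast
    hence "f = (\<lambda>xs. mpeval p (\<lambda>i. xs ! i))" by auto
    hence "p \<in> S" using p(1) f unfolding S_def by auto
    hence "p \<in> ideal_span (mp_ring B d) T" using T(3) by blast
    hence "mpeval p (\<lambda>i. xs ! i) = 0"
    proof (induction rule: ideal_span.induct)
      case (step c g w)
      thus ?case using xs unfolding F0_def by (auto simp: mpeval_add mpeval_mult)
    qed simp
    thus ?thesis using p(2) by simp
  qed
  moreover have "finite F0" "F0 \<subseteq> F" using T(1,2) unfolding F0_def S_def by auto
  ultimately show ?thesis by blast
qed

lemma polyfun_rterm: "polyfun B d f \<Longrightarrow> \<exists>t. rtparams t \<subseteq> B \<and> (\<forall>xs. rteval xs t = f xs)"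
proof (induction rule: polyfun.induct)
  case (const b)
  show ?case by (rule exI[of _ "RConst b"]) (use const in auto)
next
  case (var i)
  show ?case by (rule exI[of _ "RVar i"]) auto
next
  case (add f g)
  then obtain s t where "rtparams s \<subseteq> B" "\<forall>xs. rteval xs s = f xs" "rtparams t \<subseteq> B" "\<forall>xs. rteval xs t = g xs" by blast
  thus ?case by (intro exI[of _ "RAdd s t"]) auto
next
  case (mult f g)
  then obtain s t where "rtparams s \<subseteq> B" "\<forall>xs. rteval xs s = f xs" "rtparams t \<subseteq> B" "\<forall>xs. rteval xs t = g xs" by blast
  thus ?case by (intro exI[of _ "RMul s t"]) auto
next
  case (uminus f)
  then obtain s where "rtparams s \<subseteq> B" "\<forall>xs. rteval xs s = f xs" by blast
  thus ?case by (intro exI[of _ "RNeg s"]) auto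
qed

section \<open>Functions given by fractions\<close>

text \<open>The class \<open>P\<close> is left open because two readings are needed: polynomial
  functions of a coefficient tuple with the generators fixed, and term-definable functions of the
  generators with the tuple fixed. \<open>\<Omega>\<close> is the region where denominators are
  nonzero.\<close>

definition frac_on :: "(('b \<Rightarrow> 'a::field) \<Rightarrow> bool) \<Rightarrow> ('b \<Rightarrow> bool) \<Rightarrow> ('b \<Rightarrow> 'a) \<Rightarrow> bool" where
  "frac_on P \<Omega> F \<longleftrightarrow> (\<exists>f g. P f \<and> P g \<and> (\<forall>x. \<Omega> x \<longrightarrow> g x \<noteq> 0 \<and> F x = f x / g x))"

lemma frac_on_add:
  assumes add: "\<And>f g. P f \<Longrightarrow> P g \<Longrightarrow> P (\<lambda>x. f x + g x)"
    and mult: "\<And>f g. P f \<Longrightarrow> P g \<Longrightarrow> P (\<lambda>x. f x * g x)"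
    and "frac_on P \<Omega> F" "frac_on P \<Omega> G"
  shows "frac_on P \<Omega> (\<lambda>x. F x + G x)"
proof -
  obtain f g f' g' where *: "P f" "P g" "\<forall>x. \<Omega> x \<longrightarrow> g x \<noteq> 0 \<and> F x = f x / g x"
    "P f'" "P g'" "\<forall>x. \<Omega> x \<longrightarrow> g' x \<noteq> 0 \<and> G x = f' x / g' x"
    using assms(3,4) unfolding frac_on_def by blast
  have "P (\<lambda>x. f x * g' x + f' x * g x)" "P (\<lambda>x. g x * g' x)" by (intro add mult *)+
  moreover have "\<forall>x. \<Omega> x \<longrightarrow> g x * g' x \<noteq> 0 \<and> F x + G x = (f x * g' x + f' x * g x) / (g x * g' x)"
    using *(3,6) by (simp add: add_frac_eq)
  ultimately show ?thesis unfolding frac_on_def by blast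
qed

lemma frac_on_mult:
  assumes mult: "\<And>f g. P f \<Longrightarrow> P g \<Longrightarrow> P (\<lambda>x. f x * g x)"
    and "frac_on P \<Omega> F" "frac_on P \<Omega> G"
  shows "frac_on P \<Omega> (\<lambda>x. F x * G x)"
proof -
  obtain f g f' g' where *: "P f" "P g" "\<forall>x. \<Omega> x \<longrightarrow> g x \<noteq> 0 \<and> F x = f x / g x"
    "P f'" "P g'" "\<forall>x. \<Omega> x \<longrightarrow> g' x \<noteq> 0 \<and> G x = f' x / g' x"
    using assms(2,3) unfolding frac_on_def by blast
  have "P (\<lambda>x. f x * f' x)" "P (\<lambda>x. g x * g' x)" by (intro mult *)+
  moreover have "\<forall>x. \<Omega> x \<longrightarrow> g x * g' x \<noteq> 0 \<and> F x * G x = (f x * f' x) / (g x * g' x)"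
    using *(3,6) by simp
  ultimately show ?thesis unfolding frac_on_def by blast
qed

lemma frac_on_uminus:
  assumes "\<And>f. P f \<Longrightarrow> P (\<lambda>x. - f x)" "frac_on P \<Omega> F" shows "frac_on P \<Omega> (\<lambda>x. - F x)"
proof -
  obtain f g where *: "P f" "P g" "\<forall>x. \<Omega> x \<longrightarrow> g x \<noteq> 0 \<and> F x = f x / g x"
    using assms(2) unfolding frac_on_def by blast
  have "P (\<lambda>x. - f x)" by (rule assms(1)[OF *(1)])
  moreover have "\<forall>x. \<Omega> x \<longrightarrow> g x \<noteq> 0 \<and> - F x = - f x / g x" using *(3) by simp
  ultimately show ?thesis unfolding frac_on_def using *(2) by blast
qed

lemma frac_on_base: "P (\<lambda>_. 1) \<Longrightarrow> P f \<Longrightarrow> frac_on P \<Omega> f"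
  unfolding frac_on_def by (rule exI[of _ f], rule exI[of _ "\<lambda>_. 1"]) auto

text \<open>Induction on the term; derivatives of fractions stay fractions by the quotient rule. In
  \<open>der\<close> the derivative has to agree with a member of \<open>P\<close> on
  \<open>\<Omega>\<close> only, which accommodates functions of constant tuples.\<close>

lemma frac_on_dteval:
  assumes D: "derivation D"
    and add: "\<And>f g. P f \<Longrightarrow> P g \<Longrightarrow> P (\<lambda>x. f x + g x)"
    and mult: "\<And>f g. P f \<Longrightarrow> P g \<Longrightarrow> P (\<lambda>x. f x * g x)"
    and um: "\<And>f. P f \<Longrightarrow> P (\<lambda>x. - f x)"
    and const: "\<And>c. c \<in> B \<Longrightarrow> P (\<lambda>_. c)" and one: "1 \<in> B"
    and der: "\<And>f. P f \<Longrightarrow> \<exists>g. P g \<and> (\<forall>x. \<Omega> x \<longrightarrow> D (f x) = g x)"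
    and F: "\<And>i. frac_on P \<Omega> (\<lambda>x. F x i)" and t: "dtparams t \<subseteq> B"
  shows "frac_on P \<Omega> (\<lambda>x. dteval D (F x) t)"
  using t
proof (induction t)
  case (DVar i)
  show ?case using F[of i] by simp
next
  case (DConst c)
  thus ?case using frac_on_base[where P = P, OF const[OF one] const[of c]] by simp
next
  case (DAdd s t)
  have "frac_on P \<Omega> (\<lambda>x. dteval D (F x) s + dteval D (F x) t)"
    by (rule frac_on_add[where P = P, OF add mult]) (use DAdd in auto)
  thus ?case by simp
next
  case (DMul s t)
  have "frac_on P \<Omega> (\<lambda>x. dteval D (F x) s * dteval D (F x) t)"
    by (rule frac_on_mult[where P = P, OF mult]) (use DMul in auto)
  thus ?case by simp
next
  case (DNeg t)
  have "frac_on P \<Omega> (\<lambda>x. - dteval D (F x) t)"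
    by (rule frac_on_uminus[where P = P, OF um]) (use DNeg in auto)
  thus ?case by simp
next
  case (DDer t)
  then obtain f g where *: "P f" "P g" "\<forall>x. \<Omega> x \<longrightarrow> g x \<noteq> 0 \<and> dteval D (F x) t = f x / g x"
    unfolding frac_on_def by auto
  obtain f' g' where **: "P f'" "\<forall>x. \<Omega> x \<longrightarrow> D (f x) = f' x" "P g'" "\<forall>x. \<Omega> x \<longrightarrow> D (g x) = g' x"
    using der[OF *(1)] der[OF *(2)] by blast
  have "P (\<lambda>x. f' x * g x + - (f x * g' x))" "P (\<lambda>x. g x * g x)" by (intro add mult um * **)+
  moreover have "\<forall>x. \<Omega> x \<longrightarrow> g x * g x \<noteq> 0 \<and>
      dteval D (F x) (DDer t) = (f' x * g x + - (f x * g' x)) / (g x * g x)"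
    using *(3) **(2,4) by (simp add: derivation_divide[OF D])
  ultimately show ?case unfolding frac_on_def by blast
qed

section \<open>Definability over the constants of the base field\<close>

definition const_tuple :: "('a::field \<Rightarrow> 'a) \<Rightarrow> nat \<Rightarrow> 'a list \<Rightarrow> bool" where
  "const_tuple D d xs \<longleftrightarrow> length xs = d \<and> set xs \<subseteq> consts_of D UNIV"

lemma const_tuple_nth: "const_tuple D d xs \<Longrightarrow> i < d \<Longrightarrow> D (xs ! i) = 0"
  unfolding const_tuple_def consts_of_def by (auto dest!: nth_mem)

text \<open>At a constant tuple the coordinates have derivative zero, so \<open>D\<close> acts on
  the coefficients alone.\<close>

lemma polyfun_derivation:
  assumes D: "derivation D" and B: "diff_subfield D B"
  shows "polyfun B d f \<Longrightarrow> \<exists>g. polyfun B d g \<and> (\<forall>xs. const_tuple D d xs \<longrightarrow> D (f xs) = g xs)"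
proof (induction rule: polyfun.induct)
  case (const b)
  thus ?case using diff_subfieldD(7)[OF B] by (intro exI[of _ "\<lambda>xs. D b"]) (auto intro: polyfun.const)
next
  case (var i)
  thus ?case using diff_subfieldD(1)[OF B] const_tuple_nth[of D d]
    by (intro exI[of _ "\<lambda>xs. 0"]) (auto intro: polyfun.const)
next
  case (add f g)
  then obtain f' g' where "polyfun B d f'" "\<forall>xs. const_tuple D d xs \<longrightarrow> D (f xs) = f' xs"
    "polyfun B d g'" "\<forall>xs. const_tuple D d xs \<longrightarrow> D (g xs) = g' xs" by blast
  thus ?case by (intro exI[of _ "\<lambda>xs. f' xs + g' xs"]) (auto intro: polyfun.add simp: derivation_add[OF D])
next
  case (mult f g)
  then obtain f' g' where "polyfun B d f'" "\<forall>xs. const_tuple D d xs \<longrightarrow> D (f xs) = f' xs"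
    "polyfun B d g'" "\<forall>xs. const_tuple D d xs \<longrightarrow> D (g xs) = g' xs" by blast
  thus ?case using mult(1,2)
    by (intro exI[of _ "\<lambda>xs. f xs * g' xs + f' xs * g xs"])
      (auto intro!: polyfun.add polyfun.mult simp: derivation_mult[OF D])
next
  case (uminus f)
  then obtain f' where "polyfun B d f'" "\<forall>xs. const_tuple D d xs \<longrightarrow> D (f xs) = f' xs" by blast
  thus ?case by (intro exI[of _ "\<lambda>xs. - f' xs"]) (auto intro: polyfun.uminus simp: derivation_minus[OF D])
qed

lemma polyfun_constant:
  assumes D: "derivation D" and xs: "const_tuple D d xs"
  shows "polyfun (consts_of D K) d f \<Longrightarrow> D (f xs) = 0"
  by (induction rule: polyfun.induct)
    (use const_tuple_nth[OF xs] in \<open>auto simp: consts_of_def derivation_add[OF D] derivation_mult[OF D] derivation_minus[OF D]\<close>)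

text \<open>Coefficients in \<open>L\<close> are separated from polynomial functions over
  \<open>B\<close>, the form in which linear disjointness can be applied.\<close>

inductive polyfun_span :: "'a::comm_ring_1 set \<Rightarrow> 'a set \<Rightarrow> nat \<Rightarrow> ('a list \<Rightarrow> 'a) \<Rightarrow> bool" for B L d where
  zero: "polyfun_span B L d (\<lambda>xs. 0)"
| step: "b \<in> L \<Longrightarrow> polyfun B d g \<Longrightarrow> polyfun_span B L d f \<Longrightarrow> polyfun_span B L d (\<lambda>xs. b * g xs + f xs)"

lemma polyfun_span_add:
  "polyfun_span B L d f \<Longrightarrow> polyfun_span B L d f' \<Longrightarrow> polyfun_span B L d (\<lambda>xs. f xs + f' xs)"
proof (induction rule: polyfun_span.induct)
  case (step b g f)
  from polyfun_span.step[OF step(1,2) step(4)[OF step(5)]] show ?case by (simp add: add.assoc)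
qed simp

lemma polyfun_span_mult:
  assumes L: "diff_subfield D L" and "polyfun_span B L d f" and f': "polyfun_span B L d f'"
  shows "polyfun_span B L d (\<lambda>xs. f xs * f' xs)"
proof -
  have 1: "polyfun_span B L d (\<lambda>xs. (b * g xs) * f xs)"
    if "b \<in> L" "polyfun B d g" "polyfun_span B L d f" for b g f
    using that(3)
  proof (induction rule: polyfun_span.induct)
    case (step c h f)
    from polyfun_span.step[OF diff_subfieldD(4)[OF L that(1) step(1)] polyfun.mult[OF that(2) step(2)] step(4)]
    show ?case by (simp add: distrib_left mult_ac)
  qed (auto intro: polyfun_span.zero)
  show ?thesis using assms(2)
  proof (induction rule: polyfun_span.induct)
    case (step b g f)
    from polyfun_span_add[OF 1[OF step(1,2) f'] step(4)] show ?case by (simp add: distrib_right)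
  qed (auto intro: polyfun_span.zero)
qed

lemma polyfun_in_span:
  assumes L: "diff_subfield D L" and B: "1 \<in> B"
  shows "polyfun L d f \<Longrightarrow> polyfun_span B L d f"
proof (induction rule: polyfun.induct)
  case (const b)
  from polyfun_span.step[OF const polyfun.const[OF B] polyfun_span.zero] show ?case by simp
next
  case (var i)
  from polyfun_span.step[OF diff_subfieldD(2)[OF L] polyfun.var[OF var] polyfun_span.zero] show ?case by simp
next
  case (uminus f)
  from polyfun_span.step[OF diff_subfieldD(5)[OF L diff_subfieldD(2)[OF L]] polyfun.const[OF B] polyfun_span.zero]
  have "polyfun_span B L d (\<lambda>xs. - 1)" by simp
  from polyfun_span_mult[OF L this uminus(2)] show ?case by simp
qed (auto intro: polyfun_span_add polyfun_span_mult[OF L])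

lemma polyfun_span_sum:
  "polyfun_span B L d f \<Longrightarrow>
   \<exists>(n::nat) b g. (\<forall>i<n. b i \<in> L \<and> polyfun B d (g i)) \<and> f = (\<lambda>xs. \<Sum>i<n. b i * g i xs)"
proof (induction rule: polyfun_span.induct)
  case zero
  show ?case by (rule exI[of _ 0]) simp
next
  case (step b0 g0 f)
  then obtain n b g where *: "\<forall>i<n. b i \<in> L \<and> polyfun B d (g i)" "f = (\<lambda>xs. \<Sum>i<n::nat. b i * g i xs)" by blast
  show ?case
    by (rule exI[of _ "Suc n"], rule exI[of _ "b(n := b0)"], rule exI[of _ "g(n := g0)"])
      (use * step in \<open>auto simp: less_Suc_eq add.commute\<close>)
qed

context strongly_normal_extension
begin

abbreviation "CK \<equiv> consts_of D K"

text \<open>The formula is tested on constant tuples in \<open>\<Omega>\<close> only. This lets a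
  rational condition be replaced by the vanishing of its numerator where denominators are nonzero;
  \<open>qdef_relative\<close> restores a condition on all constant tuples.\<close>

definition qdef :: "nat \<Rightarrow> ('a list \<Rightarrow> bool) \<Rightarrow> ('a list \<Rightarrow> bool) \<Rightarrow> bool" where
  "qdef d \<Omega> Q \<longleftrightarrow> (\<exists>\<phi>. qparams \<phi> \<subseteq> CK \<and> (\<forall>xs. const_tuple D d xs \<longrightarrow> \<Omega> xs \<longrightarrow> (qsat xs \<phi> \<longleftrightarrow> Q xs)))"

lemma qdefI:
  "qparams \<phi> \<subseteq> CK \<Longrightarrow> (\<And>xs. const_tuple D d xs \<Longrightarrow> \<Omega> xs \<Longrightarrow> qsat xs \<phi> \<longleftrightarrow> Q xs) \<Longrightarrow> qdef d \<Omega> Q"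
  unfolding qdef_def by blast

lemma CK: "diff_subfield D CK" by (rule diff_subfield_constants[OF D K])

lemma qdef_cong:
  "qdef d \<Omega> Q \<Longrightarrow> (\<And>xs. const_tuple D d xs \<Longrightarrow> \<Omega> xs \<Longrightarrow> Q xs \<longleftrightarrow> Q' xs) \<Longrightarrow> qdef d \<Omega> Q'"
  unfolding qdef_def by metis

lemma qdef_not: assumes "qdef d \<Omega> P" shows "qdef d \<Omega> (\<lambda>xs. \<not> P xs)"
proof -
  obtain \<phi> where "qparams \<phi> \<subseteq> CK" "\<forall>xs. const_tuple D d xs \<longrightarrow> \<Omega> xs \<longrightarrow> (qsat xs \<phi> \<longleftrightarrow> P xs)"
    using assms unfolding qdef_def by blast
  thus ?thesis by (intro qdefI[of "RNot \<phi>"]) auto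
qed

lemma qdef_and: assumes "qdef d \<Omega> P" "qdef d \<Omega> Q" shows "qdef d \<Omega> (\<lambda>xs. P xs \<and> Q xs)"
proof -
  obtain \<phi> \<psi> where "qparams \<phi> \<subseteq> CK" "\<forall>xs. const_tuple D d xs \<longrightarrow> \<Omega> xs \<longrightarrow> (qsat xs \<phi> \<longleftrightarrow> P xs)"
    "qparams \<psi> \<subseteq> CK" "\<forall>xs. const_tuple D d xs \<longrightarrow> \<Omega> xs \<longrightarrow> (qsat xs \<psi> \<longleftrightarrow> Q xs)"
    using assms unfolding qdef_def by blast
  thus ?thesis by (intro qdefI[of "RAnd \<phi> \<psi>"]) auto
qed

lemma qdef_ball:
  assumes "finite I" "\<And>i. i \<in> I \<Longrightarrow> qdef d \<Omega> (P i)" shows "qdef d \<Omega> (\<lambda>xs. \<forall>i\<in>I. P i xs)"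
  using assms
proof (induction I)
  case empty
  show ?case by (rule qdefI[of "REq (RConst 0) (RConst 0)"]) (use diff_subfieldD(1)[OF CK] in auto)
next
  case (insert i I)
  thus ?case using qdef_and[of d \<Omega> "P i" "\<lambda>xs. \<forall>i\<in>I. P i xs"] by simp
qed

lemma qdef_relative:
  assumes "qdef d (\<lambda>_. True) P" "qdef d P Q" shows "qdef d (\<lambda>_. True) (\<lambda>xs. P xs \<and> Q xs)"
proof -
  obtain \<phi> \<psi> where "qparams \<phi> \<subseteq> CK" "\<forall>xs. const_tuple D d xs \<longrightarrow> (qsat xs \<phi> \<longleftrightarrow> P xs)"
    "qparams \<psi> \<subseteq> CK" "\<forall>xs. const_tuple D d xs \<longrightarrow> P xs \<longrightarrow> (qsat xs \<psi> \<longleftrightarrow> Q xs)"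
    using assms unfolding qdef_def by blast
  thus ?thesis by (intro qdefI[of "RAnd \<phi> \<psi>"]) auto
qed

lemma qdef_polyfun_constants: assumes "polyfun CK d f" shows "qdef d \<Omega> (\<lambda>xs. f xs = 0)"
proof -
  obtain t where "rtparams t \<subseteq> CK" "\<forall>xs. rteval xs t = f xs" using polyfun_rterm[OF assms] by blast
  thus ?thesis using diff_subfieldD(1)[OF CK] by (intro qdefI[of "REq t (RConst 0)"]) auto
qed

text \<open>Linear disjointness of \<open>L\<close> and \<open>C\<close> over \<open>CK\<close>: with coefficients \<open>b i\<close> independent over \<open>CK\<close>
  the equation splits into equations over \<open>CK\<close>; a dependence eliminates one coefficient.\<close>

lemma qdef_linear_combination:
  assumes "finite I" "\<And>i. i \<in> I \<Longrightarrow> b i \<in> L" "\<And>i. i \<in> I \<Longrightarrow> polyfun CK d (g i)"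
  shows "qdef d \<Omega> (\<lambda>xs. (\<Sum>i\<in>I. b i * g i xs) = 0)"
  using assms
proof (induction "card I" arbitrary: I g rule: less_induct)
  case less
  show ?case
  proof (cases "\<exists>e. (\<forall>i\<in>I. e i \<in> L \<and> D (e i) = 0) \<and> (\<exists>i\<in>I. e i \<noteq> 0) \<and> (\<Sum>i\<in>I. e i * b i) = 0")
    case False
    have "qdef d \<Omega> (\<lambda>xs. \<forall>i\<in>I. g i xs = 0)"
      by (rule qdef_ball[OF less.prems(1)]) (rule qdef_polyfun_constants, rule less.prems(3))
    thus ?thesis
    proof (rule qdef_cong)
      fix xs assume xs: "const_tuple D d xs"
      have "g i xs = 0" if s: "(\<Sum>i\<in>I. b i * g i xs) = 0" and i: "i \<in> I" for i
      proof (rule ccontr)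
        assume "g i xs \<noteq> 0"
        with constant_dependence_descends[OF D L less.prems(1,2), where c = "\<lambda>i. g i xs" and k = i]
        have "\<exists>e. (\<forall>i\<in>I. e i \<in> L \<and> D (e i) = 0) \<and> (\<exists>i\<in>I. e i \<noteq> 0) \<and> (\<Sum>i\<in>I. e i * b i) = 0"
          using polyfun_constant[OF D xs less.prems(3)] s i by (simp add: mult.commute)
        thus False using False by blast
      qed
      thus "(\<forall>i\<in>I. g i xs = 0) \<longleftrightarrow> (\<Sum>i\<in>I. b i * g i xs) = 0" by auto
    qed
  next
    case True
    then obtain e k where e: "\<And>i. i \<in> I \<Longrightarrow> e i \<in> L \<and> D (e i) = 0" "(\<Sum>i\<in>I. e i * b i) = 0"
      and k: "k \<in> I" "e k \<noteq> 0" by blast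
    \<comment> \<open>Strong normality enters here: the constants of \<open>L\<close> lie in
      \<open>K\<close>, so the new coefficients are admissible parameters.\<close>
    have eCK: "e i \<in> CK" if "i \<in> I" for i using e(1)[OF that] constants_in_K by (auto simp: consts_of_def)
    \<comment> \<open>Solving the dependence for \<open>b k\<close> and substituting changes the
      other coefficient functions to \<open>h i\<close>, while \<open>h k\<close> is zero.\<close>
    define h where "h i xs = g i xs - e i / e k * g k xs" for i xs
    have h: "polyfun CK d (h i)" if "i \<in> I" for i
      unfolding h_def using that less.prems(3) k eCK
      by (intro polyfun_diff polyfun.mult polyfun.const diff_subfieldD(9)[OF CK]) auto
    have "card (I - {k}) < card I" using less.prems(1) k(1) by (rule card_Diff1_less)
    hence "qdef d \<Omega> (\<lambda>xs. (\<Sum>i\<in>I - {k}. b i * h i xs) = 0)"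
      by (rule less.hyps) (use less.prems h in auto)
    moreover have "(\<Sum>i\<in>I - {k}. b i * h i xs) = (\<Sum>i\<in>I. b i * g i xs)" for xs
    proof -
      have "(\<Sum>i\<in>I - {k}. b i * h i xs) = (\<Sum>i\<in>I. b i * h i xs)"
        using less.prems(1) k by (simp add: sum.remove[of I k] h_def)
      also have "\<dots> = (\<Sum>i\<in>I. b i * g i xs) - (\<Sum>i\<in>I. e i * b i) * (g k xs / e k)"
        unfolding sum_distrib_right sum_subtractf[symmetric] by (rule sum.cong) (auto simp: h_def algebra_simps)
      finally show ?thesis using e(2) by simp
    qed
    ultimately show ?thesis by simp
  qed
qed

lemma qdef_polyfun: assumes "polyfun L d f" shows "qdef d \<Omega> (\<lambda>xs. f xs = 0)"
proof -
  have "polyfun_span CK L d f" by (rule polyfun_in_span[OF L diff_subfieldD(2)[OF CK] assms])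
  then obtain n b g where *: "\<forall>i<n. b i \<in> L \<and> polyfun CK d (g i)" "f = (\<lambda>xs. \<Sum>i<n::nat. b i * g i xs)"
    using polyfun_span_sum by blast
  show ?thesis unfolding *(2) by (rule qdef_linear_combination) (use * in auto)
qed

section \<open>Rational functions of a constant tuple\<close>

definition ratfun :: "nat \<Rightarrow> ('a list \<Rightarrow> bool) \<Rightarrow> ('a list \<Rightarrow> 'a) \<Rightarrow> bool" where
  "ratfun d \<Omega> F \<longleftrightarrow> frac_on (polyfun L d) (\<lambda>xs. const_tuple D d xs \<and> \<Omega> xs) F"

lemma ratfun_polyfun: "polyfun L d f \<Longrightarrow> ratfun d \<Omega> f"
  unfolding ratfun_def by (intro frac_on_base polyfun.const diff_subfieldD(2)[OF L])

lemma ratfun_mult: "ratfun d \<Omega> F \<Longrightarrow> ratfun d \<Omega> G \<Longrightarrow> ratfun d \<Omega> (\<lambda>xs. F xs * G xs)"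
  unfolding ratfun_def by (rule frac_on_mult) (rule polyfun.mult)

lemma ratfun_add: "ratfun d \<Omega> F \<Longrightarrow> ratfun d \<Omega> G \<Longrightarrow> ratfun d \<Omega> (\<lambda>xs. F xs + G xs)"
  unfolding ratfun_def by (rule frac_on_add) (rule polyfun.add polyfun.mult; assumption)+

lemma ratfun_diff: "ratfun d \<Omega> F \<Longrightarrow> ratfun d \<Omega> G \<Longrightarrow> ratfun d \<Omega> (\<lambda>xs. F xs - G xs)"
  using ratfun_add[of d \<Omega> F "\<lambda>xs. - G xs"] frac_on_uminus[of "polyfun L d" _ G] polyfun.uminus
  unfolding ratfun_def by auto

lemma ratfun_sum: "(\<And>i. i \<in> I \<Longrightarrow> ratfun d \<Omega> (F i)) \<Longrightarrow> ratfun d \<Omega> (\<lambda>xs. \<Sum>i\<in>I. F i xs)"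
proof (induction I rule: infinite_finite_induct)
  case (insert i I)
  thus ?case using ratfun_add[of d \<Omega> "F i" "\<lambda>xs. \<Sum>i\<in>I. F i xs"] by simp
qed (auto intro!: ratfun_polyfun polyfun.const diff_subfieldD(1)[OF L])

lemma ratfun_dteval:
  assumes "\<And>i. ratfun d \<Omega> (\<lambda>xs. F xs i)" "dtparams t \<subseteq> L"
  shows "ratfun d \<Omega> (\<lambda>xs. dteval D (F xs) t)"
  unfolding ratfun_def
proof (rule frac_on_dteval[where P = "polyfun L d" and B = L, OF D])
  show "\<exists>g. polyfun L d g \<and> (\<forall>xs. const_tuple D d xs \<and> \<Omega> xs \<longrightarrow> D (f xs) = g xs)" if "polyfun L d f" for f
    using polyfun_derivation[OF D L that] by blast
qed (use assms diff_subfieldD(2)[OF L] in \<open>auto simp: ratfun_def intro: polyfun.intros\<close>)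

lemma ratfun_zero_polyfun:
  assumes "ratfun d \<Omega> F"
  shows "\<exists>f. polyfun L d f \<and> (\<forall>xs. const_tuple D d xs \<longrightarrow> \<Omega> xs \<longrightarrow> (F xs = 0 \<longleftrightarrow> f xs = 0))"
  using assms unfolding ratfun_def frac_on_def by auto

lemma qdef_ratfun: assumes "ratfun d \<Omega> F" shows "qdef d \<Omega> (\<lambda>xs. F xs = 0)"
proof -
  obtain f where f: "polyfun L d f" "\<forall>xs. const_tuple D d xs \<longrightarrow> \<Omega> xs \<longrightarrow> (F xs = 0 \<longleftrightarrow> f xs = 0)"
    using ratfun_zero_polyfun[OF assms] by blast
  show ?thesis by (rule qdef_cong[OF qdef_polyfun[OF f(1)]]) (use f(2) in auto)
qed

lemma qdef_ratfun_eq: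
  assumes "ratfun d \<Omega> F" "ratfun d \<Omega> G" shows "qdef d \<Omega> (\<lambda>xs. F xs = G xs)"
  using qdef_ratfun[OF ratfun_diff[OF assms]] by simp

text \<open>The index set may be infinite. The numerators are polynomial functions over
  \<open>L\<close>, and finitely many of them have the same common zeros.\<close>

lemma qdef_ratfun_system:
  assumes "\<And>t. t \<in> T \<Longrightarrow> ratfun d \<Omega> (F t)" shows "qdef d \<Omega> (\<lambda>xs. \<forall>t\<in>T. F t xs = 0)"
proof -
  have "\<forall>t\<in>T. \<exists>f. polyfun L d f \<and> (\<forall>xs. const_tuple D d xs \<longrightarrow> \<Omega> xs \<longrightarrow> (F t xs = 0 \<longleftrightarrow> f xs = 0))"
    using ratfun_zero_polyfun assms by blast
  then obtain f where f: "\<And>t. t \<in> T \<Longrightarrow> polyfun L d (f t)"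
    "\<And>t xs. t \<in> T \<Longrightarrow> const_tuple D d xs \<Longrightarrow> \<Omega> xs \<Longrightarrow> F t xs = 0 \<longleftrightarrow> f t xs = 0" by metis
  have "polyfun L d g" if "g \<in> f ` T" for g using that f(1) by auto
  hence "\<exists>F0. finite F0 \<and> F0 \<subseteq> f ` T \<and> (\<forall>xs. (\<forall>g\<in>F0. g xs = 0) \<longrightarrow> (\<forall>g\<in>f ` T. g xs = 0))"
    by (rule polyfun_finite_subsystem[OF L])
  then obtain F0 where "finite F0 \<and> F0 \<subseteq> f ` T \<and> (\<forall>xs. (\<forall>g\<in>F0. g xs = 0) \<longrightarrow> (\<forall>g\<in>f ` T. g xs = 0))"
    by (elim exE)
  hence F0: "finite F0" "F0 \<subseteq> f ` T" "(\<forall>g\<in>F0. g xs = 0) \<Longrightarrow> (\<forall>g\<in>f ` T. g xs = 0)" for xs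
    by simp_all
  have "qdef d \<Omega> (\<lambda>xs. \<forall>g\<in>F0. g xs = 0)"
    by (rule qdef_ball[OF F0(1)], rule qdef_polyfun) (use F0(2) f(1) in auto)
  thus ?thesis
  proof (rule qdef_cong)
    fix xs assume xs: "const_tuple D d xs" "\<Omega> xs"
    have "(\<forall>g\<in>F0. g xs = 0) \<longleftrightarrow> (\<forall>g\<in>f ` T. g xs = 0)" using F0(2) F0(3)[of xs] by (auto simp: subset_iff)
    thus "(\<forall>g\<in>F0. g xs = 0) \<longleftrightarrow> (\<forall>t\<in>T. F t xs = 0)" using f(2)[OF _ xs] by simp
  qed
qed

section \<open>Specialisations\<close>

definition specialises :: "(nat \<Rightarrow> 'a) \<Rightarrow> bool" where
  "specialises e \<longleftrightarrow> (\<forall>t. dtparams t \<subseteq> K \<longrightarrow> dteval D a t = 0 \<longrightarrow> dteval D e t = 0)"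

text \<open>A term with parameters in \<open>K\<close> and \<open>C\<close> is a combination, with
  coefficients in \<open>C\<close>, of terms over \<open>K\<close>, the same combination at every
  pair of valuations compared.\<close>

lemma dteval_pair_span:
  assumes "dtparams t \<subseteq> K \<union> C"
  shows "(dteval D e t, dteval D e' t) \<in> pair_span D {(dteval D e s, dteval D e' s) |s. dtparams s \<subseteq> K}" (is "_ \<in> pair_span D ?G")
proof -
  have G: "diff_pair_ring D ?G" by (rule diff_pair_ring_terms) (rule diff_subfieldD[OF K])+
  note S = diff_pair_ringD[OF diff_pair_ring_pair_span[OF D G]]
  have I: "(dteval D e s, dteval D e' s) \<in> pair_span D ?G" if "dtparams s \<subseteq> K" for s
    by (rule pair_span_superset[OF D]) (use that in blast)
  show ?thesis using assms
  proof (induction t)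
    case (DVar i)
    thus ?case using I[of "DVar i"] by simp
  next
    case (DConst c)
    show ?case
    proof (cases "c \<in> K")
      case True thus ?thesis using I[of "DConst c"] by simp
    next
      case False
      hence "D c = 0" using DConst C_iff by auto
      from pair_span_scale[OF D this S(2)] show ?thesis by simp
    qed
  qed (auto intro: S)
qed

text \<open>An equation of \<open>a\<close> with constants of \<open>C\<close> as parameters is a
  relation over \<open>C\<close> between values in \<open>L\<close>. Such relations follow from
  those over the constants of \<open>L\<close>, which lie in \<open>K\<close>, and the latter are
  preserved by a specialisation over \<open>K\<close>.\<close>

lemma specialises_constants:
  assumes e: "specialises e" and t: "dtparams t \<subseteq> K \<union> C" "dteval D a t = 0"
  shows "dteval D e t = 0"
proof -
  define G where "G = {(dteval D a s, dteval D e s) |s. dtparams s \<subseteq> K}"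
  have G: "diff_pair_ring D G" unfolding G_def by (rule diff_pair_ring_terms) (rule diff_subfieldD[OF K])+
  obtain n c u v where *: "\<forall>i<n. D (c i) = 0 \<and> (u i, v i) \<in> G" "dteval D a t = (\<Sum>i<n. c i * u i)"
    "dteval D e t = (\<Sum>i<n::nat. c i * v i)"
    using pair_span_sum[OF dteval_pair_span[OF t(1), of a e, folded G_def]] by blast
  have u: "u i \<in> L" if "i < n" for i
  proof -
    have "u i \<in> R0" using * that unfolding G_def R0_def by auto
    thus ?thesis using R0_subset_L by blast
  qed
  show ?thesis unfolding *(3)
  proof (rule constant_relations_transfer[OF D L, of "{..<n}" u])
    fix b assume b: "\<And>i. i \<in> {..<n} \<Longrightarrow> b i \<in> L \<and> D (b i) = 0" "(\<Sum>i<n. b i * u i) = 0"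
    have bG: "(b i * u i, b i * v i) \<in> G" if i: "i < n" for i
    proof -
      have "b i \<in> K" using constants_in_K b(1) i by auto
      hence "(b i, b i) \<in> G" unfolding G_def by (auto intro!: exI[of _ "DConst (b i)"])
      thus ?thesis using diff_pair_ringD(4)[OF G] * i by blast
    qed
    have "((\<Sum>i\<in>I. b i * u i), (\<Sum>i\<in>I. b i * v i)) \<in> G" if "I \<subseteq> {..<n}" for I
      using finite_subset[OF that finite_lessThan] that
      by (induction I rule: infinite_finite_induct) (auto intro: diff_pair_ringD[OF G] bG)
    hence "((\<Sum>i<n. b i * u i), (\<Sum>i<n. b i * v i)) \<in> G" by blast
    then obtain s where "dtparams s \<subseteq> K" "(\<Sum>i<n. b i * u i) = dteval D a s" "(\<Sum>i<n. b i * v i) = dteval D e s"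
      unfolding G_def by blast
    thus "(\<Sum>i<n. b i * v i) = 0" using b(2) e unfolding specialises_def by simp
  qed (use * u t(2) in auto)
qed

end

text \<open>The classes of \<open>E\<close> are the full fibres of \<open>\<Psi>\<close>, so they
  correspond to the elements of \<open>H\<close>, and \<open>R\<close> between classes does not
  depend on the representatives.\<close>

lemma quotient_group_transport:
  assumes H: "group H" and im: "\<Psi> ` S = carrier H"
    and E: "E = {(x, y). x \<in> S \<and> y \<in> S \<and> \<Psi> x = \<Psi> y}"
    and R: "R = {(x, y, z). x \<in> S \<and> y \<in> S \<and> z \<in> S \<and> \<Psi> x \<otimes>\<^bsub>H\<^esub> \<Psi> y = \<Psi> z}"
  shows "equiv S E \<and> (\<exists>G :: 'b set monoid. carrier G = S // E \<and>
        (\<forall>X\<in>S // E. \<forall>Y\<in>S // E. \<forall>Z\<in>S // E.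
           X \<otimes>\<^bsub>G\<^esub> Y = Z \<longleftrightarrow> (\<exists>x\<in>X. \<exists>y\<in>Y. \<exists>z\<in>Z. (x, y, z) \<in> R)) \<and> group G \<and> G \<cong> H)"
proof
  interpret H: group H by (rule H)
  show "equiv S E" unfolding E by (rule equivI) (auto simp: refl_on_def sym_def trans_def)
  define F where "F h = {s \<in> S. \<Psi> s = h}" for h
  define \<psi> where "\<psi> X = \<Psi> (SOME x. x \<in> X)" for X
  have \<psi>F: "\<psi> (F h) = h" if "h \<in> carrier H" for h
  proof -
    have "\<exists>x. x \<in> F h" using that im unfolding F_def by (auto simp: image_iff) (metis imageE)
    hence "(SOME x. x \<in> F h) \<in> F h" by (rule someI_ex)
    thus ?thesis unfolding \<psi>_def F_def by simp
  qed
  have quo: "S // E = F ` carrier H"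
  proof -
    have "E `` {x} = F (\<Psi> x)" if "x \<in> S" for x using that by (auto simp: E F_def)
    hence "S // E = (\<lambda>x. F (\<Psi> x)) ` S" unfolding quotient_def by auto
    thus ?thesis unfolding im[symmetric] image_image .
  qed
  have F_inj: "F h = F h' \<longleftrightarrow> h = h'" if "h \<in> carrier H" "h' \<in> carrier H" for h h'
    using \<psi>F[OF that(1)] \<psi>F[OF that(2)] by metis
  define G :: "'b set monoid" where
    "G = \<lparr>carrier = S // E, monoid.mult = \<lambda>X Y. F (\<psi> X \<otimes>\<^bsub>H\<^esub> \<psi> Y), one = F \<one>\<^bsub>H\<^esub>\<rparr>"
  have mulF: "F g \<otimes>\<^bsub>G\<^esub> F h = F (g \<otimes>\<^bsub>H\<^esub> h)" if "g \<in> carrier H" "h \<in> carrier H" for g h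
    using that \<psi>F by (simp add: G_def)
  have car: "carrier G = F ` carrier H" by (simp add: G_def quo)
  have one: "\<one>\<^bsub>G\<^esub> = F \<one>\<^bsub>H\<^esub>" by (simp add: G_def)
  have "group G"
  proof (rule groupI)
    show "\<exists>y\<in>carrier G. y \<otimes>\<^bsub>G\<^esub> x = \<one>\<^bsub>G\<^esub>" if x: "x \<in> carrier G" for x
    proof -
      obtain h where "h \<in> carrier H" "x = F h" using x car by auto
      thus ?thesis unfolding car one by (intro bexI[of _ "F (inv\<^bsub>H\<^esub> h)"]) (auto simp: mulF)
    qed
  qed (auto simp: car one mulF H.m_assoc)
  moreover have "\<psi> \<in> iso G H"
    unfolding iso_def hom_def bij_betw_def
    by (auto simp: car mulF \<psi>F inj_on_def image_image cong: image_cong)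
  hence "G \<cong> H" unfolding is_iso_def by blast
  moreover have "X \<otimes>\<^bsub>G\<^esub> Y = Z \<longleftrightarrow> (\<exists>x\<in>X. \<exists>y\<in>Y. \<exists>z\<in>Z. (x, y, z) \<in> R)"
    if "X \<in> S // E" "Y \<in> S // E" "Z \<in> S // E" for X Y Z
  proof -
    have "X \<in> F ` carrier H" "Y \<in> F ` carrier H" "Z \<in> F ` carrier H" using that quo by auto
    then obtain g h k where *: "g \<in> carrier H" "X = F g" "h \<in> carrier H" "Y = F h" "k \<in> carrier H" "Z = F k"
      by blast
    then obtain x y z where xyz: "x \<in> S" "g = \<Psi> x" "y \<in> S" "h = \<Psi> y" "z \<in> S" "k = \<Psi> z"
      unfolding im[symmetric] by auto
    have "X \<otimes>\<^bsub>G\<^esub> Y = Z \<longleftrightarrow> g \<otimes>\<^bsub>H\<^esub> h = k" using * mulF F_inj by simp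
    also have "\<dots> \<longleftrightarrow> (\<exists>x\<in>X. \<exists>y\<in>Y. \<exists>z\<in>Z. (x, y, z) \<in> R)"
    proof
      assume "g \<otimes>\<^bsub>H\<^esub> h = k"
      thus "\<exists>x\<in>X. \<exists>y\<in>Y. \<exists>z\<in>Z. (x, y, z) \<in> R" using xyz
        unfolding *(2,4,6) R F_def by (intro bexI[of _ x] bexI[of _ y] bexI[of _ z]) auto
    next
      assume "\<exists>x\<in>X. \<exists>y\<in>Y. \<exists>z\<in>Z. (x, y, z) \<in> R"
      thus "g \<otimes>\<^bsub>H\<^esub> h = k" unfolding *(2,4,6) R F_def by blast
    qed
    finally show ?thesis .
  qed
  moreover have "carrier G = S // E" by (simp add: G_def)
  ultimately show "\<exists>G :: 'b set monoid. carrier G = S // E \<and>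
        (\<forall>X\<in>S // E. \<forall>Y\<in>S // E. \<forall>Z\<in>S // E.
           X \<otimes>\<^bsub>G\<^esub> Y = Z \<longleftrightarrow> (\<exists>x\<in>X. \<exists>y\<in>Y. \<exists>z\<in>Z. (x, y, z) \<in> R)) \<and> group G \<and> G \<cong> H" by blast
qed

section \<open>The interpretation\<close>

lemma tuple_of_blocks:
  assumes "\<And>s i k. D (f s i k) = 0" and "D 0 = 0"
  shows "\<exists>xs. const_tuple D (4 * (n * m) + 1) xs \<and>
    (\<forall>s<4. \<forall>i<n. \<forall>k<m. xs ! (s * (n * m) + i * m + k) = f s i k)"
proof -
  define w where "w = n * m"
  \<comment> \<open>Block, row and column are recovered from the position by division with
    remainder; the one position past the four blocks receives 0.\<close>
  define h where "h j = (if j < 4 * w then f (j div w) (j mod w div m) (j mod w mod m) else 0)" for j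
  define xs where "xs = map h [0..<4 * w + 1]"
  have "D (h j) = 0" for j using assms by (simp add: h_def)
  hence "const_tuple D (4 * w + 1) xs" unfolding const_tuple_def xs_def consts_of_def by auto
  moreover have "xs ! (s * w + i * m + k) = f s i k" if "s < 4" "i < n" "k < m" for s i k
  proof -
    have "i * m + k < (i + 1) * m" using that(3) by simp
    also have "\<dots> \<le> w" unfolding w_def using that(2) by (intro mult_le_mono1) simp
    finally have r: "i * m + k < w" .
    have "w + s * w \<le> 4 * w"
      unfolding mult_Suc[symmetric] by (rule mult_le_mono1) (use that(1) in simp)
    hence j: "s * w + (i * m + k) < 4 * w" using r by linarith
    have "h (s * w + (i * m + k)) = f s i k"
      using r j that(3) by (simp add: h_def)
    thus ?thesis using j unfolding xs_def by (simp add: add.assoc del: upt_Suc)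
  qed
  ultimately show ?thesis unfolding w_def by blast
qed

section \<open>Tuples that code automorphisms\<close>

locale galois_interpretation = strongly_normal_extension D K L fs
  for D :: "'a::field_char_0 \<Rightarrow> 'a" and K L :: "'a set" and fs :: "'a list" +
  fixes ls :: "'a list" and u :: "nat \<Rightarrow> 'a dterm"
  assumes ls: "distinct ls"
    and u: "\<And>k. k < length ls \<Longrightarrow> dtparams (u k) \<subseteq> K \<and> dteval D a (u k) = ls ! k"
    and rep: "\<And>\<tau> i. \<tau> \<in> diff_hom D K L \<Longrightarrow>
      \<exists>p\<in>cspan D (set ls). \<exists>q\<in>cspan D (set ls). q \<noteq> 0 \<and> \<tau> (a i) * q = p"
begin

abbreviation "n \<equiv> length fs"
abbreviation "m \<equiv> length ls"
definition "w = n * m"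
definition "d = 4 * w + 1"

text \<open>A tuple \<open>xs\<close> consists of four blocks of \<open>w\<close> coefficients at offsets \<open>0\<close>, \<open>w\<close>, \<open>2 * w\<close>, \<open>3 * w\<close>:
  the numerators and denominators of the image of the generators under an automorphism, and those of
  its inverse.  The unused last coordinate makes \<open>d\<close> positive.\<close>

definition comb :: "nat \<Rightarrow> 'a list \<Rightarrow> nat \<Rightarrow> (nat \<Rightarrow> 'a) \<Rightarrow> 'a" where
  "comb off xs i e = (\<Sum>k<m. xs ! (off + i * m + k) * dteval D e (u k))"

text \<open>The value 0 from index \<open>n\<close> on matches the padding of
  \<open>a\<close>.\<close>

definition img :: "nat \<Rightarrow> 'a list \<Rightarrow> (nat \<Rightarrow> 'a) \<Rightarrow> nat \<Rightarrow> 'a" where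
  "img off xs e i = (if i < n then comb off xs i e / comb (off + w) xs i e else 0)"

definition good :: "nat \<Rightarrow> 'a list \<Rightarrow> bool" where
  "good off xs \<longleftrightarrow> (\<forall>i\<in>{..<n}. comb (off + w) xs i a \<noteq> 0)"

text \<open>The second tuple followed by the first returns \<open>a\<close>, cross-multiplied. The
  nonvanishing here is a separate condition: \<open>good\<close> controls the denominators at
  \<open>a\<close>, not at the image under the second tuple.\<close>

definition inverse_pair :: "'a list \<Rightarrow> bool" where
  "inverse_pair xs \<longleftrightarrow> (\<forall>i\<in>{..<n}. comb w xs i (img (2 * w) xs a) \<noteq> 0 \<and>
     comb 0 xs i (img (2 * w) xs a) = a i * comb w xs i (img (2 * w) xs a))"

definition represents :: "'a list \<Rightarrow> bool" where
  "represents xs \<longleftrightarrow> (good 0 xs \<and> good (2 * w) xs) \<and>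
     (specialises (img 0 xs a) \<and> specialises (img (2 * w) xs a)) \<and> inverse_pair xs"

lemma index_bound: assumes "i < n" "k < m" shows "i * m + k < w"
proof -
  have "i * m + k < (i + 1) * m" using assms(2) by simp
  also have "\<dots> \<le> w" unfolding w_def using assms(1) by (intro mult_le_mono1) simp
  finally show ?thesis .
qed

lemma u_in_L: "k < m \<Longrightarrow> dtparams (u k) \<subseteq> L"
  using u KL by blast

lemma comb_polyfun:
  assumes "i < n" "off + w \<le> d'" shows "polyfun L d' (\<lambda>xs. comb off xs i a)"
  unfolding comb_def
proof (intro polyfun_sum polyfun.mult diff_subfieldD(1)[OF L])
  fix k assume k: "k \<in> {..<m}"
  show "polyfun L d' (\<lambda>xs. xs ! (off + i * m + k))"
    by (rule polyfun.var) (use index_bound[OF assms(1), of k] assms(2) k in auto)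
  have "dteval D a (u k) \<in> L" using dteval_in[OF L, of "u k" a] u_in_L a_in_L k by auto
  thus "polyfun L d' (\<lambda>xs. dteval D a (u k))" by (rule polyfun.const)
qed

lemma comb_ratfun:
  assumes "i < n" "off + w \<le> d'" "\<And>j. ratfun d' \<Omega> (\<lambda>xs. F xs j)"
  shows "ratfun d' \<Omega> (\<lambda>xs. comb off xs i (F xs))"
  unfolding comb_def
proof (intro ratfun_sum ratfun_mult)
  fix k assume k: "k \<in> {..<m}"
  show "ratfun d' \<Omega> (\<lambda>xs. xs ! (off + i * m + k))"
    by (rule ratfun_polyfun, rule polyfun.var) (use index_bound[OF assms(1), of k] assms(2) k in auto)
  show "ratfun d' \<Omega> (\<lambda>xs. dteval D (F xs) (u k))"
    by (rule ratfun_dteval[OF assms(3)]) (use u_in_L k in auto)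
qed

lemma img_ratfun:
  assumes "off + 2 * w \<le> d'" "\<And>xs. \<Omega> xs \<Longrightarrow> good off xs"
  shows "ratfun d' \<Omega> (\<lambda>xs. img off xs a j)"
proof (cases "j < n")
  case True
  have "polyfun L d' (\<lambda>xs. comb off xs j a)" "polyfun L d' (\<lambda>xs. comb (off + w) xs j a)"
    by (rule comb_polyfun[OF True]; use assms(1) in simp)+
  moreover have "\<forall>xs. const_tuple D d' xs \<and> \<Omega> xs \<longrightarrow>
      comb (off + w) xs j a \<noteq> 0 \<and> img off xs a j = comb off xs j a / comb (off + w) xs j a"
    using assms(2) True unfolding good_def img_def by auto
  ultimately show ?thesis unfolding ratfun_def frac_on_def by blast
next
  case False
  hence "(\<lambda>xs. img off xs a j) = (\<lambda>xs. 0)" unfolding img_def by simp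
  thus ?thesis by (simp add: ratfun_polyfun polyfun.const diff_subfieldD(1)[OF L])
qed

lemma good_qdef: "off + 2 * w \<le> d' \<Longrightarrow> qdef d' \<Omega> (good off)"
  unfolding good_def by (intro qdef_ball qdef_not qdef_polyfun comb_polyfun) auto

lemma specialises_qdef:
  assumes "off + 2 * w \<le> d'" "\<And>xs. \<Omega> xs \<Longrightarrow> good off xs"
  shows "qdef d' \<Omega> (\<lambda>xs. specialises (img off xs a))"
proof -
  define T where "T = {t. dtparams t \<subseteq> K \<and> dteval D a t = 0}"
  have "qdef d' \<Omega> (\<lambda>xs. \<forall>t\<in>T. dteval D (img off xs a) t = 0)"
  proof (rule qdef_ratfun_system)
    fix t assume "t \<in> T"
    thus "ratfun d' \<Omega> (\<lambda>xs. dteval D (img off xs a) t)"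
      by (intro ratfun_dteval img_ratfun assms) (use KL in \<open>auto simp: T_def\<close>)
  qed
  moreover have "specialises e \<longleftrightarrow> (\<forall>t\<in>T. dteval D e t = 0)" for e
    unfolding specialises_def T_def by blast
  ultimately show ?thesis by simp
qed

lemma represents_qdef: "qdef d (\<lambda>_. True) represents"
proof -
  have "qdef d (\<lambda>_. True) (\<lambda>xs. good 0 xs \<and> good (2 * w) xs)"
    by (intro qdef_and good_qdef) (auto simp: d_def)
  \<comment> \<open>The remaining conditions are rational in \<open>xs\<close> once the denominators
    at \<open>a\<close> are nonzero, so they are treated relative to \<open>good\<close>.\<close>
  moreover have "qdef d (\<lambda>xs. good 0 xs \<and> good (2 * w) xs)
     (\<lambda>xs. (specialises (img 0 xs a) \<and> specialises (img (2 * w) xs a)) \<and> inverse_pair xs)"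
    unfolding inverse_pair_def
  proof (intro qdef_and qdef_ball specialises_qdef)
    fix i assume i: "i \<in> {..<n}"
    have r: "ratfun d (\<lambda>xs. good 0 xs \<and> good (2 * w) xs) (\<lambda>xs. comb off xs i (img (2 * w) xs a))"
      if "off + w \<le> d" for off
      by (rule comb_ratfun) (use i that in \<open>auto simp: d_def intro!: img_ratfun\<close>)
    have wd: "w + w \<le> d" "0 + w \<le> d" by (auto simp: d_def)
    have zero: "ratfun d (\<lambda>xs. good 0 xs \<and> good (2 * w) xs) (\<lambda>xs. 0)"
      by (intro ratfun_polyfun polyfun.const diff_subfieldD(1)[OF L])
    show "qdef d (\<lambda>xs. good 0 xs \<and> good (2 * w) xs) (\<lambda>xs. comb w xs i (img (2 * w) xs a) \<noteq> 0)"
      by (intro qdef_not qdef_ratfun_eq r wd zero)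
    show "qdef d (\<lambda>xs. good 0 xs \<and> good (2 * w) xs)
      (\<lambda>xs. comb 0 xs i (img (2 * w) xs a) = a i * comb w xs i (img (2 * w) xs a))"
      by (intro qdef_ratfun_eq r wd ratfun_mult ratfun_polyfun polyfun.const a_in_L)
  qed (auto simp: d_def)
  ultimately show ?thesis unfolding represents_def by (rule qdef_relative)
qed

section \<open>From codes to automorphisms\<close>

text \<open>Now the tuple is fixed and the valuation varies; the entries of the tuple become
  parameters in \<open>C\<close>.\<close>

lemma comb_term:
  assumes "const_tuple D d xs" "i < n" "off + w \<le> d"
  shows "term_definable D (K \<union> C) (\<lambda>e. comb off xs i e)"
  unfolding comb_def
proof (intro term_definable_sum term_definable_mult)
  fix k assume k: "k \<in> {..<m}"
  have "D (xs ! (off + i * m + k)) = 0"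
    by (rule const_tuple_nth[OF assms(1)]) (use index_bound[OF assms(2), of k] assms(3) k in auto)
  thus "term_definable D (K \<union> C) (\<lambda>e. xs ! (off + i * m + k))" by (intro term_definable_const) (simp add: C_iff)
  show "term_definable D (K \<union> C) (\<lambda>e. dteval D e (u k))"
    by (rule term_definable_dteval) (use u k in auto)
qed (use diff_subfieldD(1)[OF K] in auto)

lemma dteval_img_frac:
  assumes xs: "const_tuple D d xs" and off: "off + 2 * w \<le> d" and t: "dtparams t \<subseteq> K"
  shows "frac_on (term_definable D (K \<union> C)) (\<lambda>e. \<forall>i\<in>{..<n}. comb (off + w) xs i e \<noteq> 0) (\<lambda>e. dteval D (img off xs e) t)"
proof (rule frac_on_dteval[where P = "term_definable D (K \<union> C)" and B = "K \<union> C", OF D])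
  have 1: "1 \<in> K" by (rule diff_subfieldD(2)[OF K])
  show "term_definable D (K \<union> C) (\<lambda>e. - f e)" if "term_definable D (K \<union> C) f" for f
    using that unfolding term_definable_def by (metis dteval.simps(5) dtparams.simps(5))
  show "1 \<in> K \<union> C" using 1 by blast
  show "dtparams t \<subseteq> K \<union> C" using t by blast
  show "\<exists>g. term_definable D (K \<union> C) g \<and> (\<forall>e. (\<forall>i\<in>{..<n}. comb (off + w) xs i e \<noteq> 0) \<longrightarrow> D (f e) = g e)"
    if "term_definable D (K \<union> C) f" for f using term_definable_D[OF that] by blast
  fix j
  show "frac_on (term_definable D (K \<union> C)) (\<lambda>e. \<forall>i\<in>{..<n}. comb (off + w) xs i e \<noteq> 0) (\<lambda>e. img off xs e j)"
  proof (cases "j < n")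
    case True
    have "term_definable D (K \<union> C) (\<lambda>e. comb off xs j e)" "term_definable D (K \<union> C) (\<lambda>e. comb (off + w) xs j e)"
      by (rule comb_term[OF xs True]; use off in simp)+
    moreover have "\<forall>e. (\<forall>i\<in>{..<n}. comb (off + w) xs i e \<noteq> 0) \<longrightarrow>
       comb (off + w) xs j e \<noteq> 0 \<and> img off xs e j = comb off xs j e / comb (off + w) xs j e"
      using True unfolding img_def by simp
    ultimately show ?thesis unfolding frac_on_def by blast
  next
    case False
    hence "(\<lambda>e. img off xs e j) = (\<lambda>e. 0)" unfolding img_def by simp
    moreover have "term_definable D (K \<union> C) (\<lambda>e. 0)" "term_definable D (K \<union> C) (\<lambda>e. 1)"
      using diff_subfieldD(1,2)[OF K] by (auto intro: term_definable_const)
    ultimately show ?thesis using frac_on_base[where P = "term_definable D (K \<union> C)"] by simp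
  qed
qed (auto intro: term_definable_add term_definable_mult term_definable_const)

text \<open>If \<open>t\<close> vanished at the image \<open>b\<close> of \<open>a\<close>, then so would its numerator, written in terms of \<open>a\<close> and
  constants.  Specialising \<open>a\<close> to the second tuple, whose image is \<open>a\<close>, gives \<open>t(a) = 0\<close>.\<close>

lemma img_reflects_zero:
  assumes xs: "const_tuple D d xs" "represents xs" and t: "dtparams t \<subseteq> K" "dteval D (img 0 xs a) t = 0"
  shows "dteval D a t = 0"
proof -
  note P = xs(2)[unfolded represents_def]
  have wd: "0 + 2 * w \<le> d" by (simp add: d_def)
  obtain f g where fg: "term_definable D (K \<union> C) f" "term_definable D (K \<union> C) g"
    "\<And>e. \<forall>i\<in>{..<n}. comb (0 + w) xs i e \<noteq> 0 \<Longrightarrow> g e \<noteq> 0 \<and> dteval D (img 0 xs e) t = f e / g e"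
    using dteval_img_frac[OF xs(1) wd t(1)] unfolding frac_on_def by blast
  obtain s where s: "dtparams s \<subseteq> K \<union> C" "\<And>e. dteval D e s = f e" using fg(1) unfolding term_definable_def by blast
  have "f a = 0" using fg(3)[of a] P t(2) unfolding good_def by auto
  hence "dteval D (img (2 * w) xs a) s = 0"
    using specialises_constants[OF _ s(1)] P s(2) by auto
  hence f0: "f (img (2 * w) xs a) = 0" using s(2) by simp
  have I: "comb w xs i (img (2 * w) xs a) \<noteq> 0"
    "comb 0 xs i (img (2 * w) xs a) = a i * comb w xs i (img (2 * w) xs a)" if "i < n" for i
    using P that unfolding inverse_pair_def by auto
  \<comment> \<open>Below \<open>n\<close> this is the inverse condition; from \<open>n\<close> on
    both sides are zero.\<close>
  have "img 0 xs (img (2 * w) xs a) = a"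
  proof
    fix i
    show "img 0 xs (img (2 * w) xs a) i = a i"
      unfolding img_def[of 0] using I[of i] by (auto simp: a_def)
  qed
  thus ?thesis using fg(3)[of "img (2 * w) xs a"] f0 I(1) by auto
qed

lemma represents_gal:
  assumes xs: "const_tuple D d xs" "represents xs"
  shows "\<exists>\<sigma>\<in>gal_set D K L. \<forall>i. \<sigma> (a i) = img 0 xs a i"
proof -
  have "dteval D a t = 0 \<longleftrightarrow> dteval D (img 0 xs a) t = 0" if "dtparams t \<subseteq> K" for t
    using img_reflects_zero[OF xs that] xs(2) that unfolding represents_def specialises_def by blast
  from hom_of_terms[OF a_in_L this] obtain \<tau> where \<tau>: "\<tau> \<in> diff_hom D K L" "\<forall>i. \<tau> (a i) = img 0 xs a i" by blast
  obtain \<sigma> where "\<sigma> \<in> gal_set D K L" "\<forall>x\<in>L. \<sigma> x = \<tau> x" using hom_extends_to_gal[OF \<tau>(1)] by blast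
  thus ?thesis using \<tau>(2) a_in_L by (intro bexI[of _ \<sigma>]) auto
qed

section \<open>From automorphisms to codes\<close>

text \<open>The coefficients are constants, which \<open>\<sigma>\<close> fixes, so it acts on the
  combination only through the generators.\<close>

lemma gal_comb:
  assumes \<sigma>: "\<sigma> \<in> gal_set D K L" and xs: "const_tuple D d' xs" and "i < n" "off + w \<le> d'" and e: "\<And>j. \<sigma> (a j) = e j"
  shows "\<sigma> (comb off xs i a) = comb off xs i e" "comb off xs i a \<in> M"
proof -
  note h = gal_hom[OF \<sigma>]
  have hM: "\<sigma> \<in> diff_hom D N M" using gal_iff \<sigma> by blast
  have c: "xs ! (off + i * m + k) \<in> C" if "k < m" for k
    using const_tuple_nth[OF xs, of "off + i * m + k"] index_bound[OF assms(3) that] assms(4) C_iff by simp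
  have l: "dteval D a (u k) \<in> L" if "k < m" for k
    using dteval_in[OF L, of "u k" a] u_in_L a_in_L that by auto
  have t: "xs ! (off + i * m + k) * dteval D a (u k) \<in> M" if "k < m" for k
    using c[OF that] l[OF that] M by (intro diff_subfieldD(4)[OF M(1)]) auto
  show "comb off xs i a \<in> M" unfolding comb_def by (rule diff_subfield_sum[OF M(1)]) (use t in auto)
  have "\<sigma> (dteval D a (u k)) = dteval D e (u k)" if "k < m" for k
    using dteval_diff_hom[OF h L KL, of "u k" a] u[OF that] a_in_L e by simp
  moreover have "\<sigma> (comb off xs i a) = (\<Sum>k<m. \<sigma> (xs ! (off + i * m + k) * dteval D a (u k)))"
    unfolding comb_def by (rule diff_hom_sum[OF hM M(1)]) (use t in auto)
  moreover have "\<sigma> (xs ! (off + i * m + k) * dteval D a (u k)) = xs ! (off + i * m + k) * \<sigma> (dteval D a (u k))"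
    if "k < m" for k
  proof -
    have "xs ! (off + i * m + k) \<in> M" "dteval D a (u k) \<in> M" using c[OF that] l[OF that] M by auto
    thus ?thesis using diff_homD(2)[OF hM] gal_fixes_C[OF \<sigma> c[OF that]] by metis
  qed
  ultimately show "\<sigma> (comb off xs i a) = comb off xs i e" unfolding comb_def by simp
qed

lemma gal_coefficients:
  assumes "\<sigma> \<in> gal_set D K L"
  obtains p q where "\<And>i k. D (p i k) = 0" "\<And>i k. D (q i k) = 0"
    "\<And>i. (\<Sum>k<m. q i k * dteval D a (u k)) \<noteq> 0"
    "\<And>i. \<sigma> (a i) * (\<Sum>k<m. q i k * dteval D a (u k)) = (\<Sum>k<m. p i k * dteval D a (u k))"
proof -
  have span: "\<exists>c. (\<forall>k. D (c k) = 0) \<and> y = (\<Sum>k<m. c k * dteval D a (u k))" if y: "y \<in> cspan D (set ls)" for y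
  proof -
    obtain c where c: "\<forall>l. D (c l) = 0" "y = (\<Sum>l\<in>set ls. c l * l)" using cspan_sum[OF D _ y] by blast
    \<comment> \<open>Distinctness of \<open>ls\<close> makes indices and elements correspond, so
      the sum over the set is a sum over positions.\<close>
    have "y = (\<Sum>k<m. c (ls ! k) * ls ! k)"
      unfolding c(2) by (rule sum.reindex_bij_betw[OF bij_betw_nth[OF ls refl refl], symmetric])
    thus ?thesis using c(1) u by (intro exI[of _ "\<lambda>k. c (ls ! k)"]) auto
  qed
  define Q where "Q i p q \<longleftrightarrow> (\<forall>k. D (p k) = 0 \<and> D (q k) = 0) \<and> (\<Sum>k<m. q k * dteval D a (u k)) \<noteq> 0 \<and>
     \<sigma> (a i) * (\<Sum>k<m. q k * dteval D a (u k)) = (\<Sum>k<m. p k * dteval D a (u k))" for i p q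
  have "\<exists>p q. Q i p q" for i
  proof -
    obtain p q where "p \<in> cspan D (set ls)" "q \<in> cspan D (set ls)" "q \<noteq> 0" "\<sigma> (a i) * q = p"
      using rep[OF gal_hom[OF assms]] by blast
    moreover obtain c c' where "\<forall>k. D (c k) = 0" "p = (\<Sum>k<m. c k * dteval D a (u k))"
      "\<forall>k. D (c' k) = 0" "q = (\<Sum>k<m. c' k * dteval D a (u k))"
      using span[OF calculation(1)] span[OF calculation(2)] by blast
    ultimately have "Q i c c'" unfolding Q_def by simp
    thus ?thesis by blast
  qed
  then obtain p q where "\<And>i. Q i (p i) (q i)" by metis
  thus thesis unfolding Q_def by (intro that[of p q]) simp_all
qed

text \<open>The uniform representation is used for the automorphism and for its inverse
  \<open>\<rho>\<close>. The inverse condition arises by applying \<open>\<rho>\<close> to the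
  equation that represents the image of \<open>a i\<close>.\<close>

lemma gal_represented:
  assumes \<sigma>: "\<sigma> \<in> gal_set D K L"
  shows "\<exists>xs. const_tuple D d xs \<and> represents xs \<and> (\<forall>i. \<sigma> (a i) = img 0 xs a i)"
proof -
  define \<rho> where "\<rho> = restrict (inv_into M \<sigma>) M"
  have \<rho>: "\<rho> \<in> gal_set D K L" unfolding \<rho>_def by (rule gal_inverse(1)[OF \<sigma>])
  have \<rho>\<sigma>: "\<rho> (\<sigma> x) = x" if "x \<in> M" for x
    using that gal_inverse(2)[OF \<sigma> that] gal_M[OF \<sigma> that] by (simp add: \<rho>_def)
  obtain p q where pq: "\<And>i k. D (p i k) = 0" "\<And>i k. D (q i k) = 0"
    "\<And>i. (\<Sum>k<m. q i k * dteval D a (u k)) \<noteq> 0"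
    "\<And>i. \<sigma> (a i) * (\<Sum>k<m. q i k * dteval D a (u k)) = (\<Sum>k<m. p i k * dteval D a (u k))"
    by (rule gal_coefficients[OF \<sigma>]) blast
  obtain p' q' where pq': "\<And>i k. D (p' i k) = 0" "\<And>i k. D (q' i k) = 0"
    "\<And>i. (\<Sum>k<m. q' i k * dteval D a (u k)) \<noteq> 0"
    "\<And>i. \<rho> (a i) * (\<Sum>k<m. q' i k * dteval D a (u k)) = (\<Sum>k<m. p' i k * dteval D a (u k))"
    by (rule gal_coefficients[OF \<rho>]) blast
  define F where "F s = (if s = 0 then p else if s = 1 then q else if s = 2 then p' else q')" for s :: nat
  have "\<exists>xs. const_tuple D d xs \<and> (\<forall>s<4. \<forall>i<n. \<forall>k<m. xs ! (s * w + i * m + k) = F s i k)"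
    unfolding d_def w_def by (rule tuple_of_blocks) (use pq(1,2) pq'(1,2) derivation_0[OF D] in \<open>auto simp: F_def\<close>)
  then obtain xs where xs: "const_tuple D d xs"
    "\<And>s i k. s < 4 \<Longrightarrow> i < n \<Longrightarrow> k < m \<Longrightarrow> xs ! (s * w + i * m + k) = F s i k" by blast
  have co: "comb 0 xs i e = (\<Sum>k<m. p i k * dteval D e (u k))" "comb w xs i e = (\<Sum>k<m. q i k * dteval D e (u k))"
    "comb (2 * w) xs i e = (\<Sum>k<m. p' i k * dteval D e (u k))" "comb (2 * w + w) xs i e = (\<Sum>k<m. q' i k * dteval D e (u k))"
    if "i < n" for i e
    unfolding comb_def
    using xs(2)[of 0 i] xs(2)[of 1 i] xs(2)[of 2 i] xs(2)[of 3 i] that by (auto simp: F_def add.commute)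
  have a0: "a i = 0" if "\<not> i < n" for i using that by (simp add: a_def)
  have hom0: "\<sigma> 0 = 0" "\<rho> 0 = 0" using diff_hom_0(1)[OF gal_hom L] \<sigma> \<rho> by auto
  have img: "img 0 xs a i = \<sigma> (a i)" for i
    using pq(3,4)[of i] co[of i a] a0[of i] hom0 by (auto simp: img_def divide_eq_eq split: if_splits)
  have img': "img (2 * w) xs a i = \<rho> (a i)" for i
    using pq'(3,4)[of i] co[of i a] a0[of i] hom0 by (auto simp: img_def divide_eq_eq split: if_splits)
  have "good 0 xs" "good (2 * w) xs" unfolding good_def using pq(3) pq'(3) co by auto
  moreover have spec: "specialises e" if s: "s \<in> gal_set D K L" and e: "\<And>i. e i = s (a i)" for s e
    unfolding specialises_def
  proof (intro allI impI)
    fix t assume t: "dtparams t \<subseteq> K" "dteval D a t = 0"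
    have "e = (\<lambda>i. s (a i))" using e by auto
    thus "dteval D e t = 0"
      using dteval_diff_hom[OF gal_hom[OF s] L KL t(1), of a] a_in_L t(2) diff_hom_0(1)[OF gal_hom[OF s] L] by simp
  qed
  moreover have "inverse_pair xs" unfolding inverse_pair_def
  proof (intro ballI conjI)
    fix i assume "i \<in> {..<n}"
    hence i: "i < n" by simp
    have wd: "0 + w \<le> d" "w + w \<le> d" by (auto simp: d_def)
    have e: "\<rho> (a j) = img (2 * w) xs a j" for j using img' by simp
    note g0 = gal_comb[OF \<rho> xs(1) i wd(1) e] and g1 = gal_comb[OF \<rho> xs(1) i wd(2) e]
    have \<rho>M: "\<rho> \<in> diff_hom D N M" using \<rho> gal_iff by blast
    have ne: "comb w xs i a \<noteq> 0" using pq(3) co i by auto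
    have "\<rho> (comb w xs i a) \<noteq> 0" using diff_hom_0(2)[OF \<rho>M M(1) g1(2)] ne by simp
    thus "comb w xs i (img (2 * w) xs a) \<noteq> 0" using g1(1) by simp
    have aM: "a i \<in> M" using a_in_L M(2) by blast
    \<comment> \<open>Under \<open>\<rho>\<close> the constants stay, \<open>a\<close> becomes the
      image under the second tuple, and the image of \<open>a i\<close> returns to
      \<open>a i\<close>.\<close>
    have "comb 0 xs i a = \<sigma> (a i) * comb w xs i a" using pq(4)[of i] co[OF i] by simp
    hence "\<rho> (comb 0 xs i a) = \<rho> (\<sigma> (a i)) * \<rho> (comb w xs i a)"
      using diff_homD(2)[OF \<rho>M gal_M[OF \<sigma> aM] g1(2)] by simp
    thus "comb 0 xs i (img (2 * w) xs a) = a i * comb w xs i (img (2 * w) xs a)"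
      using g0(1) g1(1) \<rho>\<sigma>[OF aM] by simp
  qed
  ultimately have "represents xs" unfolding represents_def using \<sigma> \<rho> img img' by blast
  thus ?thesis using xs(1) img by auto
qed

section \<open>Equality and composition of coded automorphisms\<close>

definition tau :: "'a list \<Rightarrow> 'a \<Rightarrow> 'a" where
  "tau xs = (SOME \<sigma>. \<sigma> \<in> gal_set D K L \<and> (\<forall>i. \<sigma> (a i) = img 0 xs a i))"

lemma tau:
  assumes "const_tuple D d xs" "represents xs"
  shows "tau xs \<in> gal_set D K L" "tau xs (a i) = img 0 xs a i"
proof -
  have "\<exists>\<sigma>. \<sigma> \<in> gal_set D K L \<and> (\<forall>i. \<sigma> (a i) = img 0 xs a i)" using represents_gal[OF assms] by blast
  from someI_ex[OF this] show "tau xs \<in> gal_set D K L" "tau xs (a i) = img 0 xs a i"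
    unfolding tau_def by blast+
qed

lemma tau_image: "tau ` {xs. const_tuple D d xs \<and> represents xs} = gal_set D K L"
proof
  show "tau ` {xs. const_tuple D d xs \<and> represents xs} \<subseteq> gal_set D K L" using tau(1) by auto
  show "gal_set D K L \<subseteq> tau ` {xs. const_tuple D d xs \<and> represents xs}"
  proof
    fix \<sigma> assume \<sigma>: "\<sigma> \<in> gal_set D K L"
    then obtain xs where xs: "const_tuple D d xs" "represents xs" "\<forall>i. \<sigma> (a i) = img 0 xs a i"
      using gal_represented by blast
    have "tau xs = \<sigma>" by (rule gal_eqI[OF tau(1)[OF xs(1,2)] \<sigma>]) (use xs tau(2)[OF xs(1,2)] in simp)
    thus "\<sigma> \<in> tau ` {xs. const_tuple D d xs \<and> represents xs}" using xs by blast
  qed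
qed

lemma good_nonzero: "represents xs \<Longrightarrow> i < n \<Longrightarrow> comb w xs i a \<noteq> 0"
  unfolding represents_def good_def by auto

lemma tau_eq_iff:
  assumes x: "const_tuple D d x" "represents x" and y: "const_tuple D d y" "represents y"
  shows "tau x = tau y \<longleftrightarrow> (\<forall>i\<in>{..<n}. comb 0 x i a * comb w y i a = comb 0 y i a * comb w x i a)"
proof -
  have "tau x = tau y \<longleftrightarrow> (\<forall>i. img 0 x a i = img 0 y a i)"
    using tau(2)[OF x] tau(2)[OF y] gal_eqI[OF tau(1)[OF x] tau(1)[OF y]] by metis
  also have "\<dots> \<longleftrightarrow> (\<forall>i\<in>{..<n}. img 0 x a i = img 0 y a i)" by (auto simp: img_def)
  also have "\<dots> \<longleftrightarrow> (\<forall>i\<in>{..<n}. comb 0 x i a * comb w y i a = comb 0 y i a * comb w x i a)"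
    using good_nonzero[OF x(2)] good_nonzero[OF y(2)] by (auto simp: img_def frac_eq_eq)
  finally show ?thesis .
qed

text \<open>Applying \<open>tau x\<close> to the equation that represents \<open>tau y (a i)\<close>
  keeps the coefficients of \<open>y\<close> and replaces \<open>a\<close> by its image under
  \<open>x\<close>. Thus the composite substitutes the image from \<open>x\<close> into the
  combinations from \<open>y\<close>, in this order, and equality with \<open>tau z\<close> is again
  a cross-multiplication.\<close>

lemma tau_compose_iff:
  assumes x: "const_tuple D d x" "represents x" and y: "const_tuple D d y" "represents y"
    and z: "const_tuple D d z" "represents z"
  shows "restrict (tau x \<circ> tau y) M = tau z \<longleftrightarrow>
    (\<forall>i\<in>{..<n}. comb 0 y i (img 0 x a) * comb w z i a = comb 0 z i a * comb w y i (img 0 x a))"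
proof -
  note tx = tau[OF x] and ty = tau[OF y] and tz = tau[OF z]
  have aM: "a i \<in> M" for i using a_in_L M(2) by blast
  have xM: "tau x \<in> diff_hom D N M" using tx(1) gal_iff by blast
  have wd: "0 + w \<le> d" "w + w \<le> d" by (auto simp: d_def)
  have comp: "tau x (tau y (a i)) = comb 0 y i (img 0 x a) / comb w y i (img 0 x a)"
    "comb w y i (img 0 x a) \<noteq> 0" if i: "i < n" for i
  proof -
    note g0 = gal_comb[OF tx(1) y(1) i wd(1) tx(2)] and g1 = gal_comb[OF tx(1) y(1) i wd(2) tx(2)]
    have ne: "comb w y i a \<noteq> 0" by (rule good_nonzero[OF y(2) i])
    show ne': "comb w y i (img 0 x a) \<noteq> 0"
      using diff_hom_0(2)[OF xM M(1) g1(2)] ne g1(1) by simp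
    have "tau y (a i) * comb w y i a = comb 0 y i a" using ty(2)[of i] i ne by (simp add: img_def)
    hence "tau x (tau y (a i)) * tau x (comb w y i a) = tau x (comb 0 y i a)"
      using diff_homD(2)[OF xM gal_M[OF ty(1) aM] g1(2)] by metis
    thus "tau x (tau y (a i)) = comb 0 y i (img 0 x a) / comb w y i (img 0 x a)"
      unfolding g0(1) g1(1) using ne' by (simp add: eq_divide_eq)
  qed
  have hom0: "tau y 0 = 0" "tau x 0 = 0" "tau z 0 = 0"
    using diff_hom_0(1)[OF gal_hom L] tx(1) ty(1) tz(1) by auto
  have "restrict (tau x \<circ> tau y) M = tau z \<longleftrightarrow> (\<forall>i. tau x (tau y (a i)) = tau z (a i))"
  proof
    assume "restrict (tau x \<circ> tau y) M = tau z"
    hence "restrict (tau x \<circ> tau y) M (a i) = tau z (a i)" for i by simp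
    thus "\<forall>i. tau x (tau y (a i)) = tau z (a i)" using aM by simp
  next
    assume "\<forall>i. tau x (tau y (a i)) = tau z (a i)"
    thus "restrict (tau x \<circ> tau y) M = tau z"
      by (intro gal_eqI[OF gal_compose[OF tx(1) ty(1)] tz(1)]) (use aM in simp)
  qed
  also have "\<dots> \<longleftrightarrow> (\<forall>i\<in>{..<n}. tau x (tau y (a i)) = tau z (a i))"
    using hom0 by (auto simp: a_def)
  also have "\<dots> \<longleftrightarrow> (\<forall>i\<in>{..<n}. comb 0 y i (img 0 x a) * comb w z i a = comb 0 z i a * comb w y i (img 0 x a))"
  proof (intro ball_cong refl)
    fix i assume "i \<in> {..<n}"
    hence i: "i < n" by simp
    show "tau x (tau y (a i)) = tau z (a i) \<longleftrightarrow> comb 0 y i (img 0 x a) * comb w z i a = comb 0 z i a * comb w y i (img 0 x a)"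
    proof -
      have "img 0 z a i = comb 0 z i a / comb w z i a" using i by (simp add: img_def)
      thus ?thesis unfolding comp(1)[OF i] tz(2) using frac_eq_eq[OF comp(2)[OF i] good_nonzero[OF z(2) i]] by simp
    qed
  qed
  finally show ?thesis .
qed

lemma comb_append:
  assumes "length x = d" "i < n" "off + w \<le> d"
  shows "comb off (x @ y) i e = comb off x i e" "comb (d + off') (x @ y) i e = comb off' y i e"
proof -
  have "(x @ y) ! (off + i * m + k) = x ! (off + i * m + k)" if "k < m" for k
    using index_bound[OF assms(2) that] assms(1,3) by (simp add: nth_append)
  thus "comb off (x @ y) i e = comb off x i e" unfolding comb_def by simp
  have "(x @ y) ! (d + off' + i * m + k) = y ! (off' + i * m + k)" for k
    using assms(1) by (simp add: nth_append add.assoc)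
  thus "comb (d + off') (x @ y) i e = comb off' y i e" unfolding comb_def by simp
qed

lemma img_append: "length x = d \<Longrightarrow> img 0 (x @ y) e = img 0 x e"
  unfolding img_def by (rule ext) (auto simp: comb_append d_def)

lemma galois_group_interpretable:
  "\<exists>(d::nat) \<phi>S \<phi>E \<phi>R S E R.
     d \<ge> 1 \<and>
     qparams \<phi>S \<subseteq> consts_of D K \<and> qparams \<phi>E \<subseteq> consts_of D K \<and>
     qparams \<phi>R \<subseteq> consts_of D K \<and>
     S = qf_defined (consts_of D UNIV) d \<phi>S \<and>
     E = {(x, y). x \<in> S \<and> y \<in> S \<and> x @ y \<in> qf_defined (consts_of D UNIV) (2 * d) \<phi>E} \<and>
     R = {(x, y, z). x \<in> S \<and> y \<in> S \<and> z \<in> S \<and>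
            x @ y @ z \<in> qf_defined (consts_of D UNIV) (3 * d) \<phi>R} \<and>
     equiv S E \<and>
     (\<exists>G :: 'a list set monoid.
        carrier G = S // E \<and>
        (\<forall>X\<in>S // E. \<forall>Y\<in>S // E. \<forall>Z\<in>S // E.
           X \<otimes>\<^bsub>G\<^esub> Y = Z \<longleftrightarrow> (\<exists>x\<in>X. \<exists>y\<in>Y. \<exists>z\<in>Z. (x, y, z) \<in> R)) \<and>
        group G \<and> G \<cong> gal_group D K L)"
proof -
  obtain \<phi>S where S: "qparams \<phi>S \<subseteq> CK" "\<And>xs. const_tuple D d xs \<Longrightarrow> qsat xs \<phi>S \<longleftrightarrow> represents xs"
    using represents_qdef unfolding qdef_def by auto
  \<comment> \<open>The code \<open>y\<close> starts at offset \<open>d\<close> in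
    \<open>x @ y\<close>; offsets are written \<open>d + 0\<close> and \<open>d + w\<close> to match
    \<open>comb_append\<close>.\<close>
  have "qdef (2 * d) (\<lambda>_. True) (\<lambda>zs. \<forall>i\<in>{..<n}. comb 0 zs i a * comb (d + w) zs i a = comb (d + 0) zs i a * comb w zs i a)"
    by (intro qdef_ball qdef_ratfun_eq ratfun_polyfun polyfun.mult comb_polyfun) (auto simp: d_def)
  then obtain \<phi>E where E: "qparams \<phi>E \<subseteq> CK" "\<And>zs. const_tuple D (2 * d) zs \<Longrightarrow>
     qsat zs \<phi>E \<longleftrightarrow> (\<forall>i\<in>{..<n}. comb 0 zs i a * comb (d + w) zs i a = comb (d + 0) zs i a * comb w zs i a)"
    unfolding qdef_def by auto
  \<comment> \<open>For a concatenation \<open>good 0\<close> speaks of the first code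
    \<open>x\<close>; it is what makes the image under \<open>x\<close> a rational function.\<close>
  have r: "ratfun (3 * d) (good 0) (\<lambda>zs. comb off zs i (img 0 zs a))" if "i < n" "off + w \<le> 3 * d" for off i
    by (rule comb_ratfun[OF that], rule img_ratfun) (auto simp: d_def)
  have "qdef (3 * d) (good 0) (\<lambda>zs. \<forall>i\<in>{..<n}. comb (d + 0) zs i (img 0 zs a) * comb (d + (d + w)) zs i a =
      comb (d + (d + 0)) zs i a * comb (d + w) zs i (img 0 zs a))"
    by (intro qdef_ball qdef_ratfun_eq ratfun_mult r ratfun_polyfun comb_polyfun) (auto simp: d_def)
  then obtain \<phi>R where R: "qparams \<phi>R \<subseteq> CK" "\<And>zs. const_tuple D (3 * d) zs \<Longrightarrow> good 0 zs \<Longrightarrow>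
     qsat zs \<phi>R \<longleftrightarrow> (\<forall>i\<in>{..<n}. comb (d + 0) zs i (img 0 zs a) * comb (d + (d + w)) zs i a =
      comb (d + (d + 0)) zs i a * comb (d + w) zs i (img 0 zs a))"
    unfolding qdef_def by auto
  define S where "S = qf_defined C d \<phi>S"
  have S_eq: "S = {xs. const_tuple D d xs \<and> represents xs}"
    unfolding S_def qf_defined_def using S(2) unfolding const_tuple_def by auto
  have Sl: "length x = d" "set x \<subseteq> C" if "x \<in> S" for x using that unfolding S_eq const_tuple_def by auto
  have wd: "0 + w \<le> d" "w + w \<le> d" by (auto simp: d_def)
  define E' where "E' = {(x, y). x \<in> S \<and> y \<in> S \<and> x @ y \<in> qf_defined C (2 * d) \<phi>E}"
  define R' where "R' = {(x, y, z). x \<in> S \<and> y \<in> S \<and> z \<in> S \<and> x @ y @ z \<in> qf_defined C (3 * d) \<phi>R}"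
  have Ei: "x @ y \<in> qf_defined C (2 * d) \<phi>E \<longleftrightarrow> tau x = tau y" if "x \<in> S" "y \<in> S" for x y
  proof -
    have t: "const_tuple D (2 * d) (x @ y)" using Sl that unfolding const_tuple_def by auto
    have "x @ y \<in> qf_defined C (2 * d) \<phi>E \<longleftrightarrow> qsat (x @ y) \<phi>E"
      using t unfolding qf_defined_def const_tuple_def by auto
    also have "\<dots> \<longleftrightarrow> (\<forall>i\<in>{..<n}. comb 0 x i a * comb w y i a = comb 0 y i a * comb w x i a)"
      unfolding E(2)[OF t]
    proof (intro ball_cong refl)
      fix i assume "i \<in> {..<n}"
      hence i: "i < n" by simp
      have l: "length x = d" using Sl that by auto
      show "comb 0 (x @ y) i a * comb (d + w) (x @ y) i a = comb (d + 0) (x @ y) i a * comb w (x @ y) i a \<longleftrightarrow>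
        comb 0 x i a * comb w y i a = comb 0 y i a * comb w x i a"
        unfolding comb_append(2)[OF l i wd(1)] comb_append(1)[OF l i wd(1)] comb_append(1)[OF l i wd(2)] ..
    qed
    also have "\<dots> \<longleftrightarrow> tau x = tau y" using tau_eq_iff[of x y] that unfolding S_eq by auto
    finally show ?thesis .
  qed
  have Ri: "x @ y @ z \<in> qf_defined C (3 * d) \<phi>R \<longleftrightarrow> tau x \<otimes>\<^bsub>gal_group D K L\<^esub> tau y = tau z"
    if "x \<in> S" "y \<in> S" "z \<in> S" for x y z
  proof -
    have t: "const_tuple D (3 * d) (x @ y @ z)" using Sl that unfolding const_tuple_def by auto
    have l: "length x = d" "length y = d" using Sl that by auto
    \<comment> \<open>The formula for \<open>R\<close> is correct only relative to
      \<open>good 0\<close>, which membership of \<open>x\<close> in \<open>S\<close>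
      guarantees.\<close>
    have g: "good 0 (x @ y @ z)"
      using that(1) wd unfolding S_eq represents_def good_def by (auto simp: comb_append(1)[OF l(1)])
    have "x @ y @ z \<in> qf_defined C (3 * d) \<phi>R \<longleftrightarrow> qsat (x @ y @ z) \<phi>R"
      using t unfolding qf_defined_def const_tuple_def by auto
    also have "\<dots> \<longleftrightarrow> (\<forall>i\<in>{..<n}. comb 0 y i (img 0 x a) * comb w z i a = comb 0 z i a * comb w y i (img 0 x a))"
      unfolding R(2)[OF t g] img_append[OF l(1)]
    proof (intro ball_cong refl)
      fix i assume "i \<in> {..<n}"
      hence i: "i < n" by simp
      show "comb (d + 0) (x @ y @ z) i (img 0 x a) * comb (d + (d + w)) (x @ y @ z) i a =
          comb (d + (d + 0)) (x @ y @ z) i a * comb (d + w) (x @ y @ z) i (img 0 x a) \<longleftrightarrow>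
        comb 0 y i (img 0 x a) * comb w z i a = comb 0 z i a * comb w y i (img 0 x a)"
        unfolding comb_append(2)[OF l(1) i wd(1)] comb_append(2)[OF l(2) i wd(1)]
          comb_append(1)[OF l(2) i wd(1)] comb_append(1)[OF l(2) i wd(2)] ..
    qed
    also have "\<dots> \<longleftrightarrow> tau x \<otimes>\<^bsub>gal_group D K L\<^esub> tau y = tau z"
      using tau_compose_iff[of x y z] that unfolding S_eq by (auto simp: gal_group_def Let_def M_def)
    finally show ?thesis .
  qed
  have im: "tau ` S = carrier (gal_group D K L)"
    unfolding S_eq tau_image by (simp add: gal_group_def Let_def)
  have E'_eq: "E' = {(x, y). x \<in> S \<and> y \<in> S \<and> tau x = tau y}" unfolding E'_def using Ei by auto
  have R'_eq: "R' = {(x, y, z). x \<in> S \<and> y \<in> S \<and> z \<in> S \<and> tau x \<otimes>\<^bsub>gal_group D K L\<^esub> tau y = tau z}"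
    unfolding R'_def using Ri by auto
  note T = quotient_group_transport[OF group_gal im E'_eq R'_eq]
  show ?thesis
    by (rule exI[of _ d], rule exI[of _ \<phi>S], rule exI[of _ \<phi>E], rule exI[of _ \<phi>R],
        rule exI[of _ S], rule exI[of _ E'], rule exI[of _ R'])
      (intro conjI S(1) E(1) R(1) S_def E'_def R'_def T[THEN conjunct1] T[THEN conjunct2], simp add: d_def)
qed

end

theorem theorem3p14:
  fixes D :: "'a::field_char_0 \<Rightarrow> 'a" and K L :: "'a set"
  assumes "diff_closed D"
    and "saturated D"
    and "(card_of L, card_of (UNIV::'a set)) \<in> ordLess"
    and "diff_subfield D K" and "diff_subfield D L" and "K \<subseteq> L"
    and "strongly_normal D K L"
  shows "\<exists>(d::nat) \<phi>S \<phi>E \<phi>R S E R.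
     d \<ge> 1 \<and>
     qparams \<phi>S \<subseteq> consts_of D K \<and> qparams \<phi>E \<subseteq> consts_of D K \<and>
     qparams \<phi>R \<subseteq> consts_of D K \<and>
     S = qf_defined (consts_of D UNIV) d \<phi>S \<and>
     E = {(x, y). x \<in> S \<and> y \<in> S \<and> x @ y \<in> qf_defined (consts_of D UNIV) (2 * d) \<phi>E} \<and>
     R = {(x, y, z). x \<in> S \<and> y \<in> S \<and> z \<in> S \<and>
            x @ y @ z \<in> qf_defined (consts_of D UNIV) (3 * d) \<phi>R} \<and>
     equiv S E \<and>
     (\<exists>G :: 'a list set monoid.
        carrier G = S // E \<and>
        (\<forall>X\<in>S // E. \<forall>Y\<in>S // E. \<forall>Z\<in>S // E.
           X \<otimes>\<^bsub>G\<^esub> Y = Z \<longleftrightarrow> (\<exists>x\<in>X. \<exists>y\<in>Y. \<exists>z\<in>Z. (x, y, z) \<in> R)) \<and>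
        group G \<and> G \<cong> gal_group D K L)"
proof -
  obtain F where F: "finite F" "L = dgen D (K \<union> F)" and str: "\<forall>\<tau>\<in>diff_hom D K L. strong D L \<tau>"
    using assms(7) unfolding strongly_normal_def by blast
  obtain fs where fs: "set fs = F" using finite_list[OF F(1)] by blast
  interpret strongly_normal_extension D K L fs
    by unfold_locales (use assms F fs str in auto)
  obtain X where X: "finite X" "X \<subseteq> R0"
    "\<forall>\<tau>\<in>diff_hom D K L. \<forall>i. \<exists>p\<in>cspan D X. \<exists>q\<in>cspan D X. q \<noteq> 0 \<and> \<tau> (a i) * q = p"
    using uniform_representation_generators by blast
  obtain ls where ls: "set ls = X" "distinct ls" using finite_distinct_list[OF X(1)] by blast
  have "\<forall>k. \<exists>t. k < length ls \<longrightarrow> dtparams t \<subseteq> K \<and> dteval D a t = ls ! k"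
  proof
    fix k
    show "\<exists>t. k < length ls \<longrightarrow> dtparams t \<subseteq> K \<and> dteval D a t = ls ! k"
    proof (cases "k < length ls")
      case True
      hence "ls ! k \<in> R0" using X(2) ls(1) by auto
      thus ?thesis unfolding R0_def by auto
    qed simp
  qed
  then obtain u where u: "\<And>k. k < length ls \<Longrightarrow> dtparams (u k) \<subseteq> K \<and> dteval D a (u k) = ls ! k" by metis
  interpret galois_interpretation D K L fs ls u
    by unfold_locales (use ls u X(3) in auto)
  show ?thesis by (rule galois_group_interpretable)
qed

end
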